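(* Let $\mathbb{H}$ be a separable Hilbert space, $E=\mathbb{H}$, $a>0$, $r\ge1$. Let $\Sigma_0\in\mathcal{S}(a,r)$ be a spiked covariance operator of rank $[r]$ with nonzero eigenvalues $\lambda=\gamma_1a$ and $\mu=\gamma_2a$, where $0<\gamma_2<\gamma_1<1$ are numerical constants. Let $\kappa:=\gamma_2\wedge(\gamma_1-\gamma_2)\wedge(1-\gamma_1)$ and suppose that $\delta$ satisfies the condition $$c_1\gamma_1a\sqrt{\tfrac rn}<\delta\le c_2\kappa a\wedge1$$ with sufficiently large $c_1\ge1$ and sufficiently small $c_2>0$. Let $U:=B(\Sigma_0,2\delta)$ and let $s>0$. Then $$\sup_{\|f\|_{C^{s,a}(U)}\le1}\ \inf_T\ \sup_{\Sigma\in\mathcal{S}(a,r),\,\|\Sigma-\Sigma_0\|<\delta}\bigl\|T(X_1,\dots,X_n)-f(\Sigma)\bigr\|_{L_2(\mathbb{P}_\Sigma)}\gtrsim_s\Bigl(\frac{\gamma_1}{\sqrt n}\vee\gamma_1^{s/2}\gamma_2^{s/2}\Bigl(\sqrt{\tfrac rn}\Bigr)^s\Bigr),$$ where the infimum is taken over all the estimators $T(X_1,\dots,X_n)$.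
   Context: Under $\mathbb{P}_\Sigma$, $X,X_1,\dots,X_n$ are i.i.d. centered Gaussian random variables in $\mathbb{H}$ with covariance operator $\Sigma$; $\|\cdot\|$ for operators is the operator norm; the effective rank is $\mathbf{r}(\Sigma)=\mathbb{E}\|X\|^2/\|\Sigma\|=\mathrm{tr}(\Sigma)/\|\Sigma\|$ (for $\Sigma\ne0$). $\mathcal{S}(a,r)$ is the set of covariance operators $\Sigma$ on $\mathbb{H}$ with $\|\Sigma\|\le a$ and $\mathbf{r}(\Sigma)\le r$. $[r]$ is the integer part of $r$. A covariance operator is called a spiked covariance of rank $d$ if its spectrum is $\{\lambda,\mu,0\}$ with $\lambda>\mu>0$, eigenvalue $\lambda$ of multiplicity $1$ and eigenvalue $\mu$ of multiplicity $d-1$. $B(\Sigma_0,\epsilon)$ is the open ball in the space of bounded operators on $\mathbb{H}$. An estimator is a measurable real function of the observations. For $s=k+\rho$, $k\ge0$ integer, $\rho\in(0,1]$, and $f$ $k$ times Fréchet continuously differentiable on an open set $U$, $\|f\|_{C^{s,a}(U)}=\max_{0\le j\le k}a^j\sup_{x\in U}\|f^{(j)}(x)\|\vee a^s\sup_{x,y\in U,x\ne y}\frac{\|f^{(k)}(x)-f^{(k)}(y)\|}{\|x-y\|^\rho}$, with operator norms of multilinear forms. $\|\eta\|_{L_2(\mathbb{P}_\Sigma)}=(\mathbb{E}_\Sigma|\eta|^2)^{1/2}$. $A\gtrsim_sB$ means $A\ge c_sB$ with a constant $c_s>0$ depending only on $s$; $c_1,c_2$ are numerical constants. $a\vee b=\max(a,b)$,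 $a\wedge b=\min(a,b)$. *)

theory Defs
  imports "HOL-Probability.Probability"
begin

text \<open>
  The Hilbert space \<open>H\<close> is a closed subspace of an ambient separable real Hilbert type, rather
  than the type itself, so that constants can be quantified before \<open>H\<close> and hence do not depend
  on it. Every separable Hilbert space is isometric to a closed subspace of any
  infinite-dimensional ambient type; \<open>H = UNIV\<close> gives the ambient space.
\<close>

section \<open>Bounded operators on a closed subspace\<close>

text \<open>
  \<open>L(H)\<close>: a bounded operator on \<open>H\<close> is identified with its extension by zero to the
  orthogonal complement of \<open>H\<close>; this preserves the operator norm.
\<close>

definition operators_on :: "'h::real_inner set \<Rightarrow> ('h \<Rightarrow>\<^sub>L 'h) set" where
  "operators_on H =
     {A. (\<forall>x. blinfun_apply A x \<in> H) \<and> (\<forall>x\<in>orthogonal_comp H. blinfun_apply A x = 0)}"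

definition op_spectrum :: "'h::real_inner set \<Rightarrow> ('h \<Rightarrow>\<^sub>L 'h) \<Rightarrow> real set" where
  "op_spectrum H A =
     {z. \<not> (\<exists>B\<in>operators_on H. \<forall>x\<in>H.
            blinfun_apply B (blinfun_apply A x - z *\<^sub>R x) = x \<and>
            blinfun_apply A (blinfun_apply B x) - z *\<^sub>R blinfun_apply B x = x)}"

definition eigenspace :: "'h::real_inner set \<Rightarrow> ('h \<Rightarrow>\<^sub>L 'h) \<Rightarrow> real \<Rightarrow> 'h set" where
  "eigenspace H A z = {x\<in>H. blinfun_apply A x = z *\<^sub>R x}"


section \<open>Gaussian measures and covariance operators\<close>

text \<open>
  \<open>P\<close> is the law of a centered Gaussian vector with covariance operator \<open>\<Sigma>\<close>: all linear
  functionals are centered normal, possibly degenerate. If \<open>\<Sigma> \<in> operators_on H\<close>, then \<open>P\<close>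
  is concentrated on the closed subspace \<open>H\<close>.
\<close>

definition centered_gaussian ::
    "'h::{real_inner, polish_space} measure \<Rightarrow> ('h \<Rightarrow>\<^sub>L 'h) \<Rightarrow> bool" where
  "centered_gaussian P \<Sigma> \<longleftrightarrow>
     prob_space P \<and> sets P = sets borel \<and>
     (\<forall>u. (AE x in P. x \<bullet> u = 0) \<or>
          (\<exists>\<sigma>>0. distributed P lborel (\<lambda>x. x \<bullet> u) (normal_density 0 \<sigma>))) \<and>
     (\<forall>u v. (\<integral>x. (x \<bullet> u) * (x \<bullet> v) \<partial>P) = blinfun_apply \<Sigma> u \<bullet> v)"

text \<open>A Borel measure on a separable Hilbert space is determined by its one-dimensional
  marginals, so there is at most one such law.\<close>

definition gaussian_law :: "('h \<Rightarrow>\<^sub>L 'h) \<Rightarrow> 'h::{real_inner, polish_space} measure" where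
  "gaussian_law \<Sigma> = (THE P. centered_gaussian P \<Sigma>)"

definition covariance_operator_on ::
    "'h::{real_inner, polish_space} set \<Rightarrow> ('h \<Rightarrow>\<^sub>L 'h) \<Rightarrow> bool" where
  "covariance_operator_on H \<Sigma> \<longleftrightarrow> \<Sigma> \<in> operators_on H \<and> (\<exists>P. centered_gaussian P \<Sigma>)"

definition effective_rank :: "('h::{real_inner, polish_space} \<Rightarrow>\<^sub>L 'h) \<Rightarrow> ennreal" where
  "effective_rank \<Sigma> = (\<integral>\<^sup>+x. ennreal ((norm x)\<^sup>2) \<partial>gaussian_law \<Sigma>) / ennreal (norm \<Sigma>)"

definition covariance_class ::
    "'h::{real_inner, polish_space} set \<Rightarrow> real \<Rightarrow> real \<Rightarrow> ('h \<Rightarrow>\<^sub>L 'h) set" where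
  "covariance_class H a r =
     {\<Sigma>. covariance_operator_on H \<Sigma> \<and> norm \<Sigma> \<le> a \<and> effective_rank \<Sigma> \<le> ennreal r}"

text \<open>
  For \<open>d \<ge> 2\<close> the multiplicities force \<open>\<nu>\<close> and \<open>\<mu>\<close> into the spectrum. It is only required to
  be contained in \<open>{\<nu>, \<mu>, 0}\<close> because \<open>\<mu>\<close> has multiplicity 0 when \<open>d = 1\<close>, and 0 is not
  in the spectrum when \<open>H\<close> has dimension \<open>d\<close>. The eigenspace of \<open>\<mu> > 0\<close> is finite-dimensional
  (\<open>\<Sigma>\<close> is compact), so \<open>dim\<close> does not take its default value 0 for infinite dimension.
\<close>

definition spiked_covariance ::
    "'h::{real_inner, polish_space} set \<Rightarrow> nat \<Rightarrow> real \<Rightarrow> real \<Rightarrow> ('h \<Rightarrow>\<^sub>L 'h) \<Rightarrow> bool" where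
  "spiked_covariance H d \<nu> \<mu> \<Sigma> \<longleftrightarrow>
     covariance_operator_on H \<Sigma> \<and> 0 < \<mu> \<and> \<mu> < \<nu> \<and>
     op_spectrum H \<Sigma> \<subseteq> {\<nu>, \<mu>, 0} \<and>
     dim (eigenspace H \<Sigma> \<nu>) = 1 \<and> dim (eigenspace H \<Sigma> \<mu>) = d - 1"


section \<open>Frechet derivatives and Hoelder norms\<close>

text \<open>
  A \<open>j\<close>-linear form on a subspace \<open>V\<close> is a function on lists, of which only the values on lists
  of length \<open>j\<close> with entries in \<open>V\<close> matter.
\<close>

definition multilinear_form_on :: "'a::real_vector set \<Rightarrow> nat \<Rightarrow> ('a list \<Rightarrow> real) \<Rightarrow> bool" where
  "multilinear_form_on V j M \<longleftrightarrow>
     (\<forall>xs ys. set xs \<subseteq> V \<and> set ys \<subseteq> V \<and> length xs + length ys + 1 = j \<longrightarrow>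
        (\<forall>v\<in>V. \<forall>w\<in>V. \<forall>b c.
           M (xs @ (b *\<^sub>R v + c *\<^sub>R w) # ys) = b * M (xs @ v # ys) + c * M (xs @ w # ys)))"

definition form_norm :: "'a::real_normed_vector set \<Rightarrow> nat \<Rightarrow> ('a list \<Rightarrow> real) \<Rightarrow> ennreal" where
  "form_norm V j M =
     (SUP vs\<in>{vs. length vs = j \<and> set vs \<subseteq> V \<inter> cball 0 1}. ennreal \<bar>M vs\<bar>)"

text \<open>
  \<open>f\<close> is \<open>k\<close> times continuously Frechet differentiable on the relatively open subset \<open>U\<close> of
  the normed space \<open>V\<close>, with derivatives \<open>D j x\<close>, the form norm being that of the bounded
  \<open>j\<close>-linear forms on \<open>V\<close>. The increment is the first argument of the derivative form.
\<close>

definition frechet_derivatives_on ::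
    "'a::real_normed_vector set \<Rightarrow> 'a set \<Rightarrow> nat \<Rightarrow> ('a \<Rightarrow> real) \<Rightarrow>
     (nat \<Rightarrow> 'a \<Rightarrow> 'a list \<Rightarrow> real) \<Rightarrow> bool" where
  "frechet_derivatives_on V U k f D \<longleftrightarrow>
     (\<forall>x\<in>U. D 0 x [] = f x) \<and>
     (\<forall>j\<le>k. \<forall>x\<in>U. multilinear_form_on V j (D j x) \<and> form_norm V j (D j x) < \<infinity>) \<and>
     (\<forall>j<k. \<forall>x\<in>U.
        ((\<lambda>y. form_norm V j (\<lambda>vs. D j y vs - D j x vs - D (Suc j) x ((y - x) # vs))
              / ennreal (norm (y - x))) \<longlongrightarrow> 0) (at x within U)) \<and>
     (\<forall>x\<in>U. ((\<lambda>y. form_norm V k (\<lambda>vs. D k y vs - D k x vs)) \<longlongrightarrow> 0) (at x within U))"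

text \<open>
  The \<open>C\<^bsup>s,a\<^esup>(U)\<close> norm, where \<open>s = k + \<rho>\<close> with \<open>k \<ge> 0\<close> an integer and \<open>0 < \<rho> \<le> 1\<close>. The
  derivatives are uniquely determined on a relatively open \<open>U\<close>, so the infimum only expresses
  that the norm is infinite if \<open>f\<close> is not \<open>k\<close> times continuously differentiable.
\<close>

definition holder_norm ::
    "'a::real_normed_vector set \<Rightarrow> real \<Rightarrow> real \<Rightarrow> 'a set \<Rightarrow> ('a \<Rightarrow> real) \<Rightarrow> ennreal" where
  "holder_norm V s a U f =
     (let k = nat (\<lceil>s\<rceil> - 1); \<rho> = s - real k in
      INF D\<in>{D. frechet_derivatives_on V U k f D}.
        max (SUP j\<in>{..k}. ennreal (a ^ j) * (SUP x\<in>U. form_norm V j (D j x)))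
            (ennreal (a powr s) *
              (SUP x\<in>U. SUP y\<in>U - {x}.
                 form_norm V k (\<lambda>vs. D k x vs - D k y vs) / ennreal (norm (x - y) powr \<rho>))))"


section \<open>Risk\<close>

definition L2_norm :: "'b measure \<Rightarrow> ('b \<Rightarrow> real) \<Rightarrow> ennreal" where
  "L2_norm P \<eta> =
     (let I = \<integral>\<^sup>+x. ennreal (\<bar>\<eta> x\<bar>\<^sup>2) \<partial>P in if I = \<infinity> then \<infinity> else ennreal (sqrt (enn2real I)))"

text \<open>Joint law of the i.i.d. observations \<open>X\<^sub>1, \<dots>, X\<^sub>n\<close>, indexed by \<open>{..<n}\<close>.\<close>

definition sample_law ::
    "nat \<Rightarrow> ('h \<Rightarrow>\<^sub>L 'h) \<Rightarrow> (nat \<Rightarrow> 'h::{real_inner, polish_space}) measure" where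
  "sample_law n \<Sigma> = PiM {..<n} (\<lambda>_. gaussian_law \<Sigma>)"

text \<open>The laws with covariance in \<open>operators_on H\<close> live on \<open>H\<close>, and a measurable function of
  \<open>n\<close> points of the closed set \<open>H\<close> extends measurably, so these are the estimators based on
  \<open>H\<close>-valued observations.\<close>

definition estimators :: "nat \<Rightarrow> ((nat \<Rightarrow> 'h::{real_inner, polish_space}) \<Rightarrow> real) set" where
  "estimators n = borel_measurable (PiM {..<n} (\<lambda>_. borel))"

end

(*
  Let u be the top unit eigenvector of Sigma_0. All alternatives are the laws of X + beta (X . u) v with X ~ N(0, Sigma_0),
  whose covariance moves Sigma_0 u = nu u to nu (1 + beta (u . v)) (u + beta v) and keeps the effective rank below r.
  Given the component of X orthogonal to v, only a one-dimensional normal law changes, so the likelihood ratio and its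
  second moment are explicit.

  For the rate gamma_1 / sqrt n take v = u and beta of order 1 / sqrt n, and test two points with a function
  sin((Sigma u . u - nu) / h).

  For the nonparametric rate, v ranges over exp(c r) well separated unit vectors of the mu-eigenspace (signs of a
  Gilbert-Varshamov code) and beta^2 is of order mu r / (nu n), so that n observations carry less information than the
  logarithm of the number of alternatives. The functions are sums of disjointly supported bumps of the vector Sigma u
  with signs given by a subset S of the code. If all of them, for all S, could be estimated well, then the code word
  could be decoded from the estimates, which a change of measure to Sigma_0 excludes.
*)

theory Submission
  imports Defs
begin

section \<open>Smooth functions with bounded derivatives\<close>

text \<open>The function \<open>f\<close> is known to the statistician: it stands outside the
  infimum over estimators, and estimating one signed sum of bumps yields only one bit about the code
  word. So the estimators for all \<open>2 ^ card C\<close> sign patterns are run on the same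
  sample. Two code words disagree on half of the patterns, hence at most one word contradicts fewer
  than a quarter of the estimates, and the decoding events are disjoint. All constants must be free
  of the dimension and of the size of the code. A bump depends on \<open>y \<bullet> y\<close> only,
  so the bounds on its derivatives do not see the dimension, and disjoint supports bound a sum of
  bumps like a single one. A bump of width \<open>h\<close> and Hoelder norm one has height of order
  \<open>(h / a) powr s\<close>, which is where the exponent comes from. For bounded rank there is
  no large code; the two-point argument at \<open>h = \<nu> / sqrt n\<close> then gives the second
  rate up to a constant, while \<open>h = a\<close> gives the first. Since
  \<open>gaussian_law\<close> is a definite description, its use rests on uniqueness of Gaussian
  laws, which is derived from the one-dimensional Levy theorem by cutting with half-spaces.\<close>

primrec iterated_deriv :: "('a::real_normed_vector \<Rightarrow> real) \<Rightarrow> 'a list \<Rightarrow> 'a \<Rightarrow> real" where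
  "iterated_deriv F [] = F"
| "iterated_deriv F (v # vs) = (\<lambda>y. frechet_derivative (iterated_deriv F vs) (at y) v)"

text \<open>All directional derivatives up to order \<open>n\<close> exist on \<open>\<Omega>\<close> and those of order \<open>j\<close> are at most
  \<open>K\<close> times the product of the norms of the \<open>j\<close> directions.\<close>

fun bounded_smooth :: "'a::real_normed_vector set \<Rightarrow> nat \<Rightarrow> real \<Rightarrow> ('a \<Rightarrow> real) \<Rightarrow> bool" where
  "bounded_smooth \<Omega> 0 K F \<longleftrightarrow> (\<forall>y\<in>\<Omega>. \<bar>F y\<bar> \<le> K)"
| "bounded_smooth \<Omega> (Suc n) K F \<longleftrightarrow> (\<forall>y\<in>\<Omega>. \<bar>F y\<bar> \<le> K \<and> F differentiable (at y)) \<and>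
     (\<forall>v. bounded_smooth \<Omega> n (K * norm v) (\<lambda>y. frechet_derivative F (at y) v))"

section \<open>Closure properties of bounded smoothness\<close>

lemma bounded_smooth_bound: "bounded_smooth \<Omega> n K F \<Longrightarrow> y \<in> \<Omega> \<Longrightarrow> \<bar>F y\<bar> \<le> K"
  by (cases n) auto

lemma bounded_smooth_mono: "bounded_smooth \<Omega> n K F \<Longrightarrow> K \<le> L \<Longrightarrow> bounded_smooth \<Omega> n L F"
proof (induction n arbitrary: K L F)
  case 0 then show ?case by force
next
  case (Suc n)
  have "bounded_smooth \<Omega> n (L * norm v) (\<lambda>y. frechet_derivative F (at y) v)" for v
    by (rule Suc.IH[of "K * norm v"]) (use Suc.prems in \<open>simp_all add: mult_right_mono\<close>)
  then show ?case using Suc.prems by force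
qed

lemma bounded_smooth_pred: "bounded_smooth \<Omega> (Suc n) K F \<Longrightarrow> bounded_smooth \<Omega> n K F"
proof (induction n arbitrary: K F)
  case (Suc n)
  then have "bounded_smooth \<Omega> n (K * norm v) (\<lambda>y. frechet_derivative F (at y) v)" for v
    by (metis bounded_smooth.simps(2))
  with Suc.prems show ?case by auto
qed auto

text \<open>\<open>frechet_derivative\<close> picks some derivative, and functions that agree on an
  open set have the same one there. This makes local formulas usable, such as that of a sum of bumps
  near one of the centres.\<close>

lemma bounded_smooth_cong:
  assumes "open \<Omega>" "\<And>y. y \<in> \<Omega> \<Longrightarrow> F y = G y" "bounded_smooth \<Omega> n K F"
  shows "bounded_smooth \<Omega> n K G"
  using assms(2,3)
proof (induction n arbitrary: K F G)
  case 0 then show ?case by auto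
next
  case (Suc n)
  have d: "(G has_derivative frechet_derivative F (at y)) (at y)" if "y \<in> \<Omega>" for y
    using Suc.prems that assms(1)
    by (metis bounded_smooth.simps(2) frechet_derivative_works has_derivative_transform_within_open)
  have "bounded_smooth \<Omega> n (K * norm v) (\<lambda>y. frechet_derivative G (at y) v)" for v
  proof (rule Suc.IH)
    show "frechet_derivative F (at y) v = frechet_derivative G (at y) v" if "y \<in> \<Omega>" for y
      using frechet_derivative_at[OF d[OF that]] by simp
    show "bounded_smooth \<Omega> n (K * norm v) (\<lambda>y. frechet_derivative F (at y) v)"
      using Suc.prems by simp
  qed
  then show ?case using Suc.prems d by (auto simp: differentiable_def)
qed

text \<open>Replaces the choice made by \<open>frechet_derivative\<close> by an explicit derivative,
  which is what the closure lemmas below compute.\<close>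

lemma bounded_smooth_SucI:
  assumes "open \<Omega>" "\<And>y. y \<in> \<Omega> \<Longrightarrow> \<bar>F y\<bar> \<le> K"
    "\<And>y. y \<in> \<Omega> \<Longrightarrow> (F has_derivative F' y) (at y)"
    "\<And>v. bounded_smooth \<Omega> n (K * norm v) (\<lambda>y. F' y v)"
  shows "bounded_smooth \<Omega> (Suc n) K F"
proof -
  have "bounded_smooth \<Omega> n (K * norm v) (\<lambda>y. frechet_derivative F (at y) v)" for v
    using assms(1) _ assms(4)
    by (rule bounded_smooth_cong) (use assms(3) frechet_derivative_at in metis)
  then show ?thesis using assms by (auto simp: differentiable_def)
qed

lemma bounded_smooth_has_derivative:
  "bounded_smooth \<Omega> (Suc n) K F \<Longrightarrow> y \<in> \<Omega> \<Longrightarrow>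
     (F has_derivative frechet_derivative F (at y)) (at y)"
  using frechet_derivative_works by auto

text \<open>Every condition concerns a single point, with derivatives taken in the whole space, so
  pieces glue without a finite cover and without loss in \<open>K\<close>.\<close>

lemma bounded_smooth_UN:
  "(\<And>i. i \<in> I \<Longrightarrow> bounded_smooth (S i) n K F) \<Longrightarrow> bounded_smooth (\<Union>i\<in>I. S i) n K F"
  by (induction n arbitrary: K F) auto

lemma bounded_smooth_const:
  assumes "open \<Omega>" "\<bar>c\<bar> \<le> K" shows "bounded_smooth \<Omega> n K (\<lambda>_. c)"
  using assms(2)
proof (induction n arbitrary: K c)
  case (Suc n)
  then show ?case
    by (intro bounded_smooth_SucI[OF assms(1), where F' = "\<lambda>_ _. 0"]) (auto intro!: Suc.IH)
qed auto

lemma bounded_smooth_add: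
  assumes "open \<Omega>" "bounded_smooth \<Omega> n K F" "bounded_smooth \<Omega> n L G"
  shows "bounded_smooth \<Omega> n (K + L) (\<lambda>y. F y + G y)"
  using assms(2,3)
proof (induction n arbitrary: K L F G)
  case 0 then show ?case by (force intro: order_trans[OF abs_triangle_ineq] add_mono)
next
  case (Suc n)
  note b = bounded_smooth_bound[OF Suc.prems(1)] bounded_smooth_bound[OF Suc.prems(2)]
  show ?case
  proof (rule bounded_smooth_SucI[OF assms(1)])
    show "((\<lambda>y. F y + G y) has_derivative
       (\<lambda>v. frechet_derivative F (at y) v + frechet_derivative G (at y) v)) (at y)" if "y \<in> \<Omega>" for y
      using Suc.prems that by (intro has_derivative_add bounded_smooth_has_derivative)
    show "bounded_smooth \<Omega> n ((K + L) * norm v)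
       (\<lambda>y. frechet_derivative F (at y) v + frechet_derivative G (at y) v)" for v
      using Suc.prems unfolding distrib_right by (intro Suc.IH) simp_all
    show "\<bar>F y + G y\<bar> \<le> K + L" if "y \<in> \<Omega>" for y using b[OF that] by linarith
  qed
qed

lemma bounded_smooth_cmult:
  assumes "open \<Omega>" "bounded_smooth \<Omega> n K F"
  shows "bounded_smooth \<Omega> n (\<bar>c\<bar> * K) (\<lambda>y. c * F y)"
  using assms(2)
proof (induction n arbitrary: K F)
  case 0 then show ?case by (auto simp: abs_mult mult_left_mono)
next
  case (Suc n)
  show ?case
  proof (rule bounded_smooth_SucI[OF assms(1)])
    show "((\<lambda>y. c * F y) has_derivative (\<lambda>v. c * frechet_derivative F (at y) v)) (at y)"
      if "y \<in> \<Omega>" for y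
      using Suc.prems that by (intro has_derivative_mult_right bounded_smooth_has_derivative)
    show "bounded_smooth \<Omega> n (\<bar>c\<bar> * K * norm v) (\<lambda>y. c * frechet_derivative F (at y) v)" for v
      using Suc.prems unfolding mult.assoc by - (rule Suc.IH, simp_all)
    show "\<bar>c * F y\<bar> \<le> \<bar>c\<bar> * K" if "y \<in> \<Omega>" for y
      using Suc.prems that by (auto simp: abs_mult mult_left_mono)
  qed
qed

text \<open>The product rule turns one product into two at each order, whence the factor
  \<open>2 ^ n\<close>.\<close>

lemma bounded_smooth_mult:
  assumes "open \<Omega>" "bounded_smooth \<Omega> n K F" "bounded_smooth \<Omega> n L G"
  shows "bounded_smooth \<Omega> n (2 ^ n * K * L) (\<lambda>y. F y * G y)"
  using assms(2,3)
proof (induction n arbitrary: K L F G)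
  case 0 then show ?case by (auto simp: abs_mult intro!: mult_mono')
next
  case (Suc n)
  note b = bounded_smooth_bound[OF Suc.prems(1)] bounded_smooth_bound[OF Suc.prems(2)]
  show ?case
  proof (rule bounded_smooth_SucI[OF assms(1)])
    show "((\<lambda>y. F y * G y) has_derivative
       (\<lambda>v. F y * frechet_derivative G (at y) v + frechet_derivative F (at y) v * G y)) (at y)"
      if "y \<in> \<Omega>" for y
      using Suc.prems that by (intro has_derivative_mult bounded_smooth_has_derivative)
    have "bounded_smooth \<Omega> n (2 ^ n * K * (L * norm v) + 2 ^ n * (K * norm v) * L)
       (\<lambda>y. F y * frechet_derivative G (at y) v + frechet_derivative F (at y) v * G y)" for v
      using Suc.prems bounded_smooth_pred[OF Suc.prems(1)] bounded_smooth_pred[OF Suc.prems(2)]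
      by (intro bounded_smooth_add[OF assms(1)] Suc.IH) (simp_all only: bounded_smooth.simps)
    then show "bounded_smooth \<Omega> n (2 ^ Suc n * K * L * norm v)
       (\<lambda>y. F y * frechet_derivative G (at y) v + frechet_derivative F (at y) v * G y)" for v
      by (simp add: algebra_simps)
    show "\<bar>F y * G y\<bar> \<le> 2 ^ Suc n * K * L" if "y \<in> \<Omega>" for y
    proof -
      have "\<bar>F y * G y\<bar> \<le> 1 * (K * L)"
        using b[OF that] by (auto simp: abs_mult intro!: mult_mono')
      also have "\<dots> \<le> 2 ^ Suc n * (K * L)"
        by (rule mult_right_mono)
          (use b[OF that] one_le_power[of "2::real" "Suc n"] in \<open>auto intro!: mult_nonneg_nonneg\<close>)
      finally show ?thesis by (simp add: mult.assoc)
    qed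
  qed
qed

text \<open>The derivative in direction \<open>w\<close> is the constant
  \<open>w \<bullet> v\<close>, without a factor \<open>R\<close>; with \<open>R \<ge> 1\<close> one
  constant serves all orders.\<close>

lemma bounded_smooth_inner_ball:
  fixes v :: "'a::real_inner"
  assumes "R \<ge> 1"
  shows "bounded_smooth (ball 0 R) n (R * norm v) (\<lambda>y. y \<bullet> v)"
proof (cases n)
  case 0
  then show ?thesis
    by (auto intro!: order_trans[OF Cauchy_Schwarz_ineq2] mult_right_mono)
next
  case (Suc m)
  have "bounded_smooth (ball 0 R) (Suc m) (R * norm v) (\<lambda>y. y \<bullet> v)"
  proof (rule bounded_smooth_SucI[where F' = "\<lambda>_ w. w \<bullet> v"])
    show "bounded_smooth (ball 0 R) m (R * norm v * norm w) (\<lambda>_. w \<bullet> v)" for w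
    proof (rule bounded_smooth_const)
      have "\<bar>w \<bullet> v\<bar> \<le> 1 * (norm v * norm w)"
        using Cauchy_Schwarz_ineq2[of w v] by (simp add: mult.commute)
      also have "\<dots> \<le> R * (norm v * norm w)" by (rule mult_right_mono) (use assms in auto)
      finally show "\<bar>w \<bullet> v\<bar> \<le> R * norm v * norm w" by (simp add: mult.assoc)
    qed auto
  qed (auto intro!: derivative_eq_intros order_trans[OF Cauchy_Schwarz_ineq2] mult_right_mono)
  with Suc show ?thesis by simp
qed

text \<open>Differentiation only shifts the phase by \<open>pi / 2\<close>, so the induction runs
  over all phases and the constant stays 1.\<close>

lemma bounded_smooth_sin_inner:
  fixes u :: "'a::real_inner"
  assumes "norm u \<le> 1"
  shows "bounded_smooth UNIV n 1 (\<lambda>y. sin (y \<bullet> u + \<alpha>))"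
proof (induction n arbitrary: \<alpha>)
  case (Suc n)
  show ?case
  proof (rule bounded_smooth_SucI)
    have s: "sin (y \<bullet> u + (\<alpha> + pi / 2)) = cos (y \<bullet> u + \<alpha>)" for y
      using sin_add[of "y \<bullet> u + \<alpha>" "pi / 2"] by (simp add: add.assoc)
    show "((\<lambda>y. sin (y \<bullet> u + \<alpha>)) has_derivative (\<lambda>v. (v \<bullet> u) * sin (y \<bullet> u + (\<alpha> + pi / 2)))) (at y)"
      for y
      unfolding s by (rule derivative_eq_intros refl | simp)+
    have "\<bar>v \<bullet> u\<bar> * 1 \<le> 1 * norm v" for v
      using Cauchy_Schwarz_ineq2[of v u] assms mult_left_mono[of "norm u" 1 "norm v"] by auto
    then show "bounded_smooth UNIV n (1 * norm v) (\<lambda>y. (v \<bullet> u) * sin (y \<bullet> u + (\<alpha> + pi / 2)))" for v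
      by (rule bounded_smooth_mono[OF bounded_smooth_cmult[OF open_UNIV Suc.IH]])
  qed auto
qed auto

text \<open>A contraction does not enlarge directions, so the chain rule keeps \<open>K\<close>. The
  main use is evaluation of operators at a unit vector.\<close>

lemma bounded_smooth_compose_affine:
  fixes A :: "'a::real_normed_vector \<Rightarrow> 'b::real_normed_vector"
  assumes "open \<Omega>" "bounded_linear A" "\<And>x. norm (A x) \<le> norm x" "0 \<le> K" "bounded_smooth \<Omega> n K F"
  shows "bounded_smooth ((\<lambda>x. A x + b) -` \<Omega>) n K (\<lambda>x. F (A x + b))"
  using assms(4,5)
proof (induction n arbitrary: K F)
  case (Suc n)
  have op: "open ((\<lambda>x. A x + b) -` \<Omega>)"
    by (intro open_vimage assms continuous_intros bounded_linear.continuous_on[OF assms(2)])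
  have A: "(A has_derivative A) (at x)" for x
    using assms(2) by (rule bounded_linear_imp_has_derivative)
  show ?case
  proof (rule bounded_smooth_SucI[OF op])
    show "((\<lambda>x. F (A x + b)) has_derivative (\<lambda>v. frechet_derivative F (at (A x + b)) (A v))) (at x)"
      if "x \<in> (\<lambda>x. A x + b) -` \<Omega>" for x
    proof (rule has_derivative_compose[where f = "\<lambda>x. A x + b" and g = F])
      show "((\<lambda>x. A x + b) has_derivative A) (at x)"
        using has_derivative_add[OF A has_derivative_const[of b]] by simp
      show "(F has_derivative frechet_derivative F (at (A x + b))) (at (A x + b))"
        using bounded_smooth_has_derivative[OF Suc.prems(2)] that by simp
    qed
    have *: "bounded_smooth ((\<lambda>x. A x + b) -` \<Omega>) n (K * norm (A v))
       (\<lambda>x. frechet_derivative F (at (A x + b)) (A v))" for v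
      by (rule Suc.IH[where F = "\<lambda>y. frechet_derivative F (at y) (A v)"]) (use Suc.prems in simp_all)
    show "bounded_smooth ((\<lambda>x. A x + b) -` \<Omega>) n (K * norm v)
       (\<lambda>x. frechet_derivative F (at (A x + b)) (A v))" for v
      by (rule bounded_smooth_mono[OF *]) (rule mult_left_mono[OF assms(3) Suc.prems(1)])
  qed (use Suc.prems in auto)
qed auto

subsection \<open>A bump function\<close>

text \<open>A truncated polynomial suffices because only finitely many derivatives are required: the
  exponent \<open>p\<close> is the smoothness budget, and each derivative lowers it by one.\<close>

definition bump :: "nat \<Rightarrow> 'a::real_inner \<Rightarrow> real" where
  "bump p y = max 0 (1 - y \<bullet> y) ^ p"

lemma has_real_derivative_max_power:
  "((\<lambda>x::real. max 0 x ^ Suc (Suc p)) has_real_derivative real (Suc (Suc p)) * max 0 x ^ Suc p) (at x)"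
proof (cases "x = 0")
  case False
  show ?thesis
  proof (cases "x > 0")
    case True
    have "((\<lambda>x::real. x ^ Suc (Suc p)) has_real_derivative real (Suc (Suc p)) * x ^ Suc p) (at x)"
      using DERIV_pow[of "Suc (Suc p)" x] by (simp del: power_Suc of_nat_Suc)
    then have "((\<lambda>x::real. max 0 x ^ Suc (Suc p)) has_real_derivative real (Suc (Suc p)) * x ^ Suc p) (at x)"
      by (rule has_field_derivative_transform_within_open[where S = "{0<..}"]) (use True in auto)
    then show ?thesis using True by simp
  next
    case neg: False
    have "((\<lambda>x::real. 0) has_real_derivative 0) (at x)" by simp
    then have "((\<lambda>x::real. max 0 x ^ Suc (Suc p)) has_real_derivative 0) (at x)"
      by (rule has_field_derivative_transform_within_open[where S = "{..<0}"]) (use neg False in auto)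
    then show ?thesis using neg by simp
  qed
next
  case True
  \<comment> \<open>At the kink the exponent is at least 2, so the difference quotient tends to 0
    from both sides.\<close>
  have *: "((\<lambda>y::real. max 0 y ^ Suc (Suc p) / y) \<longlongrightarrow> 0) (at 0)"
  proof (rule Lim_null_comparison)
    have "norm (max 0 y ^ Suc (Suc p) / y) \<le> max 0 y ^ Suc p" if "y \<noteq> 0" for y :: real
      using that by (cases "y > 0") auto
    then show "\<forall>\<^sub>F y in at 0. norm (max 0 y ^ Suc (Suc p) / y) \<le> max 0 y ^ Suc p"
      by (auto simp: eventually_at_filter)
    have "((\<lambda>y::real. max 0 y ^ Suc p) \<longlongrightarrow> max 0 0 ^ Suc p) (at 0)"
      by (intro tendsto_intros)
    then show "((\<lambda>y::real. max 0 y ^ Suc p) \<longlongrightarrow> 0) (at 0)" by simp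
  qed
  then show ?thesis using True by (simp add: has_field_derivative_iff)
qed

lemma bump_abs_le: "\<bar>bump p y\<bar> \<le> 1"
proof -
  have "max 0 (1 - y \<bullet> y) ^ p \<le> 1" by (rule power_le_one) auto
  then show ?thesis unfolding bump_def by simp
qed

lemma bump_has_derivative:
  "(bump (Suc (Suc p)) has_derivative (\<lambda>v. - 2 * real (Suc (Suc p)) * ((y \<bullet> v) * bump (Suc p) y))) (at y)"
proof -
  have "((\<lambda>y. 1 - y \<bullet> y) has_derivative (\<lambda>v. - 2 * (y \<bullet> v))) (at y)"
    by (auto intro!: derivative_eq_intros simp: inner_commute)
  from has_derivative_compose[OF this
      has_real_derivative_max_power[of p "1 - y \<bullet> y", unfolded has_field_derivative_def]]
  have "((\<lambda>y. max 0 (1 - y \<bullet> y) ^ Suc (Suc p)) has_derivative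
      (\<lambda>v. real (Suc (Suc p)) * max 0 (1 - y \<bullet> y) ^ Suc p * (- 2 * (y \<bullet> v)))) (at y)" .
  moreover have "(\<lambda>v. real (Suc (Suc p)) * max 0 (1 - y \<bullet> y) ^ Suc p * (- 2 * (y \<bullet> v))) =
     (\<lambda>v. - 2 * real (Suc (Suc p)) * ((y \<bullet> v) * bump (Suc p) y))"
    by (intro ext) (simp only: bump_def mult.assoc mult.commute mult.left_commute)
  ultimately show ?thesis unfolding bump_def by simp
qed

text \<open>Each derivative of a bump is a linear factor times a bump of lower exponent, which is
  why \<open>n < p\<close> is asked for. The linear factor is bounded only on bounded sets, hence
  the ball, whose radius 2 leaves room around the support.\<close>

lemma bounded_smooth_bump:
  "n < p \<Longrightarrow> \<exists>K\<ge>1. bounded_smooth (ball 0 2) n K (bump p :: 'a::real_inner \<Rightarrow> real)"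
proof (induction n arbitrary: p)
  case 0
  have "bounded_smooth (ball 0 2) 0 1 (bump p :: 'a \<Rightarrow> real)" using bump_abs_le by auto
  then show ?case by blast
next
  case (Suc n)
  then obtain q where p: "p = Suc (Suc q)" using less_iff_Suc_add[of "Suc n" p] by auto
  obtain K where K: "K \<ge> 1" "bounded_smooth (ball 0 2) n K (bump (Suc q) :: 'a \<Rightarrow> real)"
    using Suc.IH[of "Suc q"] Suc.prems p by auto
  define L where "L = 2 * real p * (2 ^ n * 2 * K) + 1"
  have L: "L \<ge> 1" "2 * real p * (2 ^ n * 2 * K) \<le> L" using K by (auto simp: L_def)
  have "bounded_smooth (ball 0 2) (Suc n) L (bump p :: 'a \<Rightarrow> real)"
  proof (rule bounded_smooth_SucI)
    show "(bump p has_derivative (\<lambda>v. - 2 * real p * ((y \<bullet> v) * bump (Suc q) y))) (at y)" for y :: 'a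
      unfolding p by (rule bump_has_derivative)
    have *: "bounded_smooth (ball 0 2) n (\<bar>- 2 * real p\<bar> * (2 ^ n * (2 * norm v) * K))
      (\<lambda>y. - 2 * real p * ((y \<bullet> v) * bump (Suc q) y))" for v :: 'a
      by (intro bounded_smooth_cmult bounded_smooth_mult bounded_smooth_inner_ball K open_ball) auto
    have "\<bar>- 2 * real p\<bar> * (2 ^ n * (2 * norm v) * K) = 2 * real p * (2 ^ n * 2 * K) * norm v" for v :: 'a
      by (simp add: algebra_simps)
    also have "\<dots> v \<le> L * norm v" for v :: 'a using L by (intro mult_right_mono) auto
    finally show "bounded_smooth (ball 0 2) n (L * norm v) (\<lambda>y. - 2 * real p * ((y \<bullet> v) * bump (Suc q) y))"
      for v :: 'a using bounded_smooth_mono[OF *] by blast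
  qed (use L bump_abs_le in \<open>auto intro: order_trans\<close>)
  then show ?case using L by blast
qed

lemma bump_eq_0: "norm y \<ge> 1 \<Longrightarrow> p > 0 \<Longrightarrow> bump p y = 0"
  using power_mono[of 1 "norm y" 2] by (auto simp: bump_def power2_norm_eq_inner)

text \<open>The space is covered by the balls of radius 2 about the centres and the complement of
  the closed unit balls. With centres at distance 3 at most one bump is alive on each piece, so the
  bound is that of a single bump, whatever the size of \<open>C\<close>.\<close>

lemma bounded_smooth_bump_sum:
  fixes z :: "'i \<Rightarrow> 'a::real_inner"
  assumes "finite C" "p > 0" and K: "K \<ge> 1" "bounded_smooth (ball 0 2) n K (bump p :: 'a \<Rightarrow> real)"
    and sep: "\<And>w w'. w \<in> C \<Longrightarrow> w' \<in> C \<Longrightarrow> w \<noteq> w' \<Longrightarrow> norm (z w - z w') \<ge> 3"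
    and \<epsilon>: "\<And>w. \<bar>\<epsilon> w\<bar> \<le> 1"
  shows "bounded_smooth UNIV n K (\<lambda>y. \<Sum>w\<in>C. \<epsilon> w * bump p (y - z w))"
proof -
  let ?F = "\<lambda>y. \<Sum>w\<in>C. \<epsilon> w * bump p (y - z w)"
  define S where "S = (\<lambda>w. case w of None \<Rightarrow> - (\<Union>w\<in>C. cball (z w) 1) | Some w \<Rightarrow> ball (z w) 2)"
  have "bounded_smooth (\<Union>i\<in>insert None (Some ` C). S i) n K ?F"
  proof (rule bounded_smooth_UN)
    fix i assume i: "i \<in> insert None (Some ` C)"
    show "bounded_smooth (S i) n K ?F"
    proof (cases i)
      case None
      have "open (S i)" using None assms(1) by (auto simp: S_def open_Compl)
      then show ?thesis
      proof (rule bounded_smooth_cong[where F = "\<lambda>_. 0"])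
        show "0 = ?F y" if "y \<in> S i" for y
          using that None assms(2)
          by (intro sum.neutral[symmetric]) (auto simp: S_def dist_norm norm_minus_commute intro!: bump_eq_0)
      qed (use \<open>open (S i)\<close> K in \<open>auto intro: bounded_smooth_const\<close>)
    next
      case (Some w)
      then have w: "w \<in> C" and Si: "S i = ball (z w) 2" using i by (auto simp: S_def)
      have "(\<lambda>x. x + - z w) -` ball 0 2 = ball (z w) 2"
        by (auto simp: dist_norm norm_minus_commute)
      then have "bounded_smooth (ball (z w) 2) n K (\<lambda>y. bump p (y + - z w))"
        using bounded_smooth_compose_affine[of "ball (0::'a) 2" "\<lambda>x. x" K n "bump p" "- z w"] K
        by (auto simp: bounded_linear_ident)
      then have "bounded_smooth (ball (z w) 2) n (\<bar>\<epsilon> w\<bar> * K) (\<lambda>y. \<epsilon> w * bump p (y + - z w))"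
        by (intro bounded_smooth_cmult) auto
      then have *: "bounded_smooth (ball (z w) 2) n K (\<lambda>y. \<epsilon> w * bump p (y + - z w))"
        by (rule bounded_smooth_mono) (use K \<epsilon>[of w] mult_right_mono[of "\<bar>\<epsilon> w\<bar>" 1 K] in auto)
      show ?thesis unfolding Si
      proof (rule bounded_smooth_cong[OF open_ball _ *])
        fix y assume y: "y \<in> ball (z w) 2"
        have "\<epsilon> w' * bump p (y - z w') = 0" if "w' \<in> C - {w}" for w'
        proof -
          have "norm (z w - z w') \<le> norm (y - z w) + norm (y - z w')"
            using norm_triangle_ineq4[of "y - z w'" "y - z w"] by (simp add: add.commute)
          then have "norm (y - z w') \<ge> 1"
            using sep[of w w'] that w y by (auto simp: dist_norm norm_minus_commute)
          then show ?thesis using assms(2) by (simp add: bump_eq_0)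
        qed
        then have "(\<Sum>w'\<in>C - {w}. \<epsilon> w' * bump p (y - z w')) = 0" by (rule sum.neutral[OF ballI])
        then show "\<epsilon> w * bump p (y + - z w) = ?F y"
          using w assms(1) by (simp add: sum.remove[of C w])
      qed
    qed
  qed
  moreover have "(\<Union>i\<in>insert None (Some ` C). S i) = UNIV"
    by (auto simp: S_def)
  ultimately show ?thesis by simp
qed

subsection \<open>Functions of Hoelder norm at most one\<close>

text \<open>\<open>iterated_deriv\<close> takes its last derivative in the direction at the head of
  the list, while \<open>bounded_smooth\<close> peels off the first derivative, whose direction is
  the last entry. The inductions below therefore split lists at the end.\<close>

lemma iterated_deriv_snoc:
  "iterated_deriv F (vs @ [v]) = iterated_deriv (\<lambda>y. frechet_derivative F (at y) v) vs"
  by (induction vs) auto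

lemma bounded_smooth_iterated_deriv_le:
  "bounded_smooth \<Omega> n K F \<Longrightarrow> length vs \<le> n \<Longrightarrow> y \<in> \<Omega> \<Longrightarrow>
     \<bar>iterated_deriv F vs y\<bar> \<le> K * prod_list (map norm vs)"
proof (induction n arbitrary: K F vs)
  case (Suc n)
  show ?case
  proof (cases vs rule: rev_cases)
    case Nil
    then show ?thesis using bounded_smooth_bound[OF Suc.prems(1,3)] by simp
  next
    case (snoc ws w)
    have "\<bar>iterated_deriv (\<lambda>y. frechet_derivative F (at y) w) ws y\<bar>
        \<le> K * norm w * prod_list (map norm ws)"
      by (rule Suc.IH) (use Suc.prems snoc in simp_all)
    then show ?thesis by (simp add: snoc iterated_deriv_snoc mult_ac)
  qed
qed auto

lemma bounded_smooth_iterated_deriv_has_derivative: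
  "bounded_smooth \<Omega> n K F \<Longrightarrow> length vs < n \<Longrightarrow> y \<in> \<Omega> \<Longrightarrow>
     (iterated_deriv F vs has_derivative (\<lambda>v. iterated_deriv F (v # vs) y)) (at y)"
proof (induction n arbitrary: K F vs)
  case (Suc n)
  show ?case
  proof (cases vs rule: rev_cases)
    case Nil
    then show ?thesis using bounded_smooth_has_derivative[OF Suc.prems(1,3)] by (simp add: Nil)
  next
    case (snoc ws w)
    have "(iterated_deriv (\<lambda>y. frechet_derivative F (at y) w) ws has_derivative
       (\<lambda>v. iterated_deriv (\<lambda>y. frechet_derivative F (at y) w) (v # ws) y)) (at y)"
      by (rule Suc.IH[of "K * norm w"]) (use Suc.prems snoc in simp_all)
    then show ?thesis by (simp add: snoc iterated_deriv_snoc)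
  qed
qed auto

text \<open>A tower of directional derivatives; the increment is prepended to the list of directions.\<close>

locale derivative_tower =
  fixes k :: nat and E :: "'a::real_normed_vector list \<Rightarrow> 'a \<Rightarrow> real" and K Q :: real
  assumes deriv: "length vs \<le> k \<Longrightarrow> (E vs has_derivative (\<lambda>v. E (v # vs) x)) (at x)"
    and bound: "length vs \<le> Suc k \<Longrightarrow> \<bar>E vs x\<bar> \<le> K * Q ^ length vs * prod_list (map norm vs)"
    and K: "K \<ge> 0" and Q: "Q > 0"
begin

text \<open>The first slot is linear because it is the argument of a derivative. Linearity in a
  later slot is an identity between functions of \<open>x\<close> for shorter lists; differentiating
  it and using uniqueness of derivatives adds a slot in front.\<close>

lemma multilinear:
  "length xs + length ys \<le> k \<Longrightarrow>
     E (xs @ (b *\<^sub>R v + c *\<^sub>R w) # ys) x = b * E (xs @ v # ys) x + c * E (xs @ w # ys) x"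
proof (induction xs arbitrary: x)
  case Nil
  then have lin: "linear (\<lambda>v. E (v # ys) x)" using deriv[of ys x] by (simp add: has_derivative_linear)
  show ?case using linear_add[OF lin] linear_scale[OF lin] by simp
next
  case (Cons z zs)
  have "((\<lambda>x. b * E (zs @ v # ys) x + c * E (zs @ w # ys) x) has_derivative
      (\<lambda>z. b * E (z # zs @ v # ys) x + c * E (z # zs @ w # ys) x)) (at x)"
    using Cons.prems by (intro has_derivative_add has_derivative_mult_right deriv) auto
  moreover have "(\<lambda>x. b * E (zs @ v # ys) x + c * E (zs @ w # ys) x) = E (zs @ (b *\<^sub>R v + c *\<^sub>R w) # ys)"
    using Cons by (intro ext) auto
  moreover have "(E (zs @ (b *\<^sub>R v + c *\<^sub>R w) # ys) has_derivative
      (\<lambda>z. E (z # zs @ (b *\<^sub>R v + c *\<^sub>R w) # ys) x)) (at x)"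
    using Cons.prems by (intro deriv) auto
  ultimately show ?case using has_derivative_unique by (fastforce dest: fun_cong[of _ _ z])
qed

lemma unit_bound:
  assumes "length vs \<le> Suc k" "set vs \<subseteq> cball 0 1"
  shows "\<bar>E vs x\<bar> \<le> K * Q ^ length vs"
proof -
  have "prod_list (map norm vs) \<le> 1" using assms(2)
    by (induction vs) (auto intro!: mult_le_one prod_list_nonneg)
  then have "K * Q ^ length vs * prod_list (map norm vs) \<le> K * Q ^ length vs * 1"
    using K Q by (intro mult_left_mono) auto
  then show ?thesis using bound[OF assms(1), of x] by simp
qed

lemma cons_bound:
  assumes "length vs \<le> k" "set vs \<subseteq> cball 0 1"
  shows "\<bar>E (v # vs) x\<bar> \<le> K * Q ^ Suc (length vs) * norm v"
proof -
  have "prod_list (map norm vs) \<le> 1" using assms(2)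
    by (induction vs) (auto intro!: mult_le_one prod_list_nonneg)
  then have "K * Q ^ Suc (length vs) * norm v * prod_list (map norm vs) \<le> K * Q ^ Suc (length vs) * norm v * 1"
    using K Q by (intro mult_left_mono) auto
  then show ?thesis using bound[of "v # vs" x] assms(1) by (simp add: mult.assoc)
qed

lemma lipschitz:
  assumes "length vs \<le> k" "set vs \<subseteq> cball 0 1"
  shows "\<bar>E vs y - E vs x\<bar> \<le> K * Q ^ Suc (length vs) * norm (y - x)"
proof -
  have "norm (E vs y - E vs x) \<le> K * Q ^ Suc (length vs) * norm (y - x)"
  proof (rule differentiable_bound[where S = UNIV and f' = "\<lambda>x v. E (v # vs) x"])
    show "onorm (\<lambda>v. E (v # vs) x) \<le> K * Q ^ Suc (length vs)" for x
      by (rule onorm_bound) (use cons_bound[OF assms] K Q in \<open>simp_all del: power_Suc\<close>)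
  qed (use deriv assms in auto)
  then show ?thesis by simp
qed

text \<open>Two applications of the mean value inequality, uniform over unit directions
  \<open>vs\<close>, as convergence in the form norm requires. The restriction
  \<open>length vs < k\<close> leaves two more derivatives that are bounded.\<close>

lemma taylor:
  assumes "length vs < k" "set vs \<subseteq> cball 0 1"
  shows "\<bar>E vs y - E vs x - E ((y - x) # vs) x\<bar> \<le> K * Q ^ (length vs + 2) * norm (y - x) * norm (y - x)"
proof -
  define g where "g = (\<lambda>z. E vs z - E ((z - x) # vs) x)"
  have lin: "bounded_linear (\<lambda>v. E (v # vs) x)"
    using deriv[of vs x] assms by (simp add: has_derivative_bounded_linear)
  have "norm (g y - g x) \<le> K * Q ^ (length vs + 2) * norm (y - x) * norm (y - x)"
  \<comment> \<open>On this ball \<open>norm (z - x) \<le> norm (y - x)\<close>, which bounds the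
    derivative of \<open>g\<close> uniformly.\<close>
  proof (rule differentiable_bound[where S = "cball x (norm (y - x))" and f' = "\<lambda>z v. E (v # vs) z - E (v # vs) x"])
    fix z assume z: "z \<in> cball x (norm (y - x))"
    have "((\<lambda>z. E ((z - x) # vs) x) has_derivative (\<lambda>v. E (v # vs) x)) (at z)"
      by (rule bounded_linear.has_derivative[OF lin, of "\<lambda>z. z - x" "\<lambda>v. v" "at z"])
        (auto intro!: derivative_eq_intros)
    then show "(g has_derivative (\<lambda>v. E (v # vs) z - E (v # vs) x)) (at z within cball x (norm (y - x)))"
      unfolding g_def using has_derivative_diff[OF deriv[of vs z]] assms
      by (auto intro: has_derivative_at_withinI)
    show "onorm (\<lambda>v. E (v # vs) z - E (v # vs) x) \<le> K * Q ^ (length vs + 2) * norm (y - x)"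
    proof (rule onorm_bound)
      show "0 \<le> K * Q ^ (length vs + 2) * norm (y - x)" using K Q by simp
      fix v
      have "norm (E (v # vs) z - E (v # vs) x) \<le> K * Q ^ (length vs + 2) * norm v * norm (z - x)"
      proof (rule differentiable_bound[where S = UNIV and f' = "\<lambda>z w. E (w # v # vs) z"])
        show "onorm (\<lambda>w. E (w # v # vs) z) \<le> K * Q ^ (length vs + 2) * norm v" for z
        proof (rule onorm_bound)
          show "0 \<le> K * Q ^ (length vs + 2) * norm v" using K Q by simp
          fix w
          have p: "prod_list (map norm vs) \<le> 1" using assms(2)
            by (induction vs) (auto intro!: mult_le_one prod_list_nonneg)
          have "\<bar>E (w # v # vs) z\<bar> \<le> K * Q ^ (length vs + 2) * (norm w * (norm v * prod_list (map norm vs)))"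
            using bound[of "w # v # vs" z] assms by simp
          also have "\<dots> \<le> K * Q ^ (length vs + 2) * (norm w * (norm v * 1))"
            using K Q p by (intro mult_left_mono) auto
          finally show "norm (E (w # v # vs) z) \<le> K * Q ^ (length vs + 2) * norm v * norm w"
            by (simp add: mult_ac)
        qed
      qed (use deriv assms in auto)
      also have "\<dots> \<le> K * Q ^ (length vs + 2) * norm v * norm (y - x)"
        using z K Q by (intro mult_left_mono) (auto simp: dist_norm norm_minus_commute)
      finally show "norm (E (v # vs) z - E (v # vs) x) \<le> K * Q ^ (length vs + 2) * norm (y - x) * norm v"
        by (simp add: mult_ac)
    qed
  qed (auto simp: dist_norm norm_minus_commute)
  moreover have "g y - g x = E vs y - E vs x - E ((y - x) # vs) x"
    using linear_0[OF bounded_linear.linear[OF lin]] by (simp add: g_def)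
  ultimately show ?thesis by simp
qed

lemma form_norm_le:
  assumes "\<And>vs. length vs = j \<Longrightarrow> set vs \<subseteq> cball 0 1 \<Longrightarrow> \<bar>M vs\<bar> \<le> B"
  shows "form_norm V j M \<le> ennreal B"
  unfolding form_norm_def using assms by (intro SUP_least ennreal_leI) auto

lemma tendsto_0_linear_bound:
  assumes "\<And>y. y \<noteq> x \<Longrightarrow> g y \<le> ennreal (B * norm (y - x))"
  shows "(g \<longlongrightarrow> 0) (at x within U)"
proof (rule tendsto_sandwich[OF _ _ tendsto_const])
  have "((\<lambda>y. ennreal (B * norm (y - x))) \<longlongrightarrow> ennreal (B * norm (x - x))) (at x within U)"
    by (intro tendsto_intros)
  then show "((\<lambda>y. ennreal (B * norm (y - x))) \<longlongrightarrow> 0) (at x within U)" by simp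
qed (auto simp: eventually_at_filter assms)

lemma frechet_derivatives_on: "frechet_derivatives_on V U k (E []) (\<lambda>j x vs. E vs x)"
  unfolding frechet_derivatives_on_def
proof (intro conjI ballI allI impI)
  show "multilinear_form_on V j (\<lambda>vs. E vs x)" if "j \<le> k" for j x
    using that unfolding multilinear_form_on_def by (auto intro!: multilinear)
  show "form_norm V j (\<lambda>vs. E vs x) < \<infinity>" if "j \<le> k" for j x
    by (rule order.strict_trans1[OF form_norm_le[of j _ "K * Q ^ j"]])
      (use that unit_bound[of _ x] in \<open>auto simp: less_top[symmetric]\<close>)
  show "((\<lambda>y. form_norm V j (\<lambda>vs. E vs y - E vs x - E ((y - x) # vs) x) / ennreal (norm (y - x)))
      \<longlongrightarrow> 0) (at x within U)" if "j < k" for j x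
  proof (rule tendsto_0_linear_bound)
    fix y assume "y \<noteq> x"
    have "form_norm V j (\<lambda>vs. E vs y - E vs x - E ((y - x) # vs) x)
        \<le> ennreal (K * Q ^ (j + 2) * norm (y - x) * norm (y - x))"
      using taylor that by (intro form_norm_le) auto
    then have "form_norm V j (\<lambda>vs. E vs y - E vs x - E ((y - x) # vs) x) / ennreal (norm (y - x))
        \<le> ennreal (K * Q ^ (j + 2) * norm (y - x) * norm (y - x)) / ennreal (norm (y - x))"
      by (rule divide_right_mono_ennreal)
    also have "\<dots> = ennreal (K * Q ^ (j + 2) * norm (y - x))"
      using \<open>y \<noteq> x\<close> K Q by (subst divide_ennreal) auto
    finally show "form_norm V j (\<lambda>vs. E vs y - E vs x - E ((y - x) # vs) x) / ennreal (norm (y - x))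
        \<le> ennreal (K * Q ^ (j + 2) * norm (y - x))" .
  qed
  show "((\<lambda>y. form_norm V k (\<lambda>vs. E vs y - E vs x)) \<longlongrightarrow> 0) (at x within U)" for x
    by (rule tendsto_0_linear_bound[of _ _ "K * Q ^ Suc k"], rule form_norm_le) (use lipschitz in auto)
qed auto

end

text \<open>Interpolates between the trivial bound 2 and the Lipschitz bound \<open>u\<close> for an
  increment, to reach the Hoelder exponent \<open>\<rho>\<close>.\<close>

lemma min_le_two_powr:
  fixes u \<rho> :: real
  assumes "0 \<le> u" "0 < \<rho>" "\<rho> \<le> 1"
  shows "min 2 u \<le> 2 * u powr \<rho>"
proof (cases "u \<le> 1")
  case True
  have "u \<le> u powr \<rho>"
    using powr_mono'[of \<rho> 1 u] assms True by (cases "u = 0") auto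
  then show ?thesis using powr_ge_zero[of u \<rho>] by linarith
next
  case False
  then have "1 \<le> u powr \<rho>" using assms by (intro ge_one_powr_ge_zero) auto
  then show ?thesis by linarith
qed

text \<open>Rescaling by \<open>h\<close> divides a derivative of order \<open>j\<close> by
  \<open>h ^ j\<close>. Since \<open>h \<le> a\<close> and \<open>j \<le> s\<close>, the prefactor
  \<open>(h / a) powr s\<close> compensates the weight \<open>a ^ j\<close>; the 2 in the
  denominator pays for the constant of \<open>min_le_two_powr\<close>.\<close>

lemma holder_norm_le_1:
  fixes F :: "'a::real_normed_vector \<Rightarrow> real"
  assumes s: "s > 0" "0 < h" "h \<le> a" and K: "K \<ge> 1"
    and F: "bounded_smooth UNIV (nat \<lceil>s\<rceil>) K F"
  shows "holder_norm V s a U (\<lambda>A. (h / a) powr s / (2 * K) * F (A /\<^sub>R h)) \<le> 1"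
proof -
  define k where "k = nat (\<lceil>s\<rceil> - 1)"
  define \<rho> where "\<rho> = s - real k"
  \<comment> \<open>This also holds for integer \<open>s\<close>, where \<open>\<rho> = 1\<close>.
    The derivative of order \<open>Suc k\<close> supplies the Lipschitz bound for order
    \<open>k\<close>.\<close>
  have sk: "nat \<lceil>s\<rceil> = Suc k" using s unfolding k_def by linarith
  have \<rho>: "0 < \<rho>" "\<rho> \<le> 1" using s unfolding \<rho>_def k_def by linarith+
  define C where "C = (h / a) powr s / (2 * K)"
  have C: "C \<ge> 0" using K by (simp add: C_def)
  have CK: "C * K = (h / a) powr s / 2" using K by (simp add: C_def)
  define E where "E = (\<lambda>vs x. C * (1 / h) ^ length vs * iterated_deriv F vs (x /\<^sub>R h))"
  interpret derivative_tower k E "C * K" "1 / h"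
  proof
    fix vs :: "'a list" and x
    show "(E vs has_derivative (\<lambda>v. E (v # vs) x)) (at x)" if "length vs \<le> k"
    proof -
      note d = bounded_smooth_iterated_deriv_has_derivative[OF F, of vs "x /\<^sub>R h"]
      have d': "(iterated_deriv F vs has_derivative (\<lambda>v. iterated_deriv F (v # vs) (x /\<^sub>R h))) (at (x /\<^sub>R h))"
        using d that sk by simp
      have "((\<lambda>x. iterated_deriv F vs (x /\<^sub>R h)) has_derivative
          (\<lambda>v. iterated_deriv F ((v /\<^sub>R h) # vs) (x /\<^sub>R h))) (at x)"
        by (rule has_derivative_compose[where f = "\<lambda>x. x /\<^sub>R h" and g = "iterated_deriv F vs"
              and f' = "\<lambda>v. v /\<^sub>R h" and g' = "\<lambda>v. iterated_deriv F (v # vs) (x /\<^sub>R h)"])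
          (use d' in \<open>auto intro!: derivative_eq_intros simp del: iterated_deriv.simps\<close>)
      moreover have "iterated_deriv F ((v /\<^sub>R h) # vs) (x /\<^sub>R h) = (1 / h) * iterated_deriv F (v # vs) (x /\<^sub>R h)" for v
        using linear_scale[OF has_derivative_linear[OF d'], of "inverse h" v] by (simp add: divide_inverse)
      ultimately have "((\<lambda>x. iterated_deriv F vs (x /\<^sub>R h)) has_derivative
          (\<lambda>v. (1 / h) * iterated_deriv F (v # vs) (x /\<^sub>R h))) (at x)" by simp
      from has_derivative_mult_right[OF this, of "C * (1 / h) ^ length vs"]
      show ?thesis by (simp add: E_def mult_ac)
    qed
    show "\<bar>E vs x\<bar> \<le> C * K * (1 / h) ^ length vs * prod_list (map norm vs)" if "length vs \<le> Suc k"
    proof -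
      have "\<bar>iterated_deriv F vs (x /\<^sub>R h)\<bar> \<le> K * prod_list (map norm vs)"
        using bounded_smooth_iterated_deriv_le[OF F] that sk by simp
      then have "C * (1 / h) ^ length vs * \<bar>iterated_deriv F vs (x /\<^sub>R h)\<bar>
          \<le> C * (1 / h) ^ length vs * (K * prod_list (map norm vs))"
        using C s by (intro mult_left_mono) auto
      then show ?thesis using C s by (simp add: E_def abs_mult mult_ac)
    qed
  qed (use C K s in auto)
  have fE: "(\<lambda>A. (h / a) powr s / (2 * K) * F (A /\<^sub>R h)) = E []"
    by (simp add: E_def C_def)
  have "holder_norm V s a U (E []) \<le>
      max (SUP j\<in>{..k}. ennreal (a ^ j) * (SUP x\<in>U. form_norm V j (\<lambda>vs. E vs x)))
            (ennreal (a powr s) *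
              (SUP x\<in>U. SUP y\<in>U - {x}.
                 form_norm V k (\<lambda>vs. E vs x - E vs y) / ennreal (norm (x - y) powr \<rho>)))"
    unfolding holder_norm_def Let_def k_def[symmetric] \<rho>_def[symmetric]
    by (rule INF_lower2[of "\<lambda>j x vs. E vs x"]) (use frechet_derivatives_on in auto)
  also have "\<dots> \<le> 1"
  proof (rule max.boundedI)
    show "(SUP j\<in>{..k}. ennreal (a ^ j) * (SUP x\<in>U. form_norm V j (\<lambda>vs. E vs x))) \<le> 1"
    proof (rule SUP_least)
      fix j assume j: "j \<in> {..k}"
      then have js: "real j \<le> s" using \<rho> by (auto simp: \<rho>_def)
      have "(SUP x\<in>U. form_norm V j (\<lambda>vs. E vs x)) \<le> ennreal (C * K * (1 / h) ^ j)"
        by (rule SUP_least, rule form_norm_le) (use unit_bound j in auto)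
      then have "ennreal (a ^ j) * (SUP x\<in>U. form_norm V j (\<lambda>vs. E vs x))
          \<le> ennreal (a ^ j) * ennreal (C * K * (1 / h) ^ j)"
        by (intro mult_left_mono) auto
      also have "\<dots> = ennreal (a ^ j * (C * K * (1 / h) ^ j))"
        using s C K by (simp add: ennreal_mult)
      also have "a ^ j * (C * K * (1 / h) ^ j) = (h / a) powr s * (h / a) powr (- real j) / 2"
        using s by (simp add: CK powr_minus powr_realpow power_divide field_simps)
      also have "\<dots> = (h / a) powr (s - real j) / 2" by (simp add: powr_add[symmetric])
      also have "\<dots> \<le> 1"
        using powr_le1[of "s - real j" "h / a"] s js by simp
      finally show "ennreal (a ^ j) * (SUP x\<in>U. form_norm V j (\<lambda>vs. E vs x)) \<le> 1"
        by (simp add: ennreal_leI)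
    qed
    have "(SUP x\<in>U. SUP y\<in>U - {x}.
        form_norm V k (\<lambda>vs. E vs x - E vs y) / ennreal (norm (x - y) powr \<rho>))
        \<le> ennreal (2 * (C * K) * (1 / h) ^ k * (1 / h) powr \<rho>)"
    proof (intro SUP_least)
      fix x y assume "y \<in> U - {x}"
      then have pos: "norm (x - y) powr \<rho> > 0" by auto
      have "form_norm V k (\<lambda>vs. E vs x - E vs y)
          \<le> ennreal (C * K * (1 / h) ^ k * (2 * (norm (x - y) / h) powr \<rho>))"
      proof (rule form_norm_le)
        fix vs assume vs: "length vs = k" "set vs \<subseteq> cball (0::'a) 1"
        have 1: "\<bar>E vs x - E vs y\<bar> \<le> C * K * (1 / h) ^ k * (norm (x - y) / h)"
          using lipschitz[of vs x y] vs by simp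
        have 2: "\<bar>E vs x - E vs y\<bar> \<le> C * K * (1 / h) ^ k * 2"
          using unit_bound[of vs x] unit_bound[of vs y] vs by simp
        have "\<bar>E vs x - E vs y\<bar> \<le> C * K * (1 / h) ^ k * min 2 (norm (x - y) / h)"
          using 1 2 by (simp add: min_def)
        also have "\<dots> \<le> C * K * (1 / h) ^ k * (2 * (norm (x - y) / h) powr \<rho>)"
          using min_le_two_powr[OF _ \<rho>, of "norm (x - y) / h"] C K s by (intro mult_left_mono) auto
        finally show "\<bar>E vs x - E vs y\<bar> \<le> C * K * (1 / h) ^ k * (2 * (norm (x - y) / h) powr \<rho>)" .
      qed
      also have "C * K * (1 / h) ^ k * (2 * (norm (x - y) / h) powr \<rho>)
          = (2 * (C * K) * (1 / h) ^ k * (1 / h) powr \<rho>) * norm (x - y) powr \<rho>"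
        using s by (simp add: powr_divide)
      finally have "form_norm V k (\<lambda>vs. E vs x - E vs y) / ennreal (norm (x - y) powr \<rho>)
         \<le> ennreal ((2 * (C * K) * (1 / h) ^ k * (1 / h) powr \<rho>) * norm (x - y) powr \<rho>)
            / ennreal (norm (x - y) powr \<rho>)"
        by (rule divide_right_mono_ennreal)
      also have "\<dots> = ennreal (2 * (C * K) * (1 / h) ^ k * (1 / h) powr \<rho>)"
        using pos C K s by (subst divide_ennreal) auto
      finally show "form_norm V k (\<lambda>vs. E vs x - E vs y) / ennreal (norm (x - y) powr \<rho>)
         \<le> ennreal (2 * (C * K) * (1 / h) ^ k * (1 / h) powr \<rho>)" .
    qed
    then have "ennreal (a powr s) * (SUP x\<in>U. SUP y\<in>U - {x}.
        form_norm V k (\<lambda>vs. E vs x - E vs y) / ennreal (norm (x - y) powr \<rho>))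
        \<le> ennreal (a powr s) * ennreal (2 * (C * K) * (1 / h) ^ k * (1 / h) powr \<rho>)"
      by (intro mult_left_mono) auto
    also have "\<dots> = ennreal (a powr s * (2 * (C * K) * (1 / h) ^ k * (1 / h) powr \<rho>))"
      using s C K by (simp add: ennreal_mult)
    also have "a powr s * (2 * (C * K) * (1 / h) ^ k * (1 / h) powr \<rho>) = 1"
    proof -
      have "(1 / h) ^ k * (1 / h) powr \<rho> = (1 / h) powr (real k + \<rho>)"
        using s by (simp add: powr_add powr_realpow)
      also have "real k + \<rho> = s" by (simp add: \<rho>_def)
      finally have "a powr s * (2 * (C * K) * (1 / h) ^ k * (1 / h) powr \<rho>) = a powr s * ((h / a) powr s * (1 / h) powr s)"
        by (simp add: CK)
      also have "\<dots> = (a * (h / a * (1 / h))) powr s" using s by (subst powr_mult) (simp_all add: powr_mult[symmetric])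
      finally show ?thesis using s by simp
    qed
    finally show "ennreal (a powr s) * (SUP x\<in>U. SUP y\<in>U - {x}.
        form_norm V k (\<lambda>vs. E vs x - E vs y) / ennreal (norm (x - y) powr \<rho>)) \<le> 1" by simp
  qed
  finally show ?thesis unfolding fE .
qed

section \<open>Uniqueness of Gaussian laws\<close>

lemma Re_char:
  assumes "real_distribution L"
  shows "Re (char L t) = (\<integral>x. cos (t * x + 0) \<partial>L)"
proof -
  interpret real_distribution L by fact
  have int: "integrable L (\<lambda>x. iexp (t * x))" by (rule integrable_iexp) auto
  show ?thesis unfolding char_def using integral_Re[OF int] by (simp add: Re_exp)
qed

lemma Im_char:
  assumes "real_distribution L"
  shows "Im (char L t) = (\<integral>x. cos (t * x + (- pi / 2)) \<partial>L)"
proof -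
  interpret real_distribution L by fact
  have int: "integrable L (\<lambda>x. iexp (t * x))" by (rule integrable_iexp) auto
  have s: "cos (y - pi / 2) = sin y" for y by (simp add: cos_diff)
  show ?thesis unfolding char_def using integral_Im[OF int] by (simp add: Im_exp s)
qed

text \<open>The phases 0 and \<open>- pi / 2\<close> recover the real and imaginary parts of the
  characteristic functions.\<close>

lemma real_distribution_eqI_cos:
  assumes M: "real_distribution M" and N: "real_distribution N"
    and eq: "\<And>t \<theta>. (\<integral>x. cos (t * x + \<theta>) \<partial>M) = (\<integral>x. cos (t * x + \<theta>) \<partial>N)"
  shows "M = N"
proof (rule Levy_uniqueness[OF M N], rule ext)
  fix t
  show "char M t = char N t" by (rule complex_eqI) (simp_all only: Re_char[OF M] Re_char[OF N] Im_char[OF M] Im_char[OF N] eq)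
qed

text \<open>A weight bounded away from 0 normalises to a probability density, and the law of
  \<open>x \<bullet> u\<close> under it is determined by its cosine integrals. Half-lines as test
  sets then give the weighted mass of half-spaces.\<close>

lemma weighted_marginal_eq:
  fixes P Q :: "'h::{real_inner, second_countable_topology} measure"
  assumes "prob_space P" "sets P = sets borel" "prob_space Q" "sets Q = sets borel"
    and g: "g \<in> borel_measurable borel" "\<And>x. 1 \<le> g x" "\<And>x. g x \<le> 3"
    and eq: "\<And>t \<phi>. (\<integral>x. g x * cos (t * (x \<bullet> u) + \<phi>) \<partial>P) = (\<integral>x. g x * cos (t * (x \<bullet> u) + \<phi>) \<partial>Q)"
  shows "(\<integral>x. g x * indicator {x. x \<bullet> u \<le> c} x \<partial>P) = (\<integral>x. g x * indicator {x. x \<bullet> u \<le> c} x \<partial>Q)"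
proof -
  have g3: "\<bar>g x\<bar> \<le> 3" for x using g(2)[of x] g(3)[of x] by linarith
  define m where "m = (\<integral>x. g x \<partial>P)"
  \<comment> \<open>At \<open>t = 0\<close> and \<open>\<phi> = 0\<close> the hypothesis says that
    the total masses agree.\<close>
  have mQ: "m = (\<integral>x. g x \<partial>Q)" using eq[of 0 0] by (simp add: m_def)
  define law where "law = (\<lambda>R. distr (density R (\<lambda>x. ennreal (g x / m))) borel (\<lambda>x::'h. x \<bullet> u))"
  have *: "real_distribution (law R) \<and>
     (\<forall>f. f \<in> borel_measurable borel \<longrightarrow> (\<integral>y. f y \<partial>law R) = (\<integral>x. g x * f (x \<bullet> u) \<partial>R) / m)"
    if R: "prob_space R" "sets R = sets borel" "m = (\<integral>x. g x \<partial>R)" for R :: "'h measure"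
  proof -
    interpret R: prob_space R by fact
    have [measurable_cong]: "sets R = sets borel" by fact
    have [measurable]: "g \<in> borel_measurable R" using g(1) by measurable
    have gi: "integrable R g"
      by (rule R.integrable_const_bound[of _ 3]) (use g3 in auto)
    have "(\<integral>x. 1 \<partial>R) \<le> m" unfolding R(3) using g(2) gi by (intro integral_mono) auto
    then have m: "m \<ge> 1" by (simp add: R.prob_space)
    have gm: "g x / m \<ge> 0" for x using g(2)[of x] m by simp
    have "(\<integral>\<^sup>+x. ennreal (g x / m) \<partial>R) = ennreal (\<integral>x. g x / m \<partial>R)"
      using gi gm by (intro nn_integral_eq_integral) auto
    also have "\<dots> = 1" using m by (simp add: R(3)[symmetric])
    finally have "prob_space (density R (\<lambda>x. ennreal (g x / m)))"
      by (intro prob_spaceI) (simp add: emeasure_density cong: nn_integral_cong)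
    then interpret D: prob_space "density R (\<lambda>x. ennreal (g x / m))" .
    have "real_distribution (law R)" unfolding law_def
      by (rule D.real_distribution_distr) measurable
    moreover have "(\<integral>y. f y \<partial>law R) = (\<integral>x. g x * f (x \<bullet> u) \<partial>R) / m"
      if [measurable]: "f \<in> borel_measurable borel" for f :: "real \<Rightarrow> real"
    proof -
      have "(\<integral>y. f y \<partial>law R) = (\<integral>x. f (x \<bullet> u) \<partial>density R (\<lambda>x. ennreal (g x / m)))"
        unfolding law_def by (rule integral_distr) measurable
      also have "\<dots> = (\<integral>x. (g x / m) *\<^sub>R f (x \<bullet> u) \<partial>R)"
        by (rule integral_density) (use gm in auto)
      finally show ?thesis by simp
    qed
    ultimately show ?thesis by blast
  qed
  note P = *[OF assms(1,2) m_def] and Q = *[OF assms(3,4) mQ]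
  have "m \<noteq> 0"
  proof
    assume "m = 0"
    interpret P: prob_space P by fact
    have "integrable P g"
      by (rule P.integrable_const_bound[of _ 3])
        (use g(1) g3 in \<open>auto simp: measurable_cong_sets[OF assms(2) refl]\<close>)
    then have "(\<integral>x. 1 \<partial>P) \<le> m" unfolding m_def using g(2) by (intro integral_mono) auto
    then show False using \<open>m = 0\<close> by (simp add: P.prob_space)
  qed
  have "law P = law Q"
  proof (rule real_distribution_eqI_cos)
    have "(\<lambda>x. cos (t * x + \<theta>)) \<in> borel_measurable borel" for t \<theta> :: real by measurable
    then show "(\<integral>x. cos (t * x + \<theta>) \<partial>law P) = (\<integral>x. cos (t * x + \<theta>) \<partial>law Q)" for t \<theta>
      using P Q eq by simp
  qed (use P Q in auto)
  have ind: "(\<lambda>y. indicator {..c} y :: real) \<in> borel_measurable borel" by measurable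
  have "(\<integral>x. g x * indicator {..c} (x \<bullet> u) \<partial>P) / m = (\<integral>y. indicator {..c} y \<partial>law P)"
    by (rule P[THEN conjunct2, rule_format, OF ind, symmetric])
  also have "\<dots> = (\<integral>x. g x * indicator {..c} (x \<bullet> u) \<partial>Q) / m"
    unfolding \<open>law P = law Q\<close> by (rule Q[THEN conjunct2, rule_format, OF ind])
  finally have "(\<integral>x. g x * indicator {..c} (x \<bullet> u) \<partial>P) = (\<integral>x. g x * indicator {..c} (x \<bullet> u) \<partial>Q)"
    using \<open>m \<noteq> 0\<close> by simp
  moreover have "indicator {..c} (x \<bullet> u) = (indicator {x. x \<bullet> u \<le> c} x :: real)" for x
    by (simp add: indicator_def)
  ultimately show ?thesis by simp
qed

lemma prod_cos: "cos a * cos b = (cos (a - b) + cos (a + b)) / (2::real)"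
  by (simp add: cos_add cos_diff)

text \<open>The signed function \<open>indicator A x * cos (x \<bullet> w + \<theta>)\<close>
  becomes an admissible weight after adding 2. Its cosine integrals reduce to the hypotheses by the
  product formula for cosines; the contribution of the constant 2 is removed by treating the
  constant weight in the same way.\<close>

lemma halfspace_inter_cos:
  fixes P Q :: "'h::{real_inner, second_countable_topology} measure"
  assumes PQ: "prob_space P" "sets P = sets borel" "prob_space Q" "sets Q = sets borel"
    and A[measurable]: "A \<in> sets borel"
    and eq: "\<And>w \<theta>. (\<integral>x. cos (x \<bullet> w + \<theta>) \<partial>P) = (\<integral>x. cos (x \<bullet> w + \<theta>) \<partial>Q)"
    and eqA: "\<And>w \<theta>. (\<integral>x. indicator A x * cos (x \<bullet> w + \<theta>) \<partial>P) = (\<integral>x. indicator A x * cos (x \<bullet> w + \<theta>) \<partial>Q)"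
  shows "(\<integral>x. indicator (A \<inter> {x. x \<bullet> u \<le> c}) x * cos (x \<bullet> w + \<theta>) \<partial>P)
     = (\<integral>x. indicator (A \<inter> {x. x \<bullet> u \<le> c}) x * cos (x \<bullet> w + \<theta>) \<partial>Q)"
proof -
  interpret P: prob_space P by fact
  interpret Q: prob_space Q by fact
  have [measurable_cong]: "sets P = sets borel" "sets Q = sets borel" by fact+
  have bi: "integrable P f" "integrable Q f" if "f \<in> borel_measurable borel" "\<And>x. \<bar>f x\<bar> \<le> 3" for f :: "'h \<Rightarrow> real"
    using that by (auto intro!: P.integrable_const_bound[of _ 3] Q.integrable_const_bound[of _ 3]
        simp: measurable_cong_sets[OF PQ(2) refl] measurable_cong_sets[OF PQ(4) refl])
  let ?I = "indicator A :: 'h \<Rightarrow> real"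
  have ab: "\<bar>?I x * cos y\<bar> \<le> 1" for x y
    by (auto simp: indicator_def)
  have ab3: "\<bar>?I x * cos y\<bar> \<le> 3" for x y using ab[of x y] by linarith
  have c3: "\<bar>2 * cos y\<bar> \<le> 3" "\<bar>cos y\<bar> \<le> 3" for y :: real
    using abs_cos_le_one[of y] by linarith+
  have *: "(\<integral>x. (2 + ?I x * cos (x \<bullet> w + \<theta>)) * cos (t * (x \<bullet> u) + \<phi>) \<partial>R) =
     2 * (\<integral>x. cos (x \<bullet> (t *\<^sub>R u) + \<phi>) \<partial>R) +
     ((\<integral>x. ?I x * cos (x \<bullet> (w - t *\<^sub>R u) + (\<theta> - \<phi>)) \<partial>R) +
      (\<integral>x. ?I x * cos (x \<bullet> (w + t *\<^sub>R u) + (\<theta> + \<phi>)) \<partial>R)) / 2"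
    if R: "R = P \<or> R = Q" for R t \<phi>
  proof -
    have i: "integrable R f" if "f \<in> borel_measurable borel" "\<And>x. \<bar>f x\<bar> \<le> 3" for f :: "'h \<Rightarrow> real"
      using bi[OF that] R by auto
    have "(2 + ?I x * cos (x \<bullet> w + \<theta>)) * cos (t * (x \<bullet> u) + \<phi>) =
      2 * cos (x \<bullet> (t *\<^sub>R u) + \<phi>) + (?I x * cos (x \<bullet> (w - t *\<^sub>R u) + (\<theta> - \<phi>)) / 2 +
       ?I x * cos (x \<bullet> (w + t *\<^sub>R u) + (\<theta> + \<phi>)) / 2)" for x
    proof -
      have a: "x \<bullet> (w - t *\<^sub>R u) + (\<theta> - \<phi>) = (x \<bullet> w + \<theta>) - (t * (x \<bullet> u) + \<phi>)"
        "x \<bullet> (w + t *\<^sub>R u) + (\<theta> + \<phi>) = (x \<bullet> w + \<theta>) + (t * (x \<bullet> u) + \<phi>)"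
        "x \<bullet> (t *\<^sub>R u) + \<phi> = t * (x \<bullet> u) + \<phi>"
        by (simp_all add: inner_diff_right inner_add_right)
      show ?thesis unfolding a distrib_right mult.assoc prod_cos by (simp add: field_simps)
    qed
    then show ?thesis
      using ab3 c3
      by (simp add: Bochner_Integration.integral_add i)
  qed
  have eq': "(\<integral>x. cos (t * (x \<bullet> u) + \<phi>) \<partial>P) = (\<integral>x. cos (t * (x \<bullet> u) + \<phi>) \<partial>Q)" for t \<phi>
    using eq[of "t *\<^sub>R u" \<phi>] by simp
  have 1: "(\<integral>x. (2 + ?I x * cos (x \<bullet> w + \<theta>)) * indicator {x. x \<bullet> u \<le> c} x \<partial>P)
     = (\<integral>x. (2 + ?I x * cos (x \<bullet> w + \<theta>)) * indicator {x. x \<bullet> u \<le> c} x \<partial>Q)"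
  proof (rule weighted_marginal_eq[OF PQ])
    show "1 \<le> 2 + ?I x * cos (x \<bullet> w + \<theta>)" "2 + ?I x * cos (x \<bullet> w + \<theta>) \<le> 3" for x
      using ab[of x "x \<bullet> w + \<theta>"] by linarith+
  qed (simp_all add: * eq' eqA)
  have 2: "(\<integral>x. 2 * indicator {x. x \<bullet> u \<le> c} x \<partial>P) = (\<integral>x. (2 :: real) * indicator {x. x \<bullet> u \<le> c} x \<partial>Q)"
  proof (rule weighted_marginal_eq[OF PQ])
    show "(\<integral>x. 2 * cos (t * (x \<bullet> u) + \<phi>) \<partial>P) = (\<integral>x. 2 * cos (t * (x \<bullet> u) + \<phi>) \<partial>Q)" for t \<phi>
      using eq[of "t *\<^sub>R u" \<phi>] by simp
  qed auto
  have h[measurable]: "{x. x \<bullet> u \<le> c} \<in> sets borel" by measurable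
  have 3: "(\<integral>x. (2 + ?I x * cos (x \<bullet> w + \<theta>)) * indicator {x. x \<bullet> u \<le> c} x \<partial>R)
     = (\<integral>x. 2 * indicator {x. x \<bullet> u \<le> c} x \<partial>R) +
       (\<integral>x. indicator (A \<inter> {x. x \<bullet> u \<le> c}) x * cos (x \<bullet> w + \<theta>) \<partial>R)" if R: "R = P \<or> R = Q" for R
  proof -
    have i: "integrable R f" if "f \<in> borel_measurable borel" "\<And>x. \<bar>f x\<bar> \<le> 3" for f :: "'h \<Rightarrow> real"
      using bi[OF that] R by auto
    have "(\<integral>x. 2 * indicator {x. x \<bullet> u \<le> c} x + indicator (A \<inter> {x. x \<bullet> u \<le> c}) x * cos (x \<bullet> w + \<theta>) \<partial>R) =
      (\<integral>x. 2 * indicator {x. x \<bullet> u \<le> c} x \<partial>R) +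
       (\<integral>x. indicator (A \<inter> {x. x \<bullet> u \<le> c}) x * cos (x \<bullet> w + \<theta>) \<partial>R)"
      by (intro Bochner_Integration.integral_add i) (use c3 in \<open>auto simp: indicator_def\<close>)
    then show ?thesis by (simp add: indicator_inter_arith algebra_simps)
  qed
  show ?thesis using 1 2 3[of P] 3[of Q] by simp
qed

text \<open>Built by cutting with one half-space at a time, so that the induction matches
  \<open>halfspace_inter_cos\<close>. The family serves as an intersection-stable generator of the
  Borel sets.\<close>

inductive_set halfspace_inters :: "'h::real_inner set set" where
  UNIV: "UNIV \<in> halfspace_inters"
| Int: "A \<in> halfspace_inters \<Longrightarrow> A \<inter> {x. x \<bullet> u \<le> c} \<in> halfspace_inters"

lemma halfspace_inters_measurable:
  "A \<in> halfspace_inters \<Longrightarrow> A \<in> sets (borel :: 'h::{real_inner, second_countable_topology} measure)"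
  by (induction rule: halfspace_inters.induct) auto

lemma Int_stable_halfspace_inters: "Int_stable halfspace_inters"
proof (rule Int_stableI)
  fix A B :: "'a set" assume A: "A \<in> halfspace_inters" and "B \<in> halfspace_inters"
  from this(2) A show "A \<inter> B \<in> halfspace_inters"
    by (induction B rule: halfspace_inters.induct)
      (auto simp: Int_assoc[symmetric] intro: halfspace_inters.intros)
qed

text \<open>A closed ball is the intersection of half-spaces with normals in a countable dense set,
  and an open set is a countable union of closed balls with rational radii and centres in that
  set.\<close>

lemma sets_borel_eq_halfspace_inters:
  "sets (borel :: 'h::{real_inner, second_countable_topology} measure) = sigma_sets UNIV halfspace_inters"
proof
  show "sigma_sets UNIV halfspace_inters \<subseteq> sets (borel :: 'h measure)"
    using halfspace_inters_measurable sets.sigma_sets_subset[of halfspace_inters "borel :: 'h measure"] by auto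
next
  obtain D :: "'h set" where D: "countable D" "\<And>X. open X \<Longrightarrow> X \<noteq> {} \<Longrightarrow> \<exists>d\<in>D. d \<in> X"
    using countable_dense_exists by metis
  let ?S = "sigma_sets UNIV (halfspace_inters :: 'h set set)"
  interpret S: sigma_algebra UNIV ?S by (rule sigma_algebra_sigma_sets) auto
  have hs: "{x. x \<bullet> u \<le> c} \<in> ?S" for u :: 'h and c
    using halfspace_inters.Int[OF halfspace_inters.UNIV, of u c] by (auto intro: sigma_sets.Basic)
  have cball: "cball d q \<in> ?S" if "q > 0" for d :: 'h and q
  proof -
    have "cball d q = (\<Inter>u\<in>D. {x. x \<bullet> u \<le> q * norm u + d \<bullet> u})" (is "_ = ?R")
    proof
      show "cball d q \<subseteq> ?R"
      proof clarify
        fix x and u :: 'h assume "x \<in> cball d q"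
        then have "norm (x - d) * norm u \<le> q * norm u"
          by (intro mult_right_mono) (auto simp: dist_norm norm_minus_commute)
        then show "x \<bullet> u \<le> q * norm u + d \<bullet> u"
          using norm_cauchy_schwarz[of "x - d" u] by (simp add: inner_diff_left)
      qed
      show "?R \<subseteq> cball d q"
      proof
        fix x assume x: "x \<in> ?R"
        show "x \<in> cball d q"
        proof (rule ccontr)
          assume "x \<notin> cball d q"
          then have "q < norm (x - d)" by (simp add: dist_norm norm_minus_commute)
          \<comment> \<open>The normal \<open>x - d\<close> separates \<open>x\<close> strictly from
            the ball; strict separation is an open condition on the normal, so some element of
            \<open>D\<close> does it too.\<close>
          let ?X = "{u. (x - d) \<bullet> u - q * norm u > 0}"
          have "open ?X" by (intro open_Collect_less continuous_intros)
          moreover have "\<exists>u. u \<in> ?X"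
          proof -
            have "q * norm (x - d) < norm (x - d) * norm (x - d)" using \<open>q < _\<close> \<open>q > 0\<close>
              by (intro mult_strict_right_mono) auto
            then have "x - d \<in> ?X" by (simp add: power2_norm_eq_inner[symmetric] power2_eq_square)
            then show ?thesis by blast
          qed
          ultimately obtain u where "u \<in> D" "u \<in> ?X" using D(2)[of ?X] by blast
          then show False using x by (auto simp: inner_diff_left)
        qed
      qed
    qed
    then show ?thesis using D(1) hs by (auto intro!: S.countable_INT'')
  qed
  have "U \<in> ?S" if "open U" for U :: "'h set"
  proof -
    let ?I = "{(d, q). d \<in> D \<and> q \<in> \<rat> \<and> q > 0 \<and> cball d q \<subseteq> U}"
    have "U = (\<Union>(d, q)\<in>?I. cball d q)"
    proof
      show "U \<subseteq> (\<Union>(d, q)\<in>?I. cball d q)"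
      proof
        fix x assume "x \<in> U"
        then obtain e where e: "e > 0" "cball x e \<subseteq> U" using \<open>open U\<close> open_contains_cball by blast
        obtain q where q: "q \<in> \<rat>" "0 < q" "q < e / 2" using Rats_dense_in_real[of 0 "e / 2"] e by auto
        obtain d where d: "d \<in> D" "d \<in> ball x q" using D(2)[of "ball x q"] q by auto
        have "cball d q \<subseteq> cball x e"
        proof
          fix y assume "y \<in> cball d q"
          then show "y \<in> cball x e" using d q dist_triangle[of x y d] by auto
        qed
        then have "(d, q) \<in> ?I" "x \<in> cball d q" using d q e by (auto simp: dist_commute)
        then show "x \<in> (\<Union>(d, q)\<in>?I. cball d q)" by blast
      qed
    qed auto
    moreover have "countable ?I"
      by (rule countable_subset[of _ "D \<times> \<rat>"]) (use D(1) countable_rat in auto)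
    then have "(\<Union>(d, q)\<in>?I. cball d q) \<in> ?S"
      using cball by (intro S.countable_UN'') auto
    ultimately show ?thesis by simp
  qed
  then have "sigma_sets UNIV {U. open U} \<subseteq> ?S" by (intro S.sigma_sets_subset) auto
  then show "sets (borel :: 'h measure) \<subseteq> ?S" by (simp add: borel_def sets_measure_of)
qed

text \<open>Strengthened to cosine integrals over intersections of half-spaces, the hypothesis
  survives each further cut; at \<open>w = 0\<close> and \<open>\<theta> = 0\<close> it gives the
  measures of these sets.\<close>

lemma prob_eqI_cos:
  fixes P Q :: "'h::{real_inner, second_countable_topology} measure"
  assumes PQ: "prob_space P" "sets P = sets borel" "prob_space Q" "sets Q = sets borel"
    and eq: "\<And>w \<theta>. (\<integral>x. cos (x \<bullet> w + \<theta>) \<partial>P) = (\<integral>x. cos (x \<bullet> w + \<theta>) \<partial>Q)"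
  shows "P = Q"
proof -
  interpret P: prob_space P by fact
  interpret Q: prob_space Q by fact
  have main: "(\<integral>x. indicator A x * cos (x \<bullet> w + \<theta>) \<partial>P) = (\<integral>x. indicator A x * cos (x \<bullet> w + \<theta>) \<partial>Q)"
    if "A \<in> halfspace_inters" for A w \<theta>
    using that
  proof (induction arbitrary: w \<theta> rule: halfspace_inters.induct)
    case (Int A u c)
    then show ?case
      by (intro halfspace_inter_cos[OF PQ] halfspace_inters_measurable eq) auto
  qed (simp add: eq)
  have "emeasure P A = emeasure Q A" if "A \<in> halfspace_inters" for A
    using main[OF that, of 0 0] halfspace_inters_measurable[OF that] PQ
    by (simp add: P.emeasure_eq_measure Q.emeasure_eq_measure)
  then show ?thesis
    by (intro measure_eqI_generator_eq[where A = "\<lambda>_. UNIV", OF Int_stable_halfspace_inters])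
      (use PQ sets_borel_eq_halfspace_inters halfspace_inters.UNIV in auto)
qed

section \<open>Cosine integrals, marginals and linear images of Gaussian laws\<close>

lemma std_normal_cos:
  "(\<integral>y. cos (t * y + \<alpha>) \<partial>std_normal_distribution) = exp (- (t\<^sup>2) / 2) * cos \<alpha>"
proof -
  have rd: "real_distribution std_normal_distribution" by (rule real_dist_normal_dist)
  interpret real_distribution std_normal_distribution by (rule rd)
  have s: "cos (y - pi / 2) = sin y" for y by (simp add: cos_diff)
  have i: "integrable std_normal_distribution (\<lambda>y. cos (t * y))" "integrable std_normal_distribution (\<lambda>y. sin (t * y))"
    by (auto intro!: integrable_const_bound[of _ 1])
  have c: "(\<integral>y. cos (t * y) \<partial>std_normal_distribution) = exp (- (t\<^sup>2) / 2)"
    using Re_char[OF rd, of t] by (simp add: char_std_normal_distribution)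
  have z: "(\<integral>y. sin (t * y) \<partial>std_normal_distribution) = 0"
    using Im_char[OF rd, of t] by (simp add: char_std_normal_distribution s)
  have "(\<integral>y. cos (t * y + \<alpha>) \<partial>std_normal_distribution)
     = (\<integral>y. cos (t * y) * cos \<alpha> - sin (t * y) * sin \<alpha> \<partial>std_normal_distribution)"
    by (simp add: cos_add)
  also have "\<dots> = exp (- (t\<^sup>2) / 2) * cos \<alpha>"
    by (subst Bochner_Integration.integral_diff) (use i c z in auto)
  finally show ?thesis .
qed

lemma (in prob_space) normal_distributed_cos:
  assumes D: "distributed M lborel X (normal_density 0 \<sigma>)" and "\<sigma> > 0"
  shows "expectation (\<lambda>x. cos (t * X x + \<alpha>)) = exp (- ((\<sigma> * t)\<^sup>2) / 2) * cos \<alpha>"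
proof -
  have Y: "distributed M lborel (\<lambda>x. (X x - 0) / \<sigma>) std_normal_density"
    using D normal_standard_normal_convert[OF \<open>\<sigma> > 0\<close>, of X 0] by simp
  have "(\<integral>y. cos ((\<sigma> * t) * y + \<alpha>) \<partial>std_normal_distribution)
     = (\<integral>y. std_normal_density y * cos ((\<sigma> * t) * y + \<alpha>) \<partial>lborel)"
    by (subst integral_density) auto
  also have "\<dots> = expectation (\<lambda>x. cos ((\<sigma> * t) * ((X x - 0) / \<sigma>) + \<alpha>))"
    by (rule distributed_integral[OF Y]) auto
  finally show ?thesis using \<open>\<sigma> > 0\<close> by (simp add: std_normal_cos)
qed

lemma centered_gaussianD:
  assumes "centered_gaussian P \<Sigma>"
  shows "prob_space P" "sets P = sets borel" "(\<integral>x. (x \<bullet> u) * (x \<bullet> v) \<partial>P) = blinfun_apply \<Sigma> u \<bullet> v"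
  using assms unfolding centered_gaussian_def by auto

text \<open>The definition leaves \<open>\<sigma>\<close> open; the second moment forces it to be
  the square root of the quadratic form, and the degenerate alternative corresponds to the value
  0.\<close>

lemma centered_gaussian_marginal:
  assumes G: "centered_gaussian P \<Sigma>"
  shows "(AE x in P. x \<bullet> u = 0) \<and> blinfun_apply \<Sigma> u \<bullet> u = 0 \<or>
    blinfun_apply \<Sigma> u \<bullet> u > 0 \<and>
    distributed P lborel (\<lambda>x. x \<bullet> u) (normal_density 0 (sqrt (blinfun_apply \<Sigma> u \<bullet> u)))"
proof -
  interpret prob_space P by (rule centered_gaussianD[OF G])
  have [measurable_cong]: "sets P = sets borel" by (rule centered_gaussianD[OF G])
  note cov = centered_gaussianD(3)[OF G, of u u]
  consider "AE x in P. x \<bullet> u = 0" | \<sigma> where "\<sigma> > 0" "distributed P lborel (\<lambda>x. x \<bullet> u) (normal_density 0 \<sigma>)"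
    using G unfolding centered_gaussian_def by blast
  then show ?thesis
  proof cases
    case 1
    have "(\<integral>x. (x \<bullet> u) * (x \<bullet> u) \<partial>P) = (\<integral>x. 0 \<partial>P)"
      by (rule integral_cong_AE) (use 1 in \<open>auto elim!: eventually_mono\<close>)
    with 1 cov show ?thesis by simp
  next
    case 2
    have "expectation (\<lambda>x. x \<bullet> u) = 0" using normal_distributed_expectation[OF 2] .
    then have "(\<integral>x. (x \<bullet> u) * (x \<bullet> u) \<partial>P) = \<sigma>\<^sup>2"
      using normal_distributed_variance[OF 2] by (simp add: power2_eq_square)
    then have "blinfun_apply \<Sigma> u \<bullet> u = \<sigma>\<^sup>2" using cov by simp
    then show ?thesis using 2 by simp
  qed
qed

lemma centered_gaussian_cos:
  assumes G: "centered_gaussian P \<Sigma>"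
  shows "(\<integral>x. cos (x \<bullet> w + \<theta>) \<partial>P) = exp (- (blinfun_apply \<Sigma> w \<bullet> w) / 2) * cos \<theta>"
proof -
  interpret prob_space P by (rule centered_gaussianD[OF G])
  have [measurable_cong]: "sets P = sets borel" by (rule centered_gaussianD[OF G])
  from centered_gaussian_marginal[OF G, of w] show ?thesis
  proof
    assume A: "(AE x in P. x \<bullet> w = 0) \<and> blinfun_apply \<Sigma> w \<bullet> w = 0"
    have "(\<integral>x. cos (x \<bullet> w + \<theta>) \<partial>P) = (\<integral>x. cos \<theta> \<partial>P)"
      by (rule integral_cong_AE) (use A in \<open>auto elim!: eventually_mono\<close>)
    with A show ?thesis by (simp add: prob_space)
  next
    assume A: "blinfun_apply \<Sigma> w \<bullet> w > 0 \<and>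
      distributed P lborel (\<lambda>x. x \<bullet> w) (normal_density 0 (sqrt (blinfun_apply \<Sigma> w \<bullet> w)))"
    then show ?thesis
      using normal_distributed_cos[of "\<lambda>x. x \<bullet> w" "sqrt (blinfun_apply \<Sigma> w \<bullet> w)" 1 \<theta>] by simp
  qed
qed

lemma gaussian_law_eqI:
  assumes "centered_gaussian P \<Sigma>"
  shows "gaussian_law \<Sigma> = P"
  unfolding gaussian_law_def
proof (rule the_equality, rule assms)
  show "Q = P" if "centered_gaussian Q \<Sigma>" for Q
    by (rule prob_eqI_cos) (use that assms in \<open>simp_all add: centered_gaussianD centered_gaussian_cos\<close>)
qed

lemma centered_gaussian_symmetric:
  "centered_gaussian P \<Sigma> \<Longrightarrow> blinfun_apply \<Sigma> u \<bullet> v = blinfun_apply \<Sigma> v \<bullet> u"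
  using centered_gaussianD(3)[of P \<Sigma> u v] centered_gaussianD(3)[of P \<Sigma> v u] by (simp add: mult.commute)

lemma centered_gaussian_nonneg: "centered_gaussian P \<Sigma> \<Longrightarrow> blinfun_apply \<Sigma> u \<bullet> u \<ge> 0"
  using centered_gaussian_marginal[of P \<Sigma> u] by auto

text \<open>Linear functionals of \<open>B x\<close> are linear functionals of \<open>x\<close>
  through the adjoint \<open>C\<close>, so marginals and covariances transfer directly.\<close>

lemma centered_gaussian_image:
  assumes G: "centered_gaussian P \<Sigma>" and B[measurable]: "B \<in> borel_measurable borel"
    and adj: "\<And>x w. B x \<bullet> w = x \<bullet> C w"
    and \<Sigma>': "\<And>w. blinfun_apply \<Sigma>' w = B (blinfun_apply \<Sigma> (C w))"
  shows "centered_gaussian (distr P borel B) \<Sigma>'"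
proof -
  interpret prob_space P by (rule centered_gaussianD[OF G])
  have [measurable_cong]: "sets P = sets borel" by (rule centered_gaussianD[OF G])
  have "(AE x in distr P borel B. x \<bullet> w = 0) \<or>
      (\<exists>\<sigma>>0. distributed (distr P borel B) lborel (\<lambda>x. x \<bullet> w) (normal_density 0 \<sigma>))" for w
    using centered_gaussian_marginal[OF G, of "C w"]
  proof
    assume A: "(AE x in P. x \<bullet> C w = 0) \<and> blinfun_apply \<Sigma> (C w) \<bullet> C w = 0"
    have "(AE x in distr P borel B. x \<bullet> w = 0) = (AE x in P. B x \<bullet> w = 0)"
      by (rule AE_distr_iff) measurable
    with A show ?thesis by (simp add: adj)
  next
    assume A: "blinfun_apply \<Sigma> (C w) \<bullet> C w > 0 \<and>
      distributed P lborel (\<lambda>x. x \<bullet> C w) (normal_density 0 (sqrt (blinfun_apply \<Sigma> (C w) \<bullet> C w)))"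
    have "distr (distr P borel B) lborel (\<lambda>x. x \<bullet> w) = distr P lborel (\<lambda>x. x \<bullet> C w)"
      by (subst distr_distr) (auto simp: comp_def adj)
    with A show ?thesis unfolding distributed_def
      by (intro disjI2 exI[of _ "sqrt (blinfun_apply \<Sigma> (C w) \<bullet> C w)"]) simp
  qed
  moreover have "(\<integral>x. (x \<bullet> w) * (x \<bullet> z) \<partial>distr P borel B) = blinfun_apply \<Sigma>' w \<bullet> z" for w z
    by (subst integral_distr) (auto simp: adj \<Sigma>' centered_gaussianD(3)[OF G])
  moreover have "prob_space (distr P borel B)" by (rule prob_space_distr) measurable
  ultimately show ?thesis unfolding centered_gaussian_def by auto
qed

section \<open>Rank one perturbations of the identity\<close>

text \<open>For an eigenvector \<open>v\<close> the coordinate \<open>x \<bullet> v\<close> is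
  independent of the orthogonal component. This is checked without conditioning: replacing the
  coordinate by an independent normal variable leaves all cosine integrals, hence \<open>P\<close>,
  unchanged.\<close>

lemma centered_gaussian_disintegration:
  assumes G: "centered_gaussian P \<Sigma>" and v: "norm v = 1"
    and ev: "blinfun_apply \<Sigma> v = \<kappa> *\<^sub>R v" "\<kappa> > 0"
    and F[measurable]: "F \<in> borel_measurable borel"
  shows "(\<integral>\<^sup>+x. F x \<partial>P) =
    (\<integral>\<^sup>+x. \<integral>\<^sup>+y. ennreal (normal_density 0 (sqrt \<kappa>) y) * F (x - (x \<bullet> v) *\<^sub>R v + y *\<^sub>R v) \<partial>lborel \<partial>P)"
proof -
  interpret P: prob_space P by (rule centered_gaussianD[OF G])
  have [measurable_cong]: "sets P = sets borel" by (rule centered_gaussianD[OF G])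
  define N where "N = density lborel (normal_density 0 (sqrt \<kappa>))"
  have sN[measurable_cong]: "sets N = sets borel" by (simp add: N_def)
  interpret N: prob_space N unfolding N_def using ev by (intro prob_space_normal_density) simp
  interpret PN: pair_prob_space P N ..
  have dN: "distributed N lborel (\<lambda>y. y) (normal_density 0 (sqrt \<kappa>))"
    unfolding distributed_def N_def by (auto simp: distr_id2)
  define T where "T = (\<lambda>(x, y). x - (x \<bullet> v) *\<^sub>R v + y *\<^sub>R v)"
  have T[measurable]: "T \<in> borel_measurable (P \<Otimes>\<^sub>M N)" unfolding T_def by measurable
  have "distr (P \<Otimes>\<^sub>M N) borel T = P"
  proof (rule prob_eqI_cos)
    fix w \<theta>
    define z where "z = w - (w \<bullet> v) *\<^sub>R v"
    have vv: "v \<bullet> v = 1" using v by (simp add: norm_eq_1)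
    have T': "T (x, y) \<bullet> w = x \<bullet> z + y * (v \<bullet> w)" for x y
      by (simp add: T_def z_def inner_diff_left inner_diff_right inner_add_left inner_commute[of w v] mult.commute)
    \<comment> \<open>\<open>w\<close> splits into \<open>z\<close> and a multiple of
      \<open>v\<close>, and the eigenvector property removes the cross terms of the quadratic
      form.\<close>
    have zz: "blinfun_apply \<Sigma> z \<bullet> z = blinfun_apply \<Sigma> w \<bullet> w - \<kappa> * (v \<bullet> w)\<^sup>2"
    proof -
      have "blinfun_apply \<Sigma> w \<bullet> v = \<kappa> * (v \<bullet> w)"
        using centered_gaussian_symmetric[OF G, of w v] by (simp add: ev)
      then show ?thesis
        by (simp add: z_def blinfun.diff_right blinfun.scaleR_right inner_diff_left inner_diff_right
            ev vv inner_commute power2_eq_square)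
    qed
    have int: "integrable (P \<Otimes>\<^sub>M N) (\<lambda>p. cos (T p \<bullet> w + \<theta>))"
      by (rule PN.P.integrable_const_bound[of _ 1]) auto
    have "(\<integral>x. cos (x \<bullet> w + \<theta>) \<partial>distr (P \<Otimes>\<^sub>M N) borel T) = (\<integral>p. cos (T p \<bullet> w + \<theta>) \<partial>(P \<Otimes>\<^sub>M N))"
      by (rule integral_distr) measurable
    also have "\<dots> = (\<integral>x. \<integral>y. cos (T (x, y) \<bullet> w + \<theta>) \<partial>N \<partial>P)"
      using PN.integral_fst'[OF int] by simp
    also have "\<dots> = (\<integral>x. exp (- ((sqrt \<kappa> * (v \<bullet> w))\<^sup>2) / 2) * cos (x \<bullet> z + \<theta>) \<partial>P)"
    proof (rule Bochner_Integration.integral_cong[OF refl])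
      fix x
      show "(\<integral>y. cos (T (x, y) \<bullet> w + \<theta>) \<partial>N) = exp (- ((sqrt \<kappa> * (v \<bullet> w))\<^sup>2) / 2) * cos (x \<bullet> z + \<theta>)"
        using N.normal_distributed_cos[OF dN, of "v \<bullet> w" "x \<bullet> z + \<theta>"] ev
        by (simp add: T' mult.commute add_ac)
    qed
    also have "\<dots> = exp (- ((sqrt \<kappa> * (v \<bullet> w))\<^sup>2) / 2) * (exp (- (blinfun_apply \<Sigma> z \<bullet> z) / 2) * cos \<theta>)"
      by (simp add: centered_gaussian_cos[OF G])
    also have "\<dots> = exp (- (blinfun_apply \<Sigma> w \<bullet> w) / 2) * cos \<theta>"
    proof -
      have "(sqrt \<kappa> * (v \<bullet> w))\<^sup>2 = \<kappa> * (v \<bullet> w)\<^sup>2" using ev by (simp add: power_mult_distrib)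
      moreover have "exp (- (\<kappa> * c) / 2) * exp (- (W - \<kappa> * c) / 2) = exp (- W / 2)" for c W
        by (subst mult_exp_exp) (simp add: diff_divide_distrib)
      ultimately show ?thesis by (simp only: zz mult.assoc[symmetric])
    qed
    finally show "(\<integral>x. cos (x \<bullet> w + \<theta>) \<partial>distr (P \<Otimes>\<^sub>M N) borel T) = (\<integral>x. cos (x \<bullet> w + \<theta>) \<partial>P)"
      by (simp add: centered_gaussian_cos[OF G])
  qed (auto intro!: PN.P.prob_space_distr simp: centered_gaussianD[OF G])
  then have "(\<integral>\<^sup>+x. F x \<partial>P) = (\<integral>\<^sup>+x. F x \<partial>distr (P \<Otimes>\<^sub>M N) borel T)" by simp
  also have "\<dots> = (\<integral>\<^sup>+p. F (T p) \<partial>(P \<Otimes>\<^sub>M N))" by (rule nn_integral_distr) measurable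
  also have "\<dots> = (\<integral>\<^sup>+x. \<integral>\<^sup>+y. F (T (x, y)) \<partial>N \<partial>P)"
    by (rule N.nn_integral_fst[symmetric]) measurable
  also have "\<dots> = (\<integral>\<^sup>+x. \<integral>\<^sup>+y. ennreal (normal_density 0 (sqrt \<kappa>) y) * F (x - (x \<bullet> v) *\<^sub>R v + y *\<^sub>R v) \<partial>lborel \<partial>P)"
    unfolding N_def T_def by (subst nn_integral_density) auto
  finally show ?thesis .
qed

text \<open>The likelihood ratio of the image of a Gaussian law under \<open>x \<mapsto> x + \<beta> (x \<bullet> u) v\<close>: given the
  component of \<open>x\<close> orthogonal to the eigenvector \<open>v\<close>, the map sends the coordinate
  \<open>N(0, \<sigma>\<^sup>2)\<close> along \<open>v\<close> to \<open>N(m, b\<^sup>2 \<sigma>\<^sup>2)\<close>.\<close>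

definition likelihood_ratio :: "real \<Rightarrow> real \<Rightarrow> 'h::real_inner \<Rightarrow> 'h \<Rightarrow> 'h \<Rightarrow> real" where
  "likelihood_ratio \<sigma> \<beta> u v x =
     normal_density (\<beta> * ((x - (x \<bullet> v) *\<^sub>R v) \<bullet> u)) ((1 + \<beta> * (u \<bullet> v)) * \<sigma>) (x \<bullet> v) / normal_density 0 \<sigma> (x \<bullet> v)"

lemma likelihood_ratio_measurable[measurable]:
  "likelihood_ratio \<sigma> \<beta> u (v :: 'h::{real_inner, second_countable_topology}) \<in> borel_measurable borel"
  unfolding likelihood_ratio_def normal_density_def by measurable

text \<open>On each line in direction \<open>v\<close> the map is affine,
  \<open>y \<mapsto> m + b * y\<close> with \<open>m\<close> fixed by the orthogonal component, so
  after disintegration only a one-dimensional change of variables remains.\<close>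

lemma distr_rank_one_eq_density:
  assumes G: "centered_gaussian P \<Sigma>" and v: "norm v = 1"
    and ev: "blinfun_apply \<Sigma> v = \<kappa> *\<^sub>R v" "\<kappa> > 0" and b: "1 + \<beta> * (u \<bullet> v) > 0"
  shows "distr P borel (\<lambda>x. x + (\<beta> * (x \<bullet> u)) *\<^sub>R v) = density P (likelihood_ratio (sqrt \<kappa>) \<beta> u v)"
    (is "distr P borel ?B = density P ?L")
proof (rule measure_eqI)
  have sP[measurable_cong]: "sets P = sets borel" by (rule centered_gaussianD[OF G])
  show "sets (distr P borel ?B) = sets (density P ?L)" by (simp add: sP)
  define \<sigma> where "\<sigma> = sqrt \<kappa>"
  have \<sigma>: "\<sigma> > 0" using ev by (simp add: \<sigma>_def)
  define b where "b = 1 + \<beta> * (u \<bullet> v)"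
  have b0: "b > 0" using assms(5) by (simp add: b_def)
  have vv: "v \<bullet> v = 1" using v by (simp add: norm_eq_1)
  fix A assume "A \<in> sets (distr P borel ?B)"
  then have A[measurable]: "A \<in> sets borel" by simp
  define R where "R = (\<lambda>x. x - (x \<bullet> v) *\<^sub>R v)"
  have Rd: "R x = x - (x \<bullet> v) *\<^sub>R v" for x by (simp add: R_def)
  have Rv: "R x \<bullet> v = 0" for x by (simp add: R_def inner_diff_left vv)
  have RR: "R (R x + y *\<^sub>R v) = R x" "(R x + y *\<^sub>R v) \<bullet> v = y" for x y
    using Rv[of x] vv by (simp_all add: Rd[of "R x + y *\<^sub>R v"] inner_add_left)
  have "emeasure (distr P borel ?B) A = (\<integral>\<^sup>+x. indicator A x \<partial>distr P borel ?B)" by simp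
  also have "\<dots> = (\<integral>\<^sup>+x. indicator A (?B x) \<partial>P)" by (rule nn_integral_distr) measurable
  also have "\<dots> = (\<integral>\<^sup>+x. \<integral>\<^sup>+y. ennreal (normal_density 0 \<sigma> y) * indicator A (?B (R x + y *\<^sub>R v)) \<partial>lborel \<partial>P)"
    unfolding R_def \<sigma>_def by (rule centered_gaussian_disintegration[OF G v ev]) measurable
  also have "\<dots> = (\<integral>\<^sup>+x. \<integral>\<^sup>+y. ennreal (normal_density 0 \<sigma> y) * (?L (R x + y *\<^sub>R v) * indicator A (R x + y *\<^sub>R v)) \<partial>lborel \<partial>P)"
  proof (rule nn_integral_cong)
    fix x
    define m where "m = \<beta> * (R x \<bullet> u)"
    have Bm: "?B (R x + y *\<^sub>R v) = R x + (m + b * y) *\<^sub>R v" for y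
      by (simp add: m_def b_def inner_add_left inner_commute algebra_simps)
    have nd: "normal_density 0 \<sigma> y = b * normal_density m (b * \<sigma>) (m + b * y)" for y
    proof -
      have "(b * y)\<^sup>2 / (2 * (b * \<sigma>)\<^sup>2) = y\<^sup>2 / (2 * \<sigma>\<^sup>2)" using b0 by (simp add: power_mult_distrib)
      moreover have "sqrt (2 * pi * (b * \<sigma>)\<^sup>2) = b * sqrt (2 * pi * \<sigma>\<^sup>2)"
        using b0 by (simp add: power_mult_distrib real_sqrt_mult)
      ultimately show ?thesis using b0 by (simp add: normal_density_def)
    qed
    have "(\<integral>\<^sup>+y. ennreal (normal_density 0 \<sigma> y) * indicator A (?B (R x + y *\<^sub>R v)) \<partial>lborel)
       = (\<integral>\<^sup>+y. ennreal b * (ennreal (normal_density m (b * \<sigma>) (m + b * y)) * indicator A (R x + (m + b * y) *\<^sub>R v)) \<partial>lborel)"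
      unfolding Bm nd using b0 by (simp add: ennreal_mult' mult.assoc)
    also have "\<dots> = ennreal b * (\<integral>\<^sup>+y. ennreal (normal_density m (b * \<sigma>) (m + b * y)) * indicator A (R x + (m + b * y) *\<^sub>R v) \<partial>lborel)"
      by (rule nn_integral_cmult) measurable
    also have "\<dots> = (\<integral>\<^sup>+y. ennreal (normal_density m (b * \<sigma>) y) * indicator A (R x + y *\<^sub>R v) \<partial>lborel)"
      using b0 nn_integral_real_affine[of "\<lambda>y. ennreal (normal_density m (b * \<sigma>) y) * indicator A (R x + y *\<^sub>R v)" b m]
      by simp
    also have "\<dots> = (\<integral>\<^sup>+y. ennreal (normal_density 0 \<sigma> y) * (?L (R x + y *\<^sub>R v) * indicator A (R x + y *\<^sub>R v)) \<partial>lborel)"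
    proof (rule nn_integral_cong)
      fix y
      have "?L (R x + y *\<^sub>R v) = normal_density m (b * \<sigma>) y / normal_density 0 \<sigma> y"
        unfolding likelihood_ratio_def Rd[symmetric] unfolding RR m_def b_def \<sigma>_def ..
      then have "ennreal (normal_density m (b * \<sigma>) y) = ennreal (normal_density 0 \<sigma> y) * ?L (R x + y *\<^sub>R v)"
        using normal_density_pos[OF \<sigma>, of 0 y] by (simp add: ennreal_mult'[symmetric])
      then show "ennreal (normal_density m (b * \<sigma>) y) * indicator A (R x + y *\<^sub>R v) =
         ennreal (normal_density 0 \<sigma> y) * (?L (R x + y *\<^sub>R v) * indicator A (R x + y *\<^sub>R v))"
        by (simp add: mult.assoc)
    qed
    finally show "(\<integral>\<^sup>+y. ennreal (normal_density 0 \<sigma> y) * indicator A (?B (R x + y *\<^sub>R v)) \<partial>lborel) = \<dots>" .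
  qed
  also have "\<dots> = (\<integral>\<^sup>+x. ?L x * indicator A x \<partial>P)"
    unfolding R_def \<sigma>_def by (rule centered_gaussian_disintegration[OF G v ev, symmetric]) measurable
  also have "\<dots> = emeasure (density P ?L) A"
    by (subst emeasure_density) auto
  finally show "emeasure (distr P borel ?B) A = emeasure (density P ?L) A" .
qed

section \<open>Second moments of likelihood ratios\<close>

lemma normal_density_shift_square:
  assumes "\<sigma> > 0"
  shows "normal_density 0 \<sigma> y * (normal_density m \<sigma> y / normal_density 0 \<sigma> y)\<^sup>2
    = exp (m\<^sup>2 / \<sigma>\<^sup>2) * normal_density (2 * m) \<sigma> y"
proof -
  have e: "- (y - m)\<^sup>2 / (2 * \<sigma>\<^sup>2) + - (y - m)\<^sup>2 / (2 * \<sigma>\<^sup>2) =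
    m\<^sup>2 / \<sigma>\<^sup>2 + - (y - 2 * m)\<^sup>2 / (2 * \<sigma>\<^sup>2) + - (y - 0)\<^sup>2 / (2 * \<sigma>\<^sup>2)"
    using assms by (simp add: field_simps power2_eq_square)
  have "normal_density m \<sigma> y * normal_density m \<sigma> y =
    exp (m\<^sup>2 / \<sigma>\<^sup>2) * normal_density (2 * m) \<sigma> y * normal_density 0 \<sigma> y"
    using arg_cong[OF e, of exp] unfolding exp_add normal_density_def by (simp add: field_simps)
  then show ?thesis
    using normal_density_pos[OF assms, of 0 y] by (simp add: power2_eq_square field_simps)
qed

text \<open>Squaring the numerator and dividing by the reference density leaves decay at infinity
  precisely for \<open>b\<^sup>2 < 2\<close>.\<close>

lemma normal_density_scale_square:
  assumes "\<sigma> > 0" "0 < b" "b\<^sup>2 < 2"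
  shows "normal_density 0 \<sigma> y * (normal_density 0 (b * \<sigma>) y / normal_density 0 \<sigma> y)\<^sup>2
    = 1 / sqrt (1 - (b\<^sup>2 - 1)\<^sup>2) * normal_density 0 (b * \<sigma> / sqrt (2 - b\<^sup>2)) y"
proof -
  define c where "c = sqrt (2 - b\<^sup>2)"
  have c: "c > 0" "c\<^sup>2 = 2 - b\<^sup>2" using assms by (auto simp: c_def)
  have bc: "sqrt (1 - (b\<^sup>2 - 1)\<^sup>2) = b * c"
  proof (rule real_sqrt_unique)
    show "(b * c)\<^sup>2 = 1 - (b\<^sup>2 - 1)\<^sup>2" by (simp add: power_mult_distrib c) (simp add: power2_eq_square algebra_simps)
  qed (use c assms in auto)
  have nd: "normal_density 0 s y = 1 / (sqrt (2 * pi) * s) * exp (- y\<^sup>2 / (2 * s\<^sup>2))" if "s > 0" for s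
    using that by (simp add: normal_density_def real_sqrt_mult)
  have e: "- y\<^sup>2 / (2 * (b * \<sigma>)\<^sup>2) + - y\<^sup>2 / (2 * (b * \<sigma>)\<^sup>2) =
    - y\<^sup>2 / (2 * (b * \<sigma> / c)\<^sup>2) + - y\<^sup>2 / (2 * \<sigma>\<^sup>2)"
    using assms c by (simp add: power_divide power_mult_distrib c(2) field_simps)
  have "normal_density 0 (b * \<sigma>) y * normal_density 0 (b * \<sigma>) y =
    1 / (b * c) * normal_density 0 (b * \<sigma> / c) y * normal_density 0 \<sigma> y"
    using assms c arg_cong[OF e, of exp] unfolding exp_add
    by (simp add: nd field_simps)
  then show ?thesis unfolding bc c_def[symmetric]
    using normal_density_pos[OF assms(1), of 0 y] by (simp add: power2_eq_square field_simps)
qed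

lemma normal_density_exp_square:
  assumes "\<sigma> > 0" "2 * c * \<sigma>\<^sup>2 < 1"
  shows "normal_density 0 \<sigma> y * exp (c * y\<^sup>2) =
    1 / sqrt (1 - 2 * c * \<sigma>\<^sup>2) * normal_density 0 (\<sigma> / sqrt (1 - 2 * c * \<sigma>\<^sup>2)) y"
proof -
  define q where "q = sqrt (1 - 2 * c * \<sigma>\<^sup>2)"
  have q: "q > 0" "q\<^sup>2 = 1 - 2 * c * \<sigma>\<^sup>2" using assms by (auto simp: q_def)
  have nd: "normal_density 0 s y = 1 / (sqrt (2 * pi) * s) * exp (- y\<^sup>2 / (2 * s\<^sup>2))" if "s > 0" for s
    using that by (simp add: normal_density_def real_sqrt_mult)
  have e: "- y\<^sup>2 / (2 * \<sigma>\<^sup>2) + c * y\<^sup>2 = - y\<^sup>2 / (2 * (\<sigma> / q)\<^sup>2)"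
    using assms q by (simp add: power_divide q(2) field_simps)
  show ?thesis unfolding q_def[symmetric]
    using assms q arg_cong[OF e, of exp] unfolding exp_add by (simp add: nd)
qed

lemma nn_integral_normal_density_const:
  "\<sigma> > 0 \<Longrightarrow> C \<ge> 0 \<Longrightarrow> (\<integral>\<^sup>+y. ennreal (C * normal_density m \<sigma> y) \<partial>lborel) = ennreal C"
  using nn_integral_eq_integral[OF integrable_normal_density[of \<sigma> m]]
  by (simp add: ennreal_mult' nn_integral_cmult)

text \<open>Along a line in direction \<open>v\<close> the likelihood ratio is a ratio of two normal
  densities, so its second moment is a mean of one-dimensional integrals.\<close>

lemma likelihood_ratio_second_moment:
  assumes G: "centered_gaussian P \<Sigma>" and v: "norm v = 1"
    and ev: "blinfun_apply \<Sigma> v = \<kappa> *\<^sub>R v" "\<kappa> > 0"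
  shows "(\<integral>\<^sup>+x. ennreal (likelihood_ratio (sqrt \<kappa>) \<beta> u v x) ^ 2 \<partial>P) =
    (\<integral>\<^sup>+x. \<integral>\<^sup>+y. ennreal (normal_density 0 (sqrt \<kappa>) y *
       (normal_density (\<beta> * ((x - (x \<bullet> v) *\<^sub>R v) \<bullet> u)) ((1 + \<beta> * (u \<bullet> v)) * sqrt \<kappa>) y
         / normal_density 0 (sqrt \<kappa>) y)\<^sup>2) \<partial>lborel \<partial>P)"
proof -
  define R where "R = (\<lambda>x. x - (x \<bullet> v) *\<^sub>R v)"
  have Rd: "R x = x - (x \<bullet> v) *\<^sub>R v" for x by (simp add: R_def)
  have vv: "v \<bullet> v = 1" using v by (simp add: norm_eq_1)
  have Rv: "R x \<bullet> v = 0" for x by (simp add: R_def inner_diff_left vv)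
  have RR: "R (R x + y *\<^sub>R v) = R x" "(R x + y *\<^sub>R v) \<bullet> v = y" for x y
    using Rv[of x] vv by (simp_all add: Rd[of "R x + y *\<^sub>R v"] inner_add_left)
  have "(\<integral>\<^sup>+x. ennreal (likelihood_ratio (sqrt \<kappa>) \<beta> u v x) ^ 2 \<partial>P) =
    (\<integral>\<^sup>+x. \<integral>\<^sup>+y. ennreal (normal_density 0 (sqrt \<kappa>) y) *
       ennreal (likelihood_ratio (sqrt \<kappa>) \<beta> u v (R x + y *\<^sub>R v)) ^ 2 \<partial>lborel \<partial>P)"
    unfolding R_def by (rule centered_gaussian_disintegration[OF G v ev]) measurable
  also have "\<dots> = (\<integral>\<^sup>+x. \<integral>\<^sup>+y. ennreal (normal_density 0 (sqrt \<kappa>) y *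
       (normal_density (\<beta> * (R x \<bullet> u)) ((1 + \<beta> * (u \<bullet> v)) * sqrt \<kappa>) y
         / normal_density 0 (sqrt \<kappa>) y)\<^sup>2) \<partial>lborel \<partial>P)"
    unfolding likelihood_ratio_def Rd[symmetric] unfolding RR
    by (simp add: ennreal_power ennreal_mult' del: power_divide)
  finally show ?thesis unfolding R_def .
qed

text \<open>For \<open>u = v\<close> the orthogonal component contributes no shift, and the
  coordinate along \<open>v\<close> is only rescaled by \<open>1 + \<beta>\<close>.\<close>

lemma likelihood_ratio_second_moment_scale:
  assumes G: "centered_gaussian P \<Sigma>" and v: "norm v = 1"
    and ev: "blinfun_apply \<Sigma> v = \<kappa> *\<^sub>R v" "\<kappa> > 0" and \<beta>: "0 \<le> \<beta>" "(1 + \<beta>)\<^sup>2 < 2"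
  shows "(\<integral>\<^sup>+x. ennreal (likelihood_ratio (sqrt \<kappa>) \<beta> v v x) ^ 2 \<partial>P) =
    ennreal (1 / sqrt (1 - ((1 + \<beta>)\<^sup>2 - 1)\<^sup>2))"
proof -
  interpret prob_space P by (rule centered_gaussianD[OF G])
  have vv: "v \<bullet> v = 1" using v by (simp add: norm_eq_1)
  define b where "b = 1 + \<beta>"
  have b: "0 < b" "b\<^sup>2 < 2" using \<beta> by (auto simp: b_def)
  have "1 \<le> b\<^sup>2" using \<beta> by (simp add: b_def one_le_power)
  then have "(b\<^sup>2 - 1)\<^sup>2 \<le> 1" using b by (intro power_le_one) linarith+
  then have nn: "1 / sqrt (1 - (b\<^sup>2 - 1)\<^sup>2) \<ge> 0" by simp
  have pos: "sqrt \<kappa> > 0" "b * sqrt \<kappa> / sqrt (2 - b\<^sup>2) > 0" using ev b by auto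
  have m: "\<beta> * ((x - (x \<bullet> v) *\<^sub>R v) \<bullet> v) = 0" for x by (simp add: inner_diff_left vv)
  show ?thesis
    unfolding likelihood_ratio_second_moment[OF G v ev] m vv mult_1_right b_def[symmetric]
      normal_density_scale_square[OF pos(1) b] nn_integral_normal_density_const[OF pos(2) nn]
    by (simp add: emeasure_space_1)
qed

text \<open>For \<open>u\<close> orthogonal to \<open>v\<close> the coordinate along
  \<open>v\<close> keeps its variance and is shifted by \<open>\<beta> * (x \<bullet> u)\<close>.
  The inner integral is the exponential of the squared shift over \<open>\<kappa>\<close>; its mean
  over the normal variable \<open>x \<bullet> u\<close> is finite under the smallness condition on
  \<open>\<beta>\<close>.\<close>

lemma likelihood_ratio_second_moment_shear:
  assumes G: "centered_gaussian P \<Sigma>" and v: "norm v = 1" and u: "norm u = 1" "u \<bullet> v = 0"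
    and ev: "blinfun_apply \<Sigma> v = \<kappa> *\<^sub>R v" "\<kappa> > 0" "blinfun_apply \<Sigma> u = \<nu> *\<^sub>R u" "\<nu> > 0"
    and \<beta>: "2 * \<beta>\<^sup>2 * \<nu> / \<kappa> < 1"
  shows "(\<integral>\<^sup>+x. ennreal (likelihood_ratio (sqrt \<kappa>) \<beta> u v x) ^ 2 \<partial>P) =
    ennreal (1 / sqrt (1 - 2 * \<beta>\<^sup>2 * \<nu> / \<kappa>))"
proof -
  interpret prob_space P by (rule centered_gaussianD[OF G])
  have [measurable_cong]: "sets P = sets borel" by (rule centered_gaussianD[OF G])
  have pos: "sqrt \<kappa> > 0" "sqrt \<nu> > 0" using ev by auto
  have uu: "u \<bullet> u = 1" using u by (simp add: norm_eq_1)
  have m: "(x - (x \<bullet> v) *\<^sub>R v) \<bullet> u = x \<bullet> u" for x using u(2) by (simp add: inner_diff_left inner_commute[of v u])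
  have "(\<integral>\<^sup>+x. ennreal (likelihood_ratio (sqrt \<kappa>) \<beta> u v x) ^ 2 \<partial>P) =
    (\<integral>\<^sup>+x. ennreal (exp ((\<beta> * (x \<bullet> u))\<^sup>2 / (sqrt \<kappa>)\<^sup>2)) \<partial>P)"
    unfolding likelihood_ratio_second_moment[OF G v ev(1,2)] m u(2) mult_zero_right add_0_right mult_1
      normal_density_shift_square[OF pos(1)]
    by (simp add: nn_integral_normal_density_const[OF pos(1)])
  also have "\<dots> = (\<integral>\<^sup>+x. ennreal (exp (\<beta>\<^sup>2 / \<kappa> * (x \<bullet> u)\<^sup>2)) \<partial>P)"
    using ev by (simp add: power_mult_distrib)
  also have "\<dots> = (\<integral>\<^sup>+y. ennreal (normal_density 0 (sqrt \<nu>) y) * ennreal (exp (\<beta>\<^sup>2 / \<kappa> * y\<^sup>2)) \<partial>lborel)"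
  proof -
    have "distributed P lborel (\<lambda>x. x \<bullet> u) (normal_density 0 (sqrt \<nu>))"
      using centered_gaussian_marginal[OF G, of u] ev(3,4) uu by simp
    then show ?thesis by (subst distributed_nn_integral) auto
  qed
  also have "\<dots> = (\<integral>\<^sup>+y. ennreal (1 / sqrt (1 - 2 * (\<beta>\<^sup>2 / \<kappa>) * (sqrt \<nu>)\<^sup>2) *
      normal_density 0 (sqrt \<nu> / sqrt (1 - 2 * (\<beta>\<^sup>2 / \<kappa>) * (sqrt \<nu>)\<^sup>2)) y) \<partial>lborel)"
    by (subst normal_density_exp_square[symmetric]) (use pos \<beta> ev in \<open>simp_all add: ennreal_mult'\<close>)
  also have "\<dots> = ennreal (1 / sqrt (1 - 2 * (\<beta>\<^sup>2 / \<kappa>) * (sqrt \<nu>)\<^sup>2))"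
    by (rule nn_integral_normal_density_const) (use pos \<beta> ev in auto)
  finally show ?thesis using ev by simp
qed

section \<open>Samples\<close>

lemma PiM_density_prob:
  fixes P :: "'a measure" and n :: nat
  assumes "prob_space P" and L[measurable]: "L \<in> borel_measurable P" and "prob_space (density P L)"
  shows "PiM {..<n} (\<lambda>_. density P L) = density (PiM {..<n} (\<lambda>_. P)) (\<lambda>X. \<Prod>i<n. L (X i))"
proof -
  interpret P: prob_space P by fact
  interpret Q: prob_space "density P L" by fact
  interpret PP: product_sigma_finite "\<lambda>_::nat. P" by unfold_locales
  interpret QQ: product_sigma_finite "\<lambda>_::nat. density P L" by unfold_locales
  have s: "sets (PiM {..<n} (\<lambda>_. density P L)) = sets (PiM {..<n} (\<lambda>_. P))"
    by (intro sets_PiM_cong) auto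
  have "density (PiM {..<n} (\<lambda>_. P)) (\<lambda>X. \<Prod>i<n. L (X i)) = PiM {..<n} (\<lambda>_. density P L)"
  proof (rule QQ.PiM_eqI)
    fix A assume A: "\<And>i. i \<in> {..<n} \<Longrightarrow> A i \<in> sets (density P L)"
    then have [measurable]: "\<And>i. i \<in> {..<n} \<Longrightarrow> A i \<in> sets P" by simp
    have "emeasure (density (PiM {..<n} (\<lambda>_. P)) (\<lambda>X. \<Prod>i<n. L (X i))) (Pi\<^sub>E {..<n} A)
       = (\<integral>\<^sup>+X. (\<Prod>i<n. L (X i)) * indicator (Pi\<^sub>E {..<n} A) X \<partial>PiM {..<n} (\<lambda>_. P))"
      by (rule emeasure_density) (auto intro!: sets_PiM_I_finite)
    also have "\<dots> = (\<integral>\<^sup>+X. (\<Prod>i<n. L (X i) * indicator (A i) (X i)) \<partial>PiM {..<n} (\<lambda>_. P))"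
    proof (rule nn_integral_cong)
      fix X assume X: "X \<in> space (PiM {..<n} (\<lambda>_. P))"
      then have "indicator (Pi\<^sub>E {..<n} A) X = (\<Prod>i<n. indicator (A i) (X i) :: ennreal)"
        by (auto simp: indicator_def space_PiM PiE_iff prod_zero_iff)
      then show "(\<Prod>i<n. L (X i)) * indicator (Pi\<^sub>E {..<n} A) X = (\<Prod>i<n. L (X i) * indicator (A i) (X i))"
        by (simp add: prod.distrib)
    qed
    also have "\<dots> = (\<Prod>i<n. \<integral>\<^sup>+x. L x * indicator (A i) x \<partial>P)"
      by (rule PP.product_nn_integral_prod) auto
    also have "\<dots> = (\<Prod>i<n. emeasure (density P L) (A i))"
      by (intro prod.cong refl) (auto simp: emeasure_density)
    finally show "emeasure (density (PiM {..<n} (\<lambda>_. P)) (\<lambda>X. \<Prod>i<n. L (X i))) (Pi\<^sub>E {..<n} A)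
       = (\<Prod>i<n. emeasure (density P L) (A i))" .
  qed (auto simp: s)
  then show ?thesis ..
qed

text \<open>Cauchy-Schwarz for the product likelihood ratio, whose second moment is the
  \<open>n\<close>-th power of that of one observation.\<close>

lemma PiM_density_change_of_measure:
  fixes P :: "'a measure" and n :: nat
  assumes "prob_space P" and L[measurable]: "L \<in> borel_measurable P" and "prob_space (density P L)"
    and C: "(\<integral>\<^sup>+x. L x ^ 2 \<partial>P) = C" and A: "A \<in> sets (PiM {..<n} (\<lambda>_. P))"
  shows "(emeasure (PiM {..<n} (\<lambda>_. density P L)) A)\<^sup>2 \<le> emeasure (PiM {..<n} (\<lambda>_. P)) A * C ^ n"
proof -
  interpret P: prob_space P by fact
  interpret PP: product_sigma_finite "\<lambda>_::nat. P" by unfold_locales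
  let ?L = "\<lambda>X. \<Prod>i<n. L (X i)"
  have "emeasure (PiM {..<n} (\<lambda>_. density P L)) A = (\<integral>\<^sup>+X. ?L X * indicator A X \<partial>PiM {..<n} (\<lambda>_. P))"
    unfolding PiM_density_prob[OF assms(1-3)] by (rule emeasure_density) (use A in auto)
  also have "\<dots>\<^sup>2 \<le> (\<integral>\<^sup>+X. ?L X ^ 2 \<partial>PiM {..<n} (\<lambda>_. P)) * (\<integral>\<^sup>+X. indicator A X ^ 2 \<partial>PiM {..<n} (\<lambda>_. P))"
    by (rule Cauchy_Schwarz_nn_integral) (use A in auto)
  also have "(\<integral>\<^sup>+X. indicator A X ^ 2 \<partial>PiM {..<n} (\<lambda>_. P)) = emeasure (PiM {..<n} (\<lambda>_. P)) A"
    using A by (simp add: power2_eq_square indicator_inter_arith[symmetric])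
  also have "(\<integral>\<^sup>+X. ?L X ^ 2 \<partial>PiM {..<n} (\<lambda>_. P)) = (\<integral>\<^sup>+X. (\<Prod>i<n. L (X i) ^ 2) \<partial>PiM {..<n} (\<lambda>_. P))"
    by (simp add: prod_power_distrib)
  also have "\<dots> = (\<Prod>i<n. \<integral>\<^sup>+x. L x ^ 2 \<partial>P)"
    by (rule PP.product_nn_integral_prod) auto
  also have "\<dots> = C ^ n" by (simp add: C)
  finally show ?thesis by (simp add: mult.commute)
qed

section \<open>Codes\<close>

lemma sum_Pow_power_card:
  fixes x :: real
  assumes "finite I"
  shows "(\<Sum>D\<in>Pow I. x ^ card D) = (1 + x) ^ card I"
  using assms
proof (induction I)
  case (insert i I)
  have inj: "inj_on (insert i) (Pow I)" using insert by (auto simp: inj_on_def)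
  have "(\<Sum>D\<in>Pow (insert i I). x ^ card D) = (\<Sum>D\<in>Pow I. x ^ card D) + (\<Sum>D\<in>insert i ` Pow I. x ^ card D)"
    unfolding Pow_insert using insert by (intro sum.union_disjoint) auto
  also have "(\<Sum>D\<in>insert i ` Pow I. x ^ card D) = (\<Sum>D\<in>Pow I. x * x ^ card D)"
  proof (subst sum.reindex[OF inj], rule sum.cong)
    fix D assume "D \<in> Pow I"
    then have "finite D" "i \<notin> D" using insert.hyps by (auto dest: finite_subset)
    then show "((\<lambda>D. x ^ card D) \<circ> insert i) D = x * x ^ card D" by simp
  qed simp
  finally show ?case using insert by (simp add: sum_distrib_left[symmetric] algebra_simps)
qed simp

text \<open>Symmetric difference with \<open>w\<close> permutes \<open>Pow I\<close>, so the sum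
  does not depend on \<open>w\<close>.\<close>

lemma sym_diff_sum:
  fixes x :: real
  assumes "finite I" "w \<subseteq> I"
  shows "(\<Sum>w'\<in>Pow I. x ^ card (sym_diff w w')) = (1 + x) ^ card I"
proof -
  have "(\<Sum>w'\<in>Pow I. x ^ card (sym_diff w w')) = (\<Sum>D\<in>Pow I. x ^ card D)"
    by (rule sum.reindex_bij_witness[where i = "sym_diff w" and j = "sym_diff w"]) (use assms in auto)
  then show ?thesis using sum_Pow_power_card[OF assms(1)] by simp
qed

text \<open>The Gilbert--Varshamov bound: a maximal code is covering.\<close>

lemma exists_separated_code:
  assumes I: "finite I"
  shows "\<exists>C \<subseteq> Pow I. (\<forall>w\<in>C. \<forall>w'\<in>C. w \<noteq> w' \<longrightarrow> card I < 8 * card (sym_diff w w')) \<and>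
     (4 / 3 :: real) ^ card I \<le> real (card C)"
proof -
  define good where "good = (\<lambda>C. C \<subseteq> Pow I \<and> (\<forall>w\<in>C. \<forall>w'\<in>C. w \<noteq> w' \<longrightarrow> card I < 8 * card (sym_diff w w')))"
  have "finite (Collect good)" by (rule finite_subset[of _ "Pow (Pow I)"]) (use I in \<open>auto simp: good_def\<close>)
  moreover have "good {}" by (simp add: good_def)
  ultimately obtain C where C: "good C" "\<And>C'. good C' \<Longrightarrow> C \<subseteq> C' \<Longrightarrow> C = C'"
    using finite_has_maximal[of "Collect good"] by blast
  have fC: "finite C" using C(1) I by (auto simp: good_def intro: finite_subset)
  have cover: "\<exists>w\<in>C. 8 * card (sym_diff w w') \<le> card I" if "w' \<subseteq> I" for w'
  proof (rule ccontr)
    assume neg: "\<not> ?thesis"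
    have s: "sym_diff w' w = sym_diff w w'" for w by auto
    have "good (insert w' C)" using C(1) that neg s unfolding good_def by (auto simp: not_le)
    then have "w' \<in> C" using C(2) by blast
    then show False using neg by auto
  qed
  \<comment> \<open>Weighting by powers of \<open>y\<close> replaces a count of Hamming balls. A
    word within distance \<open>card I / 8\<close> bounds \<open>y ^ card I\<close> by a power of
    \<open>y ^ 8\<close>, and for \<open>y = 3 / 4\<close> the ratio of \<open>2 * y\<close> to
    \<open>1 + y ^ 8\<close> is at least \<open>(3 / 2) / (9 / 8) = 4 / 3\<close>.\<close>
  define y :: real where "y = 3 / 4"
  have "(2 * y) ^ card I = (\<Sum>w'\<in>Pow I. y ^ card I)"
    using I by (simp add: card_Pow power_mult_distrib)
  also have "\<dots> \<le> (\<Sum>w'\<in>Pow I. \<Sum>w\<in>C. (y ^ 8) ^ card (sym_diff w w'))"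
  proof (rule sum_mono)
    fix w' assume "w' \<in> Pow I"
    then obtain w where w: "w \<in> C" "8 * card (sym_diff w w') \<le> card I" using cover by blast
    have "y ^ card I \<le> y ^ (8 * card (sym_diff w w'))"
      by (rule power_decreasing) (use w in \<open>auto simp: y_def\<close>)
    also have "\<dots> = (y ^ 8) ^ card (sym_diff w w')" by (simp add: power_mult)
    also have "\<dots> \<le> (\<Sum>w\<in>C. (y ^ 8) ^ card (sym_diff w w'))"
      by (rule member_le_sum) (use w fC in \<open>auto simp: y_def\<close>)
    finally show "y ^ card I \<le> (\<Sum>w\<in>C. (y ^ 8) ^ card (sym_diff w w'))" .
  qed
  also have "\<dots> = (\<Sum>w\<in>C. \<Sum>w'\<in>Pow I. (y ^ 8) ^ card (sym_diff w w'))" by (rule sum.swap)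
  also have "\<dots> = (\<Sum>w\<in>C. (1 + y ^ 8) ^ card I)"
    using C(1) I by (intro sum.cong refl sym_diff_sum) (auto simp: good_def)
  also have "\<dots> = real (card C) * (1 + y ^ 8) ^ card I" by simp
  also have "\<dots> \<le> real (card C) * (9 / 8) ^ card I"
    by (intro mult_left_mono power_mono) (auto simp: y_def power_divide)
  finally have *: "(3 / 2) ^ card I \<le> real (card C) * (9 / 8) ^ card I" by (simp add: y_def)
  have "(4 / 3 :: real) ^ card I = (3 / 2) ^ card I / (9 / 8) ^ card I"
    by (simp add: power_divide[symmetric])
  also have "\<dots> \<le> real (card C)" using * by (simp add: pos_divide_le_eq)
  finally have N: "(4 / 3) ^ card I \<le> real (card C)" .
  show ?thesis by (rule exI[of _ C]) (use C(1) N in \<open>simp add: good_def\<close>)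
qed

section \<open>Testing\<close>

text \<open>Chebyshev's inequality; the finite bound on \<open>L2_norm\<close> rules out its
  infinite branch.\<close>

lemma L2_norm_tail:
  assumes "prob_space Q" and [measurable]: "\<eta> \<in> borel_measurable Q"
    and L: "L2_norm Q \<eta> < ennreal \<delta>" and "t > 0"
  shows "measure Q {x \<in> space Q. t \<le> \<bar>\<eta> x\<bar>} \<le> (\<delta> / t)\<^sup>2"
proof -
  interpret prob_space Q by fact
  define J where "J = (\<integral>\<^sup>+x. ennreal (\<bar>\<eta> x\<bar>\<^sup>2) \<partial>Q)"
  have J: "J \<noteq> \<infinity>" "sqrt (enn2real J) < \<delta>"
    using L unfolding L2_norm_def Let_def J_def[symmetric]
    by (auto split: if_splits simp: ennreal_less_iff)
  have "\<delta> > 0" using J(2) by (rule le_less_trans[rotated]) simp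
  have "ennreal (t\<^sup>2 * measure Q {x \<in> space Q. t \<le> \<bar>\<eta> x\<bar>}) = (\<integral>\<^sup>+x. ennreal (t\<^sup>2) * indicator {x \<in> space Q. t \<le> \<bar>\<eta> x\<bar>} x \<partial>Q)"
    by (subst nn_integral_cmult_indicator) (auto simp: emeasure_eq_measure ennreal_mult')
  also have "\<dots> \<le> J" unfolding J_def
  proof (rule nn_integral_mono)
    fix x
    have "t\<^sup>2 \<le> \<bar>\<eta> x\<bar>\<^sup>2" if "t \<le> \<bar>\<eta> x\<bar>" using that \<open>t > 0\<close> by (intro power_mono) auto
    then show "ennreal (t\<^sup>2) * indicator {x \<in> space Q. t \<le> \<bar>\<eta> x\<bar>} x \<le> ennreal (\<bar>\<eta> x\<bar>\<^sup>2)"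
      by (auto simp: indicator_def simp del: power2_abs intro!: ennreal_leI)
  qed
  finally have "t\<^sup>2 * measure Q {x \<in> space Q. t \<le> \<bar>\<eta> x\<bar>} \<le> enn2real J"
    using J(1) by (metis ennreal_enn2real ennreal_le_iff enn2real_nonneg infinity_ennreal_def less_top)
  also have "\<dots> = (sqrt (enn2real J))\<^sup>2" by simp
  also have "\<dots> \<le> \<delta>\<^sup>2" using J by (intro power_mono) auto
  finally show ?thesis using \<open>t > 0\<close> by (simp add: power_divide field_simps)
qed

text \<open>Thresholding \<open>T\<close> at \<open>\<Delta> / 2\<close> errs with probability at
  most 1/4 under either law, so the event has mass at most 1/4 under \<open>P\<close> and at least
  3/4 under \<open>Q\<close>; the change of measure would give
  \<open>9 / 16 \<le> 1 / 2\<close>.\<close>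

lemma two_point_test:
  assumes P: "prob_space P" "sets P = sets M" and Q: "prob_space Q" "sets Q = sets M"
    and T: "T \<in> borel_measurable M"
    and PQ: "\<And>A. A \<in> sets M \<Longrightarrow> (emeasure Q A)\<^sup>2 \<le> emeasure P A * ennreal 2"
    and \<Delta>: "\<Delta> > 0" and LP: "L2_norm P (\<lambda>x. T x - 0) < ennreal (\<Delta> / 4)"
    and LQ: "L2_norm Q (\<lambda>x. T x - \<Delta>) < ennreal (\<Delta> / 4)"
  shows False
proof -
  interpret P: prob_space P by fact
  interpret Q: prob_space Q by fact
  note [measurable_cong] = P(2) Q(2)
  note [measurable] = T
  have sp: "space P = space M" "space Q = space M" using P(2) Q(2) by (auto dest: sets_eq_imp_space_eq)
  define A where "A = {x \<in> space M. \<Delta> / 2 \<le> \<bar>T x\<bar>}"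
  have A[measurable]: "A \<in> sets M" unfolding A_def by measurable
  have "measure P {x \<in> space P. \<Delta> / 2 \<le> \<bar>T x - 0\<bar>} \<le> ((\<Delta> / 4) / (\<Delta> / 2))\<^sup>2"
    by (rule L2_norm_tail[OF P(1) _ LP]) (use \<Delta> in auto)
  also have "{x \<in> space P. \<Delta> / 2 \<le> \<bar>T x - 0\<bar>} = A" by (simp add: A_def sp)
  finally have pA: "measure P A \<le> 1 / 4" using \<Delta> by (simp add: power2_eq_square)
  have "measure Q {x \<in> space Q. \<Delta> / 2 \<le> \<bar>T x - \<Delta>\<bar>} \<le> ((\<Delta> / 4) / (\<Delta> / 2))\<^sup>2"
    by (rule L2_norm_tail[OF Q(1) _ LQ]) (use \<Delta> in auto)
  then have q: "measure Q {x \<in> space Q. \<Delta> / 2 \<le> \<bar>T x - \<Delta>\<bar>} \<le> 1 / 4" using \<Delta> by (simp add: power2_eq_square)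
  have "space Q - A \<subseteq> {x \<in> space Q. \<Delta> / 2 \<le> \<bar>T x - \<Delta>\<bar>}" by (auto simp: A_def sp)
  then have "measure Q (space Q - A) \<le> 1 / 4"
    using Q.finite_measure_mono[of "space Q - A" "{x \<in> space Q. \<Delta> / 2 \<le> \<bar>T x - \<Delta>\<bar>}"] q by simp
  then have qA: "measure Q A \<ge> 3 / 4" using Q.prob_compl[of A] by simp
  have "(measure Q A)\<^sup>2 \<le> measure P A * 2"
    using PQ[OF A] by (simp add: P.emeasure_eq_measure Q.emeasure_eq_measure ennreal_power ennreal_mult[symmetric]
        ennreal_mult''[symmetric] del: ennreal_numeral)
  moreover have "(3 / 4)\<^sup>2 \<le> (measure Q A)\<^sup>2" using qA by (intro power_mono) auto
  ultimately show False using pA by (simp add: power2_eq_square)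
qed

text \<open>Distinct \<open>w\<close>, \<open>w'\<close> in \<open>C\<close> are separated by exactly half of all subsets of \<open>C\<close>, so \<open>w\<close> can be
  decoded from estimates of \<open>\<pm>\<Delta>\<close> (the sign telling whether \<open>w \<in> S\<close>) for all \<open>S \<subseteq> C\<close>.\<close>

lemma card_separating_subsets:
  assumes "finite C" "w \<in> C" "w' \<in> C" "w \<noteq> w'"
  shows "2 * card {S \<in> Pow C. (w \<in> S) \<noteq> (w' \<in> S)} = 2 ^ card C"
proof -
  let ?X = "{S \<in> Pow C. (w \<in> S) \<noteq> (w' \<in> S)}" and ?Y = "{S \<in> Pow C. (w \<in> S) = (w' \<in> S)}"
  have "bij_betw (\<lambda>S. sym_diff S {w}) ?X ?Y"
    by (rule bij_betwI[where g = "\<lambda>S. sym_diff S {w}"]) (use assms in auto)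
  then have "card ?X = card ?Y" by (rule bij_betw_same_card)
  moreover have "card (Pow C) = card (?X \<union> ?Y)" by (rule arg_cong[where f = card]) auto
  moreover have "card (?X \<union> ?Y) = card ?X + card ?Y" using assms(1) by (intro card_Un_disjoint) auto
  ultimately show ?thesis using assms(1) by (simp add: card_Pow)
qed

text \<open>Under \<open>Q w\<close> each estimate is off by \<open>\<Delta>\<close> with
  probability at most 1/16, so by Markov fewer than a quarter of the patterns err, except with
  probability 1/4. The change of measure turns this into
  \<open>9 / 16 \<le> measure P (A w) * K\<close>, and the masses of the disjoint events
  \<open>A w\<close> sum to at most 1.\<close>

lemma decoding_bound:
  assumes C: "finite C" and P: "prob_space P" "sets P = sets M"
    and Q: "\<And>w. w \<in> C \<Longrightarrow> prob_space (Q w)" "\<And>w. w \<in> C \<Longrightarrow> sets (Q w) = sets M"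
    and T: "\<And>S. S \<subseteq> C \<Longrightarrow> T S \<in> borel_measurable M"
    and PQ: "\<And>w A. w \<in> C \<Longrightarrow> A \<in> sets M \<Longrightarrow> (emeasure (Q w) A)\<^sup>2 \<le> emeasure P A * ennreal K"
    and K: "K \<ge> 0" and \<Delta>: "\<Delta> > 0"
    and L: "\<And>w S. w \<in> C \<Longrightarrow> S \<subseteq> C \<Longrightarrow> L2_norm (Q w) (\<lambda>x. T S x - (if w \<in> S then \<Delta> else - \<Delta>)) < ennreal (\<Delta> / 4)"
  shows "real (card C) * (9 / 16) \<le> K"
proof -
  interpret P: prob_space P by fact
  have spP: "space P = space M" using P(2) by (rule sets_eq_imp_space_eq)
  define wrong where "wrong = (\<lambda>w S. {x \<in> space M. \<Delta> \<le> \<bar>T S x - (if w \<in> S then \<Delta> else - \<Delta>)\<bar>})"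
  have wr: "wrong w S \<in> sets M" if "S \<subseteq> C" for w S
    unfolding wrong_def using T[OF that, measurable] by measurable
  define errs where "errs = (\<lambda>w x. \<Sum>S\<in>Pow C. indicator (wrong w S) x :: real)"
  have em: "errs w \<in> borel_measurable M" for w
    unfolding errs_def using wr by (intro borel_measurable_sum borel_measurable_indicator) auto
  define A where "A = (\<lambda>w. {x \<in> space M. 4 * errs w x < 2 ^ card C})"
  have A: "A w \<in> sets M" for w unfolding A_def using em[of w, measurable] by measurable
  have QA: "measure (Q w) (A w) \<ge> 3 / 4" if w: "w \<in> C" for w
  proof -
    interpret Q: prob_space "Q w" using Q(1)[OF w] .
    have sq[measurable_cong]: "sets (Q w) = sets M" using Q(2)[OF w] .
    have spQ: "space (Q w) = space M" using sq by (rule sets_eq_imp_space_eq)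
    have b: "measure (Q w) (wrong w S) \<le> 1 / 16" if S: "S \<subseteq> C" for S
    proof -
      have "measure (Q w) {x \<in> space (Q w). \<Delta> \<le> \<bar>T S x - (if w \<in> S then \<Delta> else - \<Delta>)\<bar>} \<le> ((\<Delta> / 4) / \<Delta>)\<^sup>2"
        by (rule L2_norm_tail[OF Q(1)[OF w] _ L[OF w S] \<Delta>]) (use T[OF S, measurable] in measurable)
      then show ?thesis using \<Delta> by (simp add: wrong_def spQ power2_eq_square)
    qed
    have ie: "integrable (Q w) (indicator (wrong w S) :: _ \<Rightarrow> real)" if "S \<subseteq> C" for S
      using wr[OF that] by (intro integrable_real_indicator) (auto simp: sq Q.emeasure_eq_measure)
    have int: "integrable (Q w) (errs w)"
      unfolding errs_def using ie by (intro Bochner_Integration.integrable_sum) auto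
    have "(\<integral>x. errs w x \<partial>Q w) = (\<Sum>S\<in>Pow C. measure (Q w) (wrong w S))"
      unfolding errs_def using ie wr sq by (subst Bochner_Integration.integral_sum) (auto simp: sets.Int_space_eq2)
    also have "\<dots> \<le> (\<Sum>S\<in>Pow C. 1 / 16)" by (intro sum_mono b) auto
    also have "\<dots> = 2 ^ card C / 16" using C by (simp add: card_Pow)
    finally have e: "(\<integral>x. errs w x \<partial>Q w) \<le> 2 ^ card C / 16" .
    have "measure (Q w) {x \<in> space (Q w). 2 ^ card C / 4 \<le> errs w x} \<le> (\<integral>x. errs w x \<partial>Q w) / (2 ^ card C / 4)"
      by (rule integral_Markov_inequality_measure[OF int, of "{}"])
        (auto simp: errs_def intro!: sum_nonneg)
    also have "\<dots> \<le> 1 / 4" using e by (simp add: field_simps)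
    finally have "measure (Q w) (space (Q w) - A w) \<le> 1 / 4"
      by (simp add: A_def spQ set_diff_eq not_less conj_commute field_simps cong: conj_cong)
    then show ?thesis using Q.prob_compl[of "A w"] A[of w] sq by simp
  qed
  have PA: "9 / 16 \<le> measure P (A w) * K" if w: "w \<in> C" for w
  proof -
    interpret Q: prob_space "Q w" using Q(1)[OF w] .
    have "(3 / 4)\<^sup>2 \<le> (measure (Q w) (A w))\<^sup>2" using QA[OF w] by (intro power_mono) auto
    also have "\<dots> \<le> measure P (A w) * K"
      using PQ[OF w A, of w] K by (simp add: P.emeasure_eq_measure Q.emeasure_eq_measure ennreal_power ennreal_mult[symmetric])
    finally show ?thesis by (simp add: power2_eq_square)
  qed
  have disj: "disjoint_family_on A C"
    unfolding disjoint_family_on_def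
  proof (intro ballI impI)
    fix w w' assume w: "w \<in> C" "w' \<in> C" "w \<noteq> w'"
    have False if x: "x \<in> A w" "x \<in> A w'" for x
    proof -
      \<comment> \<open>No value is strictly within \<open>\<Delta>\<close> of both
        \<open>\<Delta>\<close> and \<open>- \<Delta>\<close>, so each pattern that separates
        \<open>w\<close> from \<open>w'\<close> is wrong for one of them. The two words together
        account for fewer errors than half the number of patterns, but exactly half of the patterns
        separate.\<close>
      have "(\<Sum>S\<in>Pow C. (if (w \<in> S) \<noteq> (w' \<in> S) then 1 else 0)) \<le>
         (\<Sum>S\<in>Pow C. indicator (wrong w S) x + indicator (wrong w' S) x :: real)"
        using x \<Delta> by (intro sum_mono) (auto simp: indicator_def wrong_def A_def)
      also have "\<dots> = errs w x + errs w' x" by (simp add: errs_def sum.distrib)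
      also have "\<dots> < 2 ^ card C / 2" using x by (simp add: A_def)
      finally have "2 * real (card {S \<in> Pow C. (w \<in> S) \<noteq> (w' \<in> S)}) < 2 ^ card C"
        using C by (simp add: sum.If_cases Int_def)
      then show False using arg_cong[OF card_separating_subsets[OF C w], of real] by simp
    qed
    then show "A w \<inter> A w' = {}" by blast
  qed
  have "real (card C) * (9 / 16) = (\<Sum>w\<in>C. 9 / 16)" by simp
  also have "\<dots> \<le> (\<Sum>w\<in>C. measure P (A w) * K)" by (intro sum_mono PA)
  also have "\<dots> = (\<Sum>w\<in>C. measure P (A w)) * K" by (simp add: sum_distrib_right)
  also have "(\<Sum>w\<in>C. measure P (A w)) = measure P (\<Union>w\<in>C. A w)"
    using A P(2) C disj by (intro P.finite_measure_finite_Union[symmetric]) auto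
  also have "\<dots> * K \<le> 1 * K" using K by (intro mult_right_mono) auto
  finally show ?thesis by simp
qed

section \<open>Spiked covariance operators\<close>

lemma power2_norm_add_scaleR:
  fixes p q :: "'a::real_inner"
  shows "(norm (p + c *\<^sub>R q))\<^sup>2 = (norm p)\<^sup>2 + 2 * c * (p \<bullet> q) + c\<^sup>2 * (norm q)\<^sup>2"
  unfolding power2_norm_eq_inner
  by (simp add: inner_add_left inner_add_right inner_commute[of q p] power2_eq_square algebra_simps)

lemma subspace_eigenspace: "subspace H \<Longrightarrow> subspace (eigenspace H A z)"
  unfolding eigenspace_def subspace_def by (auto simp: blinfun.zero_right blinfun.add_right blinfun.scaleR_right scaleR_add_right)

lemma not_in_op_spectrum_bounded_below:
  assumes "z \<notin> op_spectrum H A"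
  shows "\<exists>b>0. \<forall>x\<in>H. norm x \<le> b * norm (blinfun_apply A x - z *\<^sub>R x)"
proof -
  obtain B where B: "\<forall>x\<in>H. blinfun_apply B (blinfun_apply A x - z *\<^sub>R x) = x"
    using assms unfolding op_spectrum_def by blast
  have "norm x \<le> (norm B + 1) * norm (blinfun_apply A x - z *\<^sub>R x)" if "x \<in> H" for x
    using norm_blinfun[of B "blinfun_apply A x - z *\<^sub>R x"] B that
    by (simp add: distrib_right add_increasing2)
  then show ?thesis by (intro exI[of _ "norm B + 1"]) (simp add: add_nonneg_pos)
qed

text \<open>A self-adjoint operator has \<open>\<parallel>A\<parallel>\<close> or \<open>- \<parallel>A\<parallel>\<close> in its spectrum: otherwise \<open>A\<^sup>2 - \<parallel>A\<parallel>\<^sup>2\<close> would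
  be bounded below, and almost maximizing vectors contradict this.\<close>

lemma norm_in_op_spectrum:
  fixes A :: "'h::real_inner \<Rightarrow>\<^sub>L 'h"
  assumes H: "subspace H" and A: "A \<in> operators_on H"
    and sym: "\<And>x y. blinfun_apply A x \<bullet> y = x \<bullet> blinfun_apply A y"
    and pos: "norm A > 0"
  shows "norm A \<in> op_spectrum H A \<or> - norm A \<in> op_spectrum H A"
proof (rule ccontr)
  assume neg: "\<not> ?thesis"
  define M where "M = norm A"
  have M: "M > 0" using pos by (simp add: M_def)
  have AH: "blinfun_apply A x \<in> H" for x using A by (simp add: operators_on_def)
  obtain b1 where b1: "b1 > 0" "\<And>x. x \<in> H \<Longrightarrow> norm x \<le> b1 * norm (blinfun_apply A x - M *\<^sub>R x)"
    using not_in_op_spectrum_bounded_below[of M H A] neg by (auto simp: M_def)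
  obtain b2 where b2: "b2 > 0" "\<And>x. x \<in> H \<Longrightarrow> norm x \<le> b2 * norm (blinfun_apply A x - (- M) *\<^sub>R x)"
    using not_in_op_spectrum_bounded_below[of "- M" H A] neg by (auto simp: M_def)
  define b where "b = b1 * b2"
  have b: "b > 0" using b1 b2 by (simp add: b_def)
  \<comment> \<open>Composition of the two lower bounds, since \<open>A + M\<close> after
    \<open>A - M\<close> is \<open>A\<^sup>2 - M\<^sup>2\<close>.\<close>
  have low: "norm x \<le> b * norm (blinfun_apply A (blinfun_apply A x) - M\<^sup>2 *\<^sub>R x)" if x: "x \<in> H" for x
  proof -
    define y where "y = blinfun_apply A x - M *\<^sub>R x"
    have y: "y \<in> H" unfolding y_def using H x AH by (simp add: subspace_diff subspace_scale)
    have "norm x \<le> b1 * norm y" using b1(2)[OF x] by (simp add: y_def)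
    also have "\<dots> \<le> b1 * (b2 * norm (blinfun_apply A y - (- M) *\<^sub>R y))"
      using b1(1) b2(2)[OF y] by (intro mult_left_mono) auto
    also have "blinfun_apply A y - (- M) *\<^sub>R y = blinfun_apply A (blinfun_apply A x) - M\<^sup>2 *\<^sub>R x"
      by (simp add: y_def blinfun.diff_right blinfun.scaleR_right scaleR_diff_right power2_eq_square)
    finally show ?thesis by (simp add: b_def mult.assoc)
  qed
  \<comment> \<open>Expanding the squared norm of \<open>A (A x) - M\<^sup>2 *\<^sub>R x\<close> by
    symmetry and using \<open>low\<close> gives a factor strictly below \<open>M\<^sup>2\<close>.
    The sign of \<open>q\<close> is left open, hence the \<open>max\<close> below.\<close>
  define q where "q = M\<^sup>2 - 1 / (b\<^sup>2 * M\<^sup>2)"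
  have contr: "(norm (blinfun_apply A x))\<^sup>2 \<le> q * (norm x)\<^sup>2" if x: "x \<in> H" for x
  proof -
    let ?Ax = "blinfun_apply A x"
    have "(norm (blinfun_apply A ?Ax))\<^sup>2 \<le> (M * norm ?Ax)\<^sup>2"
      using norm_blinfun[of A ?Ax] by (intro power_mono) (auto simp: M_def)
    then have 1: "(norm (blinfun_apply A ?Ax))\<^sup>2 \<le> M\<^sup>2 * (norm ?Ax)\<^sup>2" by (simp add: power_mult_distrib)
    have "(norm x)\<^sup>2 \<le> (b * norm (blinfun_apply A ?Ax - M\<^sup>2 *\<^sub>R x))\<^sup>2"
      using low[OF x] by (intro power_mono) auto
    also have "\<dots> = b\<^sup>2 * (norm (blinfun_apply A ?Ax - M\<^sup>2 *\<^sub>R x))\<^sup>2" by (simp add: power_mult_distrib)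
    also have "(norm (blinfun_apply A ?Ax - M\<^sup>2 *\<^sub>R x))\<^sup>2 =
        (norm (blinfun_apply A ?Ax))\<^sup>2 - 2 * M\<^sup>2 * (norm ?Ax)\<^sup>2 + (M\<^sup>2)\<^sup>2 * (norm x)\<^sup>2"
      using power2_norm_add_scaleR[of "blinfun_apply A ?Ax" "- M\<^sup>2" x] sym[of ?Ax x]
      by (simp add: power2_norm_eq_inner[of ?Ax])
    also have "b\<^sup>2 * \<dots> \<le> b\<^sup>2 * (M\<^sup>2 * (M\<^sup>2 * (norm x)\<^sup>2 - (norm ?Ax)\<^sup>2))"
      using 1 by (intro mult_left_mono) (auto simp: algebra_simps power2_eq_square)
    finally have "(norm x)\<^sup>2 / (b\<^sup>2 * M\<^sup>2) \<le> M\<^sup>2 * (norm x)\<^sup>2 - (norm ?Ax)\<^sup>2"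
      using b M by (simp add: pos_divide_le_eq mult_ac)
    then show ?thesis by (simp add: q_def left_diff_distrib)
  qed
  define p where "p = sqrt (max q 0)"
  have p: "p \<ge> 0" "p\<^sup>2 = max q 0" by (auto simp: p_def)
  have "max q 0 < M\<^sup>2" using b M by (simp add: q_def)
  then have pM: "p < M" using p M by (metis less_eq_real_def power2_less_imp_less)
  have cH: "norm (blinfun_apply A x) \<le> p * norm x" if "x \<in> H" for x
  proof (rule power2_le_imp_le)
    have "q * (norm x)\<^sup>2 \<le> max q 0 * (norm x)\<^sup>2" by (intro mult_right_mono) auto
    then show "(norm (blinfun_apply A x))\<^sup>2 \<le> (p * norm x)\<^sup>2"
      using contr[OF that] by (simp add: power_mult_distrib p(2))
  qed (use p in simp)
  \<comment> \<open>For vectors outside \<open>H\<close>, symmetry writes the squared norm of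
    \<open>A x\<close> as \<open>x \<bullet> A (A x)\<close>, where the inner \<open>A x\<close>
    lies in \<open>H\<close>.\<close>
  have "norm (blinfun_apply A x) \<le> p * norm x" for x
  proof (cases "blinfun_apply A x = 0")
    case False
    let ?Ax = "blinfun_apply A x"
    have "norm ?Ax * norm ?Ax = x \<bullet> blinfun_apply A ?Ax"
      using sym[of x ?Ax] by (simp add: power2_norm_eq_inner[symmetric] power2_eq_square)
    also have "\<dots> \<le> norm x * (p * norm ?Ax)"
      using norm_cauchy_schwarz[of x "blinfun_apply A ?Ax"] mult_left_mono[OF cH[OF AH], of "norm x" x] by simp
    finally have "norm ?Ax * norm ?Ax \<le> (p * norm x) * norm ?Ax" by (simp add: mult_ac)
    then show ?thesis using False by (simp add: mult_le_cancel_right)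
  qed (use p in simp)
  then have "norm A \<le> p" by (intro norm_blinfun_bound p)
  then show False using pM by (simp add: M_def)
qed

text \<open>The norm or its negative lies in the spectrum, and no spectral value is negative. This
  lets the bound on the effective rank become the bound \<open>r * \<nu>\<close> on the
  trace.\<close>

lemma spiked_covariance_norm:
  assumes H: "subspace H" and S: "spiked_covariance H d \<nu> \<mu> \<Sigma>"
  shows "norm \<Sigma> \<le> \<nu>"
proof (cases "norm \<Sigma> > 0")
  case True
  have op: "\<Sigma> \<in> operators_on H" and spec: "op_spectrum H \<Sigma> \<subseteq> {\<nu>, \<mu>, 0}" and m: "0 < \<mu>" "\<mu> < \<nu>"
    and cov: "\<exists>P. centered_gaussian P \<Sigma>"
    using S by (auto simp: spiked_covariance_def covariance_operator_on_def)
  have "blinfun_apply \<Sigma> x \<bullet> y = x \<bullet> blinfun_apply \<Sigma> y" for x y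
    using cov centered_gaussian_symmetric[of _ \<Sigma> x y] by (auto simp: inner_commute)
  then have "norm \<Sigma> \<in> op_spectrum H \<Sigma> \<or> - norm \<Sigma> \<in> op_spectrum H \<Sigma>"
    by (intro norm_in_op_spectrum[OF H op _ True])
  then have "norm \<Sigma> \<in> {\<nu>, \<mu>, 0} \<or> - norm \<Sigma> \<in> {\<nu>, \<mu>, 0}" using spec by blast
  then show ?thesis using m True unfolding insert_iff empty_iff by (elim disjE) (linarith | simp)+
next
  case False
  then show ?thesis using S by (simp add: spiked_covariance_def)
qed

section \<open>Eigenvectors and orthonormal families\<close>

lemma spiked_covariance_top_eigenvector:
  assumes H: "subspace H" and S: "spiked_covariance H d \<nu> \<mu> \<Sigma>"
  shows "\<exists>u\<in>H. norm u = 1 \<and> blinfun_apply \<Sigma> u = \<nu> *\<^sub>R u"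
proof -
  have "dim (eigenspace H \<Sigma> \<nu>) = 1" using S by (simp add: spiked_covariance_def)
  then have "\<not> eigenspace H \<Sigma> \<nu> \<subseteq> {0}" using dim_le_card[of "eigenspace H \<Sigma> \<nu>" "{}"] by auto
  then obtain x where x: "x \<in> H" "blinfun_apply \<Sigma> x = \<nu> *\<^sub>R x" "x \<noteq> 0" by (auto simp: eigenspace_def)
  show ?thesis
    by (rule bexI[of _ "x /\<^sub>R norm x"]) (use x H in \<open>simp_all add: blinfun.scaleR_right subspace_scale\<close>)
qed

lemma exists_orthonormal_family:
  fixes V :: "'h::real_inner set"
  assumes V: "subspace V" and m: "0 < m" "dim V = m"
  shows "\<exists>(I :: 'h set) e. finite I \<and> card I = m \<and> (\<forall>i\<in>I. e i \<in> V \<and> norm (e i) = 1) \<and>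
     (\<forall>i\<in>I. \<forall>j\<in>I. i \<noteq> j \<longrightarrow> e i \<bullet> e j = 0)"
proof -
  obtain B where B: "B \<subseteq> V" "independent B" "V \<subseteq> span B" "card B = dim V"
    using basis_exists[of V] by blast
  \<comment> \<open>\<open>card\<close> is 0 on infinite sets, so \<open>m > 0\<close> makes the
    basis finite.\<close>
  have fB: "finite B" using B(4) m card.infinite by force
  obtain C where C: "finite C" "span C = span B" "pairwise orthogonal C"
    using basis_orthogonal[OF fB] by blast
  \<comment> \<open>The orthogonal spanning set is not known to avoid 0, so 0 is discarded before
    \<open>m\<close> vectors are selected and normalised.\<close>
  have "V \<subseteq> span (C - {0})" using B(3) C(2) by (simp add: span_delete_0)
  then have "m \<le> card (C - {0})" using dim_le_card[of V "C - {0}"] C(1) m by simp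
  then obtain I where I: "I \<subseteq> C - {0}" "card I = m" "finite I" using obtain_subset_with_card_n by blast
  have CV: "C \<subseteq> V" using B(1) C(2) V by (metis span_minimal span_superset subset_trans)
  show ?thesis
  proof (intro exI[of _ I] exI[of _ "\<lambda>x. x /\<^sub>R norm x"] conjI ballI impI)
    fix i assume "i \<in> I"
    then show "i /\<^sub>R norm i \<in> V" using I CV V by (auto intro: subspace_scale)
    have "i \<noteq> 0" using \<open>i \<in> I\<close> I by auto
    then show "norm (i /\<^sub>R norm i) = 1" by simp
    fix j assume "j \<in> I" "i \<noteq> j"
    then show "(i /\<^sub>R norm i) \<bullet> (j /\<^sub>R norm j) = 0"
      using \<open>i \<in> I\<close> I C(3) by (auto simp: pairwise_def orthogonal_def)
  qed (use I in auto)
qed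

section \<open>Rank one perturbations of a covariance operator\<close>

lift_definition rank_one :: "'h::real_inner \<Rightarrow> 'h \<Rightarrow> ('h \<Rightarrow>\<^sub>L 'h)" is "\<lambda>u v x. (x \<bullet> u) *\<^sub>R v"
  by (rule bounded_linear_scaleR_const[OF bounded_linear_inner_left])

lemma norm_rank_one_le: "norm (rank_one u v) \<le> norm u * norm v"
proof (rule norm_blinfun_bound)
  fix x
  have "\<bar>x \<bullet> u\<bar> * norm v \<le> norm x * norm u * norm v"
    by (intro mult_right_mono Cauchy_Schwarz_ineq2) auto
  then show "norm (blinfun_apply (rank_one u v) x) \<le> norm u * norm v * norm x"
    by (simp add: rank_one.rep_eq mult_ac)
qed simp

text \<open>The covariance operator of \<open>X + \<beta> (X \<bullet> u) v\<close> if \<open>\<Sigma> u = \<nu> u\<close>.\<close>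

definition perturbed :: "('h::real_inner \<Rightarrow>\<^sub>L 'h) \<Rightarrow> real \<Rightarrow> real \<Rightarrow> 'h \<Rightarrow> 'h \<Rightarrow> ('h \<Rightarrow>\<^sub>L 'h)" where
  "perturbed \<Sigma> \<nu> \<beta> u v = \<Sigma> + ((\<beta> * \<nu>) *\<^sub>R (rank_one u v + rank_one v u) + (\<beta>\<^sup>2 * \<nu>) *\<^sub>R rank_one v v)"

lemma perturbed_apply:
  "blinfun_apply (perturbed \<Sigma> \<nu> \<beta> u v) x = blinfun_apply \<Sigma> x +
     ((\<beta> * \<nu>) *\<^sub>R ((x \<bullet> u) *\<^sub>R v + (x \<bullet> v) *\<^sub>R u) + (\<beta>\<^sup>2 * \<nu> * (x \<bullet> v)) *\<^sub>R v)"
  by (simp add: perturbed_def blinfun.add_left blinfun.scaleR_left rank_one.rep_eq)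

text \<open>The sign condition on \<open>u \<bullet> v\<close> covers both choices in use:
  \<open>v = u\<close>, a rescaling, and \<open>v\<close> orthogonal to \<open>u\<close>, a
  shear.\<close>

locale spike =
  fixes P :: "'h::{real_inner, polish_space} measure" and \<Sigma> :: "'h \<Rightarrow>\<^sub>L 'h" and \<nu> \<beta> :: real and u v :: 'h
  assumes G: "centered_gaussian P \<Sigma>" and u: "norm u = 1" and v: "norm v = 1"
    and ev: "blinfun_apply \<Sigma> u = \<nu> *\<^sub>R u" and \<nu>: "\<nu> > 0" and \<beta>: "\<beta> \<ge> 0" and uv: "u \<bullet> v \<ge> 0"
begin

abbreviation "B \<equiv> \<lambda>x. x + (\<beta> * (x \<bullet> u)) *\<^sub>R v"
abbreviation "\<Sigma>' \<equiv> perturbed \<Sigma> \<nu> \<beta> u v"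

text \<open>The squared norm of \<open>B u = u + \<beta> *\<^sub>R v\<close>; the norm of
  \<open>\<Sigma>'\<close> turns out to be at least \<open>\<nu> * \<rho>\<close>.\<close>

definition "\<rho> = 1 + 2 * \<beta> * (u \<bullet> v) + \<beta>\<^sup>2"

lemma uu: "u \<bullet> u = 1" and vv: "v \<bullet> v = 1"
  using u v by (simp_all add: norm_eq_1)

lemma \<rho>_ge_1: "\<rho> \<ge> 1"
  using \<beta> uv by (simp add: \<rho>_def)

lemma centered_gaussian_perturbed: "centered_gaussian (distr P borel B) \<Sigma>'"
proof (rule centered_gaussian_image[OF G, where C = "\<lambda>w. w + (\<beta> * (w \<bullet> v)) *\<^sub>R u"])
  show "B x \<bullet> w = x \<bullet> (w + (\<beta> * (w \<bullet> v)) *\<^sub>R u)" for x w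
    by (simp add: inner_add_left inner_add_right inner_commute)
  have s: "blinfun_apply \<Sigma> w \<bullet> u = \<nu> * (w \<bullet> u)" for w
    using centered_gaussian_symmetric[OF G, of w u] by (simp add: ev inner_commute)
  show "blinfun_apply \<Sigma>' w = B (blinfun_apply \<Sigma> (w + (\<beta> * (w \<bullet> v)) *\<^sub>R u))" for w
    by (simp add: perturbed_apply blinfun.add_right blinfun.scaleR_right ev inner_add_left s uu
        scaleR_add_left scaleR_add_right algebra_simps power2_eq_square)
qed measurable

lemma gaussian_law_perturbed: "gaussian_law \<Sigma>' = distr P borel B"
  by (rule gaussian_law_eqI[OF centered_gaussian_perturbed])

lemma norm_perturbed_diff: "norm (\<Sigma>' - \<Sigma>) \<le> \<nu> * (2 * \<beta> + \<beta>\<^sup>2)"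
proof -
  have r: "norm (rank_one u v) \<le> 1" "norm (rank_one v u) \<le> 1" "norm (rank_one v v) \<le> 1"
    using norm_rank_one_le[of u v] norm_rank_one_le[of v u] norm_rank_one_le[of v v] u v by simp_all
  have "norm (\<Sigma>' - \<Sigma>) \<le> norm ((\<beta> * \<nu>) *\<^sub>R (rank_one u v + rank_one v u)) + norm ((\<beta>\<^sup>2 * \<nu>) *\<^sub>R rank_one v v)"
    by (simp add: perturbed_def norm_triangle_ineq del: norm_scaleR)
  also have "\<dots> \<le> (\<beta> * \<nu>) * (1 + 1) + (\<beta>\<^sup>2 * \<nu>) * 1"
    using \<beta> \<nu> r norm_triangle_ineq[of "rank_one u v" "rank_one v u"]
      mult_left_mono[OF r(3), of "\<beta>\<^sup>2 * \<nu>"]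
    by (intro add_mono) (auto intro!: mult_left_mono)
  finally show ?thesis by (simp add: algebra_simps)
qed

text \<open>The quadratic form of \<open>\<Sigma>'\<close> at \<open>w = B u\<close> is that of
  \<open>\<Sigma>\<close> at \<open>z\<close>, the adjoint of \<open>B\<close> applied to
  \<open>w\<close>. The component of \<open>z\<close> along \<open>u\<close> is
  \<open>\<rho>\<close> and contributes \<open>\<nu> * \<rho>\<^sup>2\<close>, and
  \<open>\<Sigma>\<close> is nonnegative on the rest; dividing by the squared norm
  \<open>\<rho>\<close> of \<open>w\<close> gives the bound.\<close>

lemma norm_perturbed_ge: "\<nu> * \<rho> \<le> norm \<Sigma>'"
proof -
  define w where "w = u + \<beta> *\<^sub>R v"
  define z where "z = w + (\<beta> * (w \<bullet> v)) *\<^sub>R u"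
  have ww: "w \<bullet> w = \<rho>"
    by (simp add: w_def \<rho>_def inner_add_left inner_add_right uu vv inner_commute power2_eq_square algebra_simps)
  have zu: "z \<bullet> u = \<rho>"
    by (simp add: z_def w_def \<rho>_def inner_add_left inner_add_right uu vv inner_commute power2_eq_square algebra_simps)
  have s: "blinfun_apply \<Sigma> x \<bullet> u = \<nu> * (x \<bullet> u)" for x
    using centered_gaussian_symmetric[OF G, of x u] by (simp add: ev inner_commute)
  have "0 \<le> blinfun_apply \<Sigma> (z - \<rho> *\<^sub>R u) \<bullet> (z - \<rho> *\<^sub>R u)" by (rule centered_gaussian_nonneg[OF G])
  also have "\<dots> = blinfun_apply \<Sigma> z \<bullet> z - \<nu> * \<rho>\<^sup>2"
    using zu by (simp add: blinfun.diff_right blinfun.scaleR_right ev inner_diff_left inner_diff_right s uu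
        inner_commute[of u z] power2_eq_square)
  finally have "\<nu> * \<rho>\<^sup>2 \<le> blinfun_apply \<Sigma> z \<bullet> z" by simp
  also have "\<dots> = blinfun_apply \<Sigma>' w \<bullet> w"
    by (simp add: z_def perturbed_apply blinfun.add_right blinfun.scaleR_right ev inner_add_left inner_add_right
        s uu inner_commute[of u w] inner_commute[of v w] power2_eq_square algebra_simps)
  also have "\<dots> \<le> norm \<Sigma>' * norm w * norm w"
    using norm_cauchy_schwarz[of "blinfun_apply \<Sigma>' w" w] mult_right_mono[OF norm_blinfun[of \<Sigma>' w], of "norm w"] by simp
  also have "\<dots> = norm \<Sigma>' * \<rho>"
    by (simp add: ww[symmetric] power2_norm_eq_inner[symmetric] power2_eq_square)
  finally have "(\<nu> * \<rho>) * \<rho> \<le> norm \<Sigma>' * \<rho>" by (simp add: power2_eq_square)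
  then show ?thesis using \<rho>_ge_1 by (simp add: mult_le_cancel_right)
qed

text \<open>Expanding the square of \<open>norm (B x)\<close> adds two covariances to the trace,
  both evaluated by the eigenvector equation for \<open>u\<close>.\<close>

lemma second_moment_perturbed:
  assumes "(\<integral>\<^sup>+x. ennreal ((norm x)\<^sup>2) \<partial>P) \<le> ennreal t" "t \<ge> 0"
  shows "(\<integral>\<^sup>+x. ennreal ((norm x)\<^sup>2) \<partial>gaussian_law \<Sigma>') \<le> ennreal (t + \<nu> * (\<rho> - 1))"
proof -
  interpret prob_space P by (rule centered_gaussianD[OF G])
  have [measurable_cong]: "sets P = sets borel" by (rule centered_gaussianD[OF G])
  have fin: "(\<integral>\<^sup>+x. ennreal ((norm x)\<^sup>2) \<partial>P) < \<infinity>" using assms(1) by (rule le_less_trans) simp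
  have i0: "integrable P (\<lambda>x. (norm x)\<^sup>2)" by (rule integrableI_nonneg) (use fin in auto)
  have i: "integrable P (\<lambda>x. (x \<bullet> y) * (x \<bullet> z))" if "norm y = 1" "norm z = 1" for y z
  proof (rule Bochner_Integration.integrable_bound[OF i0])
    have "\<bar>x \<bullet> y\<bar> * \<bar>x \<bullet> z\<bar> \<le> norm x * norm x" for x
      using Cauchy_Schwarz_ineq2[of x y] Cauchy_Schwarz_ineq2[of x z] that by (intro mult_mono) auto
    then show "AE x in P. norm ((x \<bullet> y) * (x \<bullet> z)) \<le> norm ((norm x)\<^sup>2)"
      by (simp add: abs_mult power2_eq_square)
  qed measurable
  have n: "(norm (B x))\<^sup>2 = (norm x)\<^sup>2 + (2 * \<beta> * ((x \<bullet> u) * (x \<bullet> v)) + \<beta>\<^sup>2 * ((x \<bullet> u) * (x \<bullet> u)))" for x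
    by (simp add: power2_norm_add_scaleR v power_mult_distrib power2_eq_square[of "x \<bullet> u"])
  have "(\<integral>\<^sup>+x. ennreal ((norm x)\<^sup>2) \<partial>gaussian_law \<Sigma>') = (\<integral>\<^sup>+x. ennreal ((norm (B x))\<^sup>2) \<partial>P)"
    unfolding gaussian_law_perturbed by (rule nn_integral_distr) measurable
  also have "\<dots> = ennreal (\<integral>x. (norm (B x))\<^sup>2 \<partial>P)"
  proof (rule nn_integral_eq_integral)
    show "integrable P (\<lambda>x. (norm (B x))\<^sup>2)"
      unfolding n by (intro Bochner_Integration.integrable_add integrable_mult_right i0 i u v)
  qed simp
  also have "(\<integral>x. (norm (B x))\<^sup>2 \<partial>P) = (\<integral>x. (norm x)\<^sup>2 \<partial>P) + \<nu> * (\<rho> - 1)"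
  proof -
    have "(\<integral>x. (norm (B x))\<^sup>2 \<partial>P) = (\<integral>x. (norm x)\<^sup>2 \<partial>P) +
        (2 * \<beta> * (\<integral>x. (x \<bullet> u) * (x \<bullet> v) \<partial>P) + \<beta>\<^sup>2 * (\<integral>x. (x \<bullet> u) * (x \<bullet> u) \<partial>P))"
      unfolding n using i0 i[OF u v] i[OF u u] by simp
    then show ?thesis by (simp add: centered_gaussianD(3)[OF G] ev uu \<rho>_def algebra_simps)
  qed
  also have "(\<integral>x. (norm x)\<^sup>2 \<partial>P) \<le> t"
    using assms nn_integral_eq_integral[OF i0] by simp
  finally show ?thesis by (simp add: ennreal_leI)
qed

text \<open>The bound \<open>r * \<nu>\<close> on the trace grows by
  \<open>\<nu> * (\<rho> - 1)\<close>, while the norm rises to at least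
  \<open>\<nu> * \<rho>\<close>. As \<open>r \<ge> 1\<close>, the new trace is at most
  \<open>r\<close> times the new norm.\<close>

lemma perturbed_in_covariance_class:
  assumes H: "subspace H" "u \<in> H" "v \<in> H" and S: "\<Sigma> \<in> covariance_class H a r"
    and n: "norm \<Sigma> \<le> \<nu>" and r: "r \<ge> 1" and small: "\<nu> * (2 * \<beta> + \<beta>\<^sup>2) \<le> a - \<nu>"
  shows "\<Sigma>' \<in> covariance_class H a r"
proof -
  have op: "\<Sigma> \<in> operators_on H" and er: "effective_rank \<Sigma> \<le> ennreal r"
    using S by (auto simp: covariance_class_def covariance_operator_on_def)
  have "\<Sigma>' \<in> operators_on H"
    using op H by (auto simp: operators_on_def perturbed_apply orthogonal_comp_def orthogonal_def inner_commute
        intro!: subspace_add subspace_scale)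
  moreover have "norm \<Sigma>' \<le> a"
    using norm_triangle_ineq[of \<Sigma> "\<Sigma>' - \<Sigma>"] norm_perturbed_diff n small by simp
  moreover have "effective_rank \<Sigma>' \<le> ennreal r"
  proof -
    define J where "J = (\<integral>\<^sup>+x. ennreal ((norm x)\<^sup>2) \<partial>P)"
    have n0: "norm \<Sigma> > 0" using ev \<nu> u by (auto simp: blinfun.zero_left)
    have "J / ennreal (norm \<Sigma>) \<le> ennreal r"
      using er by (simp add: effective_rank_def J_def gaussian_law_eqI[OF G])
    then have "J / ennreal (norm \<Sigma>) * ennreal (norm \<Sigma>) \<le> ennreal r * ennreal (norm \<Sigma>)"
      by (rule mult_right_mono) simp
    then have "J \<le> ennreal r * ennreal (norm \<Sigma>)"
      using n0 by (simp add: ennreal_divide_times divide_ennreal)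
    also have "\<dots> \<le> ennreal (r * \<nu>)"
      using n r by (simp add: ennreal_mult'[symmetric] ennreal_leI mult_left_mono)
    finally have "(\<integral>\<^sup>+x. ennreal ((norm x)\<^sup>2) \<partial>gaussian_law \<Sigma>') \<le> ennreal (r * \<nu> + \<nu> * (\<rho> - 1))"
      using r \<nu> unfolding J_def by (intro second_moment_perturbed) auto
    also have "\<dots> \<le> ennreal (r * norm \<Sigma>')"
    proof (rule ennreal_leI)
      have "\<nu> * (\<rho> - 1) * 1 \<le> \<nu> * (\<rho> - 1) * r" using \<nu> \<rho>_ge_1 r by (intro mult_left_mono) auto
      then have "r * \<nu> + \<nu> * (\<rho> - 1) \<le> r * (\<nu> * \<rho>)" by (simp add: algebra_simps)
      also have "\<dots> \<le> r * norm \<Sigma>'" using norm_perturbed_ge r by (intro mult_left_mono) auto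
      finally show "r * \<nu> + \<nu> * (\<rho> - 1) \<le> r * norm \<Sigma>'" .
    qed
    finally have "(\<integral>\<^sup>+x. ennreal ((norm x)\<^sup>2) \<partial>gaussian_law \<Sigma>') \<le> ennreal r * ennreal (norm \<Sigma>')"
      using r by (simp add: ennreal_mult)
    moreover have "norm \<Sigma>' > 0"
      using norm_perturbed_ge \<nu> \<rho>_ge_1 by (smt (verit) mult_pos_pos)
    ultimately show ?thesis unfolding effective_rank_def by (intro divide_le_posI_ennreal) (auto simp: mult.commute)
  qed
  ultimately show ?thesis
    using centered_gaussian_perturbed by (auto simp: covariance_class_def covariance_operator_on_def)
qed

lemma perturbed_apply_top: "blinfun_apply \<Sigma>' u = (\<nu> * (1 + \<beta> * (u \<bullet> v))) *\<^sub>R (u + \<beta> *\<^sub>R v)"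
  by (simp add: perturbed_apply ev uu algebra_simps power2_eq_square)

end

section \<open>Sign vectors\<close>

definition sign_vector :: "'i set \<Rightarrow> ('i \<Rightarrow> 'a::real_inner) \<Rightarrow> 'i set \<Rightarrow> 'a" where
  "sign_vector I e w = (1 / sqrt (card I)) *\<^sub>R (\<Sum>i\<in>I. (if i \<in> w then 1 else - 1) *\<^sub>R e i)"

lemma inner_orthonormal_sum:
  fixes e :: "'i \<Rightarrow> 'a::real_inner"
  assumes "finite I" "\<And>i. i \<in> I \<Longrightarrow> norm (e i) = 1" "\<And>i j. i \<in> I \<Longrightarrow> j \<in> I \<Longrightarrow> i \<noteq> j \<Longrightarrow> e i \<bullet> e j = 0"
  shows "(\<Sum>i\<in>I. c i *\<^sub>R e i) \<bullet> (\<Sum>i\<in>I. c i *\<^sub>R e i) = (\<Sum>i\<in>I. (c i)\<^sup>2)"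
proof -
  have "(\<Sum>i\<in>I. c i *\<^sub>R e i) \<bullet> (\<Sum>j\<in>I. c j *\<^sub>R e j) = (\<Sum>i\<in>I. \<Sum>j\<in>I. c i * c j * (e i \<bullet> e j))"
    unfolding inner_sum_left inner_sum_right
    by (intro sum.cong refl) (simp add: inner_commute mult.assoc)
  also have "\<dots> = (\<Sum>i\<in>I. \<Sum>j\<in>I. if j = i then (c i)\<^sup>2 else 0)"
    using assms(2,3) by (intro sum.cong refl) (auto simp: norm_eq_1 power2_eq_square)
  finally show ?thesis using assms(1) by simp
qed

lemma norm_sign_vector:
  assumes "finite I" "card I > 0" "\<And>i. i \<in> I \<Longrightarrow> norm (e i) = 1"
    "\<And>i j. i \<in> I \<Longrightarrow> j \<in> I \<Longrightarrow> i \<noteq> j \<Longrightarrow> e i \<bullet> e j = 0"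
  shows "norm (sign_vector I e w) = 1"
proof -
  have *: "(\<Sum>i\<in>I. (if i \<in> w then 1 else - 1) *\<^sub>R e i) \<bullet> (\<Sum>i\<in>I. (if i \<in> w then 1 else - 1) *\<^sub>R e i)
      = (\<Sum>i\<in>I. (if i \<in> w then 1 else - 1)\<^sup>2)"
    by (rule inner_orthonormal_sum) (use assms in auto)
  have "(\<Sum>i\<in>I. (if i \<in> w then 1 else - 1 :: real)\<^sup>2) = (\<Sum>i\<in>I. 1)" by (intro sum.cong) auto
  then have "norm (\<Sum>i\<in>I. (if i \<in> w then 1 else - 1) *\<^sub>R e i) = sqrt (card I)"
    unfolding norm_eq_sqrt_inner * by simp
  then show ?thesis using assms(2) by (simp add: sign_vector_def)
qed

text \<open>Differing signs leave a coefficient of absolute value 2, so Hamming separation of the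
  code becomes separation in norm.\<close>

lemma norm_sign_vector_diff:
  assumes I: "finite I" "card I > 0" "\<And>i. i \<in> I \<Longrightarrow> norm (e i) = 1"
    "\<And>i j. i \<in> I \<Longrightarrow> j \<in> I \<Longrightarrow> i \<noteq> j \<Longrightarrow> e i \<bullet> e j = 0"
    and w: "w \<subseteq> I" "w' \<subseteq> I"
  shows "(norm (sign_vector I e w - sign_vector I e w'))\<^sup>2 = 4 * card (sym_diff w w') / card I"
proof -
  let ?c = "\<lambda>i. (if i \<in> w then 1 else - 1) - (if i \<in> w' then 1 else - 1) :: real"
  have "sign_vector I e w - sign_vector I e w' = (1 / sqrt (card I)) *\<^sub>R (\<Sum>i\<in>I. ?c i *\<^sub>R e i)"
    by (simp add: sign_vector_def scaleR_diff_left scaleR_diff_right[symmetric] sum_subtractf)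
  moreover have "(\<Sum>i\<in>I. ?c i *\<^sub>R e i) \<bullet> (\<Sum>i\<in>I. ?c i *\<^sub>R e i) = (\<Sum>i\<in>I. (?c i)\<^sup>2)"
    by (rule inner_orthonormal_sum) (use I in auto)
  moreover have "(\<Sum>i\<in>I. (?c i)\<^sup>2) = (\<Sum>i\<in>I. if i \<in> sym_diff w w' then 4 else 0)"
    by (intro sum.cong) auto
  moreover have "\<dots> = 4 * card (sym_diff w w')"
  proof -
    have "I \<inter> sym_diff w w' = sym_diff w w'" using w by auto
    then show ?thesis using sum.inter_restrict[OF I(1), of "\<lambda>_. 4 :: real" "sym_diff w w'"] by simp
  qed
  ultimately show ?thesis
    using I(2) by (simp add: power2_norm_eq_inner power2_eq_square[symmetric] power_divide)
qed

lemma sign_vector_in_subspace: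
  "subspace V \<Longrightarrow> (\<And>i. i \<in> I \<Longrightarrow> e i \<in> V) \<Longrightarrow> sign_vector I e w \<in> V"
  unfolding sign_vector_def by (intro subspace_scale subspace_sum) auto

section \<open>Numerical estimates\<close>

lemma sin_ge_half:
  fixes x :: real
  assumes "0 \<le> x" "x \<le> 1"
  shows "x / 2 \<le> sin x"
proof -
  have "\<bar>sin x - (\<Sum>m<3. sin_coeff m * x ^ m)\<bar> \<le> inverse (fact 3) * \<bar>x\<bar> ^ 3"
    by (rule Maclaurin_sin_bound)
  moreover have "(\<Sum>m<3. sin_coeff m * x ^ m) = x"
    by (simp add: numeral_3_eq_3 sin_coeff_def)
  moreover have "x ^ 3 \<le> x"
    using power_decreasing[of 1 3 x] assms by simp
  ultimately have "\<bar>sin x - x\<bar> \<le> x / 6" using assms by (simp add: fact_numeral)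
  then show ?thesis using assms by linarith
qed

lemma inverse_sqrt_power_le_exp:
  fixes x :: real
  assumes "0 \<le> x" "x \<le> 1 / 2"
  shows "(1 / sqrt (1 - x)) ^ n \<le> exp (n * x)"
proof -
  have "1 + 2 * x \<le> exp (2 * x)" by (rule exp_ge_add_one_self)
  then have "(1 - x) * (1 + 2 * x) \<le> (1 - x) * exp (2 * x)" using assms by (intro mult_left_mono) auto
  moreover have "1 \<le> (1 - x) * (1 + 2 * x)"
    using mult_left_mono[of "2 * x" 1 x] assms by (simp add: algebra_simps)
  ultimately have "1 \<le> (1 - x) * exp (2 * x)" by linarith
  then have "1 / (1 - x) \<le> exp (2 * x)" using assms by (simp add: pos_divide_le_eq mult.commute)
  then have "sqrt (1 / (1 - x)) \<le> sqrt ((exp x)\<^sup>2)" by (simp add: exp_double[symmetric])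
  then have "1 / sqrt (1 - x) \<le> exp x" by (simp add: real_sqrt_divide)
  then have "(1 / sqrt (1 - x)) ^ n \<le> exp x ^ n" using assms by (intro power_mono) auto
  then show ?thesis by (simp add: exp_of_nat_mult)
qed

text \<open>Bernoulli's inequality gives \<open>(1 - y\<^sup>2) ^ n \<ge> 1 / 4\<close>.\<close>

lemma inverse_sqrt_power_le_2:
  fixes y :: real
  assumes "0 \<le> y" "n * y\<^sup>2 \<le> 3 / 4" "n \<ge> 1"
  shows "(1 / sqrt (1 - y\<^sup>2)) ^ n \<le> 2"
proof -
  have "y\<^sup>2 * 1 \<le> y\<^sup>2 * n" using assms(3) by (intro mult_left_mono) auto
  then have y: "y\<^sup>2 \<le> 3 / 4" using assms(2) by (simp add: mult.commute)
  have "1 - n * y\<^sup>2 \<le> (1 - y\<^sup>2) ^ n"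
    using Bernoulli_inequality[of "- y\<^sup>2" n] y by simp
  then have "(1 / 2)\<^sup>2 \<le> (1 - y\<^sup>2) ^ n" using assms(2) by (simp add: power2_eq_square)
  then have "1 / 2 \<le> sqrt ((1 - y\<^sup>2) ^ n)" by (rule real_le_rsqrt)
  then show ?thesis using y by (simp add: power_divide real_sqrt_power pos_divide_le_eq)
qed

text \<open>Compares the information in the sample with the size of the code. Since
  \<open>exp (1 / 16) \<le> 16 / 15\<close> and \<open>16 / 15 * (5 / 4) = 4 / 3\<close>, a surplus
  of \<open>(5 / 4) ^ m\<close> is left, which exceeds \<open>16 / 9\<close> for
  \<open>m \<ge> 4\<close>.\<close>

lemma exp_less_four_thirds_power:
  fixes m :: nat
  assumes "m \<ge> 4"
  shows "exp ((real m + 1) / 32) < (4 / 3) ^ m * (9 / 16)"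
proof -
  have "exp ((real m + 1) / 32) \<le> exp (real m * (1 / 16))" using assms by simp
  also have "\<dots> = exp (1 / 16) ^ m" by (rule exp_of_nat_mult)
  also have "\<dots> \<le> (16 / 15) ^ m"
  proof (rule power_mono)
    have "15 / 16 \<le> exp (- (1 / 16 :: real))" using exp_ge_add_one_self[of "- (1 / 16 :: real)"] by simp
    then show "exp (1 / 16 :: real) \<le> 16 / 15" by (simp add: exp_minus field_simps)
  qed simp
  also have "\<dots> < (4 / 3) ^ m * (9 / 16)"
  proof -
    have "(16 / 9 :: real) < (5 / 4) ^ 4" by (simp add: power_divide)
    also have "\<dots> \<le> (5 / 4) ^ m" using assms by (intro power_increasing) auto
    finally have "(16 / 15 :: real) ^ m * (16 / 9) < (16 / 15) ^ m * (5 / 4) ^ m" by (intro mult_strict_left_mono) auto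
    also have "\<dots> = (4 / 3 :: real) ^ m" by (simp add: power_mult_distrib[symmetric])
    finally show ?thesis by simp
  qed
  finally show ?thesis .
qed

section \<open>The minimax lower bound\<close>

definition minimax_risk ::
    "'h::{real_inner, polish_space} set \<Rightarrow> real \<Rightarrow> real \<Rightarrow> real \<Rightarrow> real \<Rightarrow> nat \<Rightarrow> ('h \<Rightarrow>\<^sub>L 'h) \<Rightarrow> ennreal" where
  "minimax_risk H s a r \<delta> n \<Sigma>\<^sub>0 =
     (SUP f\<in>{f. holder_norm (operators_on H) s a (ball \<Sigma>\<^sub>0 (2 * \<delta>) \<inter> operators_on H) f \<le> 1}.
      INF T\<in>estimators n.
      SUP \<Sigma>\<in>{\<Sigma>\<in>covariance_class H a r. norm (\<Sigma> - \<Sigma>\<^sub>0) < \<delta>}.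
        L2_norm (sample_law n \<Sigma>) (\<lambda>X. T X - f \<Sigma>))"

text \<open>Each \<open>f\<close> comes with an estimator of its own, which may depend on the signs
  of the bumps.\<close>

lemma minimax_risk_lessD:
  assumes less: "minimax_risk H s a r \<delta> n \<Sigma>\<^sub>0 < c"
    and f: "holder_norm (operators_on H) s a (ball \<Sigma>\<^sub>0 (2 * \<delta>) \<inter> operators_on H) f \<le> 1"
  shows "\<exists>T\<in>estimators n. \<forall>\<Sigma>\<in>covariance_class H a r. norm (\<Sigma> - \<Sigma>\<^sub>0) < \<delta> \<longrightarrow>
    L2_norm (sample_law n \<Sigma>) (\<lambda>X. T X - f \<Sigma>) < c"
proof -
  have "(INF T\<in>estimators n. SUP \<Sigma>\<in>{\<Sigma>\<in>covariance_class H a r. norm (\<Sigma> - \<Sigma>\<^sub>0) < \<delta>}.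
      L2_norm (sample_law n \<Sigma>) (\<lambda>X. T X - f \<Sigma>)) \<le> minimax_risk H s a r \<delta> n \<Sigma>\<^sub>0"
    unfolding minimax_risk_def by (rule SUP_upper2[of f]) (use f in auto)
  then have "(INF T\<in>estimators n. SUP \<Sigma>\<in>{\<Sigma>\<in>covariance_class H a r. norm (\<Sigma> - \<Sigma>\<^sub>0) < \<delta>}.
      L2_norm (sample_law n \<Sigma>) (\<lambda>X. T X - f \<Sigma>)) < c" using less by (rule le_less_trans)
  then obtain T where T: "T \<in> estimators n" and
    sup: "(SUP \<Sigma>\<in>{\<Sigma>\<in>covariance_class H a r. norm (\<Sigma> - \<Sigma>\<^sub>0) < \<delta>}.
      L2_norm (sample_law n \<Sigma>) (\<lambda>X. T X - f \<Sigma>)) < c"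
    unfolding INF_less_iff by blast
  have "L2_norm (sample_law n \<Sigma>) (\<lambda>X. T X - f \<Sigma>) < c"
    if "\<Sigma> \<in> covariance_class H a r" "norm (\<Sigma> - \<Sigma>\<^sub>0) < \<delta>" for \<Sigma>
    by (rule le_less_trans[OF SUP_upper sup]) (use that in auto)
  with T show ?thesis by blast
qed

lemma sample_law_prob_space:
  assumes "centered_gaussian P \<Sigma>"
  shows "prob_space (sample_law n \<Sigma>)" "sets (sample_law n \<Sigma>) = sets (PiM {..<n} (\<lambda>_. borel))"
  unfolding sample_law_def gaussian_law_eqI[OF assms]
  by (auto intro!: prob_space_PiM sets_PiM_cong simp: centered_gaussianD[OF assms])

lemma (in spike) sample_law_change_of_measure:
  assumes ev': "blinfun_apply \<Sigma> v = \<kappa> *\<^sub>R v" "\<kappa> > 0"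
    and C: "(\<integral>\<^sup>+x. ennreal (likelihood_ratio (sqrt \<kappa>) \<beta> u v x) ^ 2 \<partial>P) = ennreal C" "C \<ge> 0"
    and A: "A \<in> sets (PiM {..<n} (\<lambda>_. borel))"
  shows "(emeasure (sample_law n \<Sigma>') A)\<^sup>2 \<le> emeasure (sample_law n \<Sigma>) A * ennreal (C ^ n)"
proof -
  let ?L = "\<lambda>x. ennreal (likelihood_ratio (sqrt \<kappa>) \<beta> u v x)"
  have sP[measurable_cong]: "sets P = sets borel" by (rule centered_gaussianD[OF G])
  have d: "distr P borel B = density P ?L"
    by (rule distr_rank_one_eq_density[OF G v ev']) (use \<beta> uv in \<open>simp add: add_pos_nonneg\<close>)
  have s: "sets (PiM {..<n} (\<lambda>_. P)) = sets (PiM {..<n} (\<lambda>_. borel))"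
    by (intro sets_PiM_cong) (auto simp: sP)
  have "(emeasure (PiM {..<n} (\<lambda>_. density P ?L)) A)\<^sup>2 \<le> emeasure (PiM {..<n} (\<lambda>_. P)) A * ennreal C ^ n"
  proof (rule PiM_density_change_of_measure[OF _ _ _ C(1)])
    show "prob_space (density P ?L)"
      using centered_gaussianD(1)[OF centered_gaussian_perturbed] by (simp add: d)
    show "?L \<in> borel_measurable P" by measurable
  qed (use A s centered_gaussianD(1)[OF G] in auto)
  then show ?thesis
    using C(2) by (simp add: sample_law_def gaussian_law_perturbed gaussian_law_eqI[OF G] d ennreal_power)
qed

text \<open>In \<open>small\<close>, the first inequality keeps the alternatives within
  \<open>\<delta>\<close> of \<open>\<Sigma>\<^sub>0\<close> and the second keeps their norm at most
  \<open>a\<close>; both families of perturbations have size at most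
  \<open>\<nu> * sqrt (r / n)\<close>.\<close>

locale spiked_minimax =
  fixes H :: "'h::{real_inner, polish_space} set" and a r \<delta> \<nu> :: real and n :: nat
    and \<Sigma>\<^sub>0 :: "'h \<Rightarrow>\<^sub>L 'h" and P :: "'h measure" and u :: 'h
  assumes H: "subspace H" and S: "\<Sigma>\<^sub>0 \<in> covariance_class H a r" and G: "centered_gaussian P \<Sigma>\<^sub>0"
    and norm_\<Sigma>\<^sub>0: "norm \<Sigma>\<^sub>0 \<le> \<nu>" and u: "u \<in> H" "norm u = 1" and ev: "blinfun_apply \<Sigma>\<^sub>0 u = \<nu> *\<^sub>R u"
    and \<nu>: "0 < \<nu>" "\<nu> \<le> a" and r: "r \<ge> 1" and n: "n \<ge> 1"
    and small: "\<nu> * sqrt (r / n) < \<delta>" "\<nu> * sqrt (r / n) \<le> a - \<nu>"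
begin

lemma \<delta>_pos: "\<delta> > 0"
  by (rule le_less_trans[OF _ small(1)]) (use \<nu> r in auto)

lemma perturbed_admissible:
  assumes "v \<in> H" "norm v = 1" "0 \<le> u \<bullet> v" "0 \<le> \<beta>" "2 * \<beta> + \<beta>\<^sup>2 \<le> sqrt (r / n)"
  shows "perturbed \<Sigma>\<^sub>0 \<nu> \<beta> u v \<in> covariance_class H a r" "norm (perturbed \<Sigma>\<^sub>0 \<nu> \<beta> u v - \<Sigma>\<^sub>0) < \<delta>"
proof -
  interpret sp: spike P \<Sigma>\<^sub>0 \<nu> \<beta> u v
    by unfold_locales (use assms G u ev \<nu> in auto)
  have "\<nu> * (2 * \<beta> + \<beta>\<^sup>2) \<le> \<nu> * sqrt (r / n)" using assms \<nu> by (intro mult_left_mono) auto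
  then show "perturbed \<Sigma>\<^sub>0 \<nu> \<beta> u v \<in> covariance_class H a r" "norm (perturbed \<Sigma>\<^sub>0 \<nu> \<beta> u v - \<Sigma>\<^sub>0) < \<delta>"
    using sp.norm_perturbed_diff small sp.perturbed_in_covariance_class[OF H u(1) assms(1) S norm_\<Sigma>\<^sub>0 r] by auto
qed

text \<open>The scale \<open>h\<close> is left free: \<open>h = a\<close> yields the parametric
  rate, and \<open>h = \<nu> / sqrt n\<close> yields its power with exponent \<open>s\<close>. The
  lower limit on \<open>h\<close> keeps the argument of the sine between 0 and 1.\<close>

lemma two_point_lower_bound:
  assumes s: "s > 0" and h: "\<nu> / sqrt n \<le> h" "h \<le> a"
  shows "minimax_risk H s a r \<delta> n \<Sigma>\<^sub>0 \<ge> ennreal ((h / a) powr s * (\<nu> / (sqrt n * h)) / 32)"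
proof -
  have n0: "sqrt n \<ge> 1" using n by simp
  have h0: "h > 0" by (rule less_le_trans[OF _ h(1)]) (use \<nu> n0 in auto)
  have a0: "a > 0" using h0 h(2) by simp
  \<comment> \<open>With this constant the relative change \<open>\<eta>\<close> of the variance
    along \<open>u\<close> is at most \<open>3 * \<beta>\<close>, so
    \<open>n * \<eta>\<^sup>2 \<le> 9 / 16\<close>, inside the range of
    \<open>inverse_sqrt_power_le_2\<close>.\<close>
  define \<beta> where "\<beta> = 1 / (4 * sqrt n)"
  have \<beta>: "0 < \<beta>" "\<beta> \<le> 1 / 4" using n0 by (auto simp: \<beta>_def field_simps)
  have \<beta>2: "\<beta>\<^sup>2 \<le> \<beta> / 4" using \<beta> by (simp add: power2_eq_square)
  have \<beta>n: "sqrt n * \<beta> = 1 / 4" using n0 by (simp add: \<beta>_def)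
  have b1: "2 * \<beta> + \<beta>\<^sup>2 \<le> sqrt (r / n)"
  proof -
    have "2 * \<beta> + \<beta>\<^sup>2 \<le> 4 * \<beta>" using \<beta> \<beta>2 by linarith
    also have "\<dots> = sqrt (1 / n)" by (simp add: \<beta>_def real_sqrt_divide)
    also have "\<dots> \<le> sqrt (r / n)" using r by (simp add: divide_right_mono)
    finally show ?thesis .
  qed
  interpret sp: spike P \<Sigma>\<^sub>0 \<nu> \<beta> u u
    by unfold_locales (use \<beta> G u ev \<nu> in auto)
  \<comment> \<open>The phase places \<open>\<Sigma>\<^sub>0\<close> at a zero of the sine, where it
    is steepest.\<close>
  define F where "F = (\<lambda>A :: 'h \<Rightarrow>\<^sub>L 'h. sin (blinfun_apply A u \<bullet> u + (- \<nu> / h)))"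
  have F: "bounded_smooth UNIV (nat \<lceil>s\<rceil>) 1 F"
  proof -
    have "bounded_smooth ((\<lambda>A :: 'h \<Rightarrow>\<^sub>L 'h. blinfun_apply A u + 0) -` UNIV) (nat \<lceil>s\<rceil>) 1
       (\<lambda>A. (\<lambda>y. sin (y \<bullet> u + (- \<nu> / h))) (blinfun_apply A u + 0))"
    proof (rule bounded_smooth_compose_affine)
      show "bounded_linear (\<lambda>A :: 'h \<Rightarrow>\<^sub>L 'h. blinfun_apply A u)" by (rule blinfun.bounded_linear_left)
      show "norm (blinfun_apply A u) \<le> norm A" for A :: "'h \<Rightarrow>\<^sub>L 'h" using norm_blinfun[of A u] u by simp
      show "bounded_smooth UNIV (nat \<lceil>s\<rceil>) 1 (\<lambda>y. sin (y \<bullet> u + (- \<nu> / h)))"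
        by (rule bounded_smooth_sin_inner) (use u in simp)
    qed auto
    then show ?thesis by (simp add: F_def)
  qed
  define f where "f = (\<lambda>A. (h / a) powr s / (2 * 1) * F (A /\<^sub>R h))"
  have hf: "holder_norm V s a U f \<le> 1" for V U
    unfolding f_def by (rule holder_norm_le_1[OF s h0 h(2) _ F]) simp
  define x where "x = \<nu> * (2 * \<beta> + \<beta>\<^sup>2) / h"
  have x: "\<nu> / (sqrt n * h) / 2 \<le> x" "0 \<le> x" "x \<le> 1"
  proof -
    have "\<nu> / (sqrt n * h) / 2 = \<nu> * (2 * \<beta>) / h" using n0 by (simp add: \<beta>_def)
    also have "\<dots> \<le> x" unfolding x_def using \<nu> h0 \<beta> by (intro divide_right_mono mult_left_mono) auto
    finally show "\<nu> / (sqrt n * h) / 2 \<le> x" .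
    show "0 \<le> x" using \<nu> h0 \<beta> by (simp add: x_def)
    have "\<nu> * (2 * \<beta> + \<beta>\<^sup>2) \<le> \<nu> * (4 * \<beta>)" using \<beta> \<beta>2 \<nu> by (intro mult_left_mono) auto
    also have "\<dots> = \<nu> / sqrt n" by (simp add: \<beta>_def)
    finally show "x \<le> 1" using h(1) h0 by (simp add: x_def)
  qed
  define \<Delta> where "\<Delta> = (h / a) powr s / 2 * sin x"
  have \<Delta>_ge: "(h / a) powr s * (\<nu> / (sqrt n * h)) / 8 \<le> \<Delta>"
  proof -
    have "\<nu> / (sqrt n * h) / 2 / 2 \<le> x / 2" by (rule divide_right_mono[OF x(1)]) simp
    also have "\<dots> \<le> sin x" by (rule sin_ge_half[OF x(2,3)])
    finally have "\<nu> / (sqrt n * h) / 4 \<le> sin x" by simp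
    then have "(h / a) powr s / 2 * (\<nu> / (sqrt n * h) / 4) \<le> \<Delta>" unfolding \<Delta>_def by (intro mult_left_mono) auto
    then show ?thesis by simp
  qed
  have "(h / a) powr s * (\<nu> / (sqrt n * h)) / 8 > 0" using h0 a0 \<nu> n0 by simp
  then have \<Delta>0: "\<Delta> > 0" using \<Delta>_ge by linarith
  have f0: "f \<Sigma>\<^sub>0 = 0" 
  proof -
    have "blinfun_apply (\<Sigma>\<^sub>0 /\<^sub>R h) u \<bullet> u + - \<nu> / h = 0"
      using h0 by (simp add: blinfun.scaleR_left ev sp.uu field_simps)
    then show ?thesis by (simp add: f_def F_def)
  qed
  have f1: "f (perturbed \<Sigma>\<^sub>0 \<nu> \<beta> u u) = \<Delta>"
  proof -
    have "blinfun_apply ((perturbed \<Sigma>\<^sub>0 \<nu> \<beta> u u) /\<^sub>R h) u \<bullet> u + - \<nu> / h = x"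
      unfolding blinfun.scaleR_left sp.perturbed_apply_top
      using h0 by (simp add: sp.uu inner_add_left x_def field_simps power2_eq_square)
    then show ?thesis by (simp add: f_def F_def \<Delta>_def)
  qed
  have "ennreal (\<Delta> / 4) \<le> minimax_risk H s a r \<delta> n \<Sigma>\<^sub>0"
  proof (rule ccontr)
    assume "\<not> ?thesis"
    then obtain T where T: "T \<in> estimators n" "\<And>\<Sigma>. \<Sigma> \<in> covariance_class H a r \<Longrightarrow> norm (\<Sigma> - \<Sigma>\<^sub>0) < \<delta> \<Longrightarrow>
        L2_norm (sample_law n \<Sigma>) (\<lambda>X. T X - f \<Sigma>) < ennreal (\<Delta> / 4)"
      using minimax_risk_lessD[OF _ hf] by (metis not_le)
    define \<eta> where "\<eta> = (1 + \<beta>)\<^sup>2 - 1"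
    have \<eta>: "\<eta> = 2 * \<beta> + \<beta>\<^sup>2" by (simp add: \<eta>_def power2_eq_square algebra_simps)
    have \<eta>n: "0 \<le> \<eta>" "n * \<eta>\<^sup>2 \<le> 3 / 4"
    proof -
      show "0 \<le> \<eta>" using \<beta> by (simp add: \<eta>)
      have "\<eta> \<le> 3 * \<beta>" using \<beta> \<beta>2 by (simp add: \<eta>)
      then have "sqrt n * \<eta> \<le> sqrt n * (3 * \<beta>)" using n0 by (intro mult_left_mono) auto
      then have "(sqrt n * \<eta>)\<^sup>2 \<le> (3 / 4)\<^sup>2"
        using \<beta>n \<open>0 \<le> \<eta>\<close> by (intro power_mono) auto
      then show "n * \<eta>\<^sup>2 \<le> 3 / 4" by (simp add: power_mult_distrib power_divide)
    qed
    have "(1 + \<beta>)\<^sup>2 \<le> (5 / 4)\<^sup>2" using \<beta> by (intro power_mono) auto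
    then have lt2: "(1 + \<beta>)\<^sup>2 < 2" by (simp add: power_divide)
    note sm = likelihood_ratio_second_moment_scale[OF G u(2) ev \<nu>(1) less_imp_le[OF \<beta>(1)] lt2]
    have C: "(1 / sqrt (1 - \<eta>\<^sup>2)) ^ n \<le> 2" by (rule inverse_sqrt_power_le_2[OF \<eta>n n])
    have "\<eta> \<le> 1" using \<beta> \<beta>2 by (simp add: \<eta>)
    then have "\<eta>\<^sup>2 \<le> 1" using \<eta>n by (intro power_le_one)
    then have nn: "1 / sqrt (1 - \<eta>\<^sup>2) \<ge> 0" by simp
    show False
    proof (rule two_point_test[where P = "sample_law n \<Sigma>\<^sub>0" and Q = "sample_law n (perturbed \<Sigma>\<^sub>0 \<nu> \<beta> u u)" and \<Delta> = \<Delta> and T = T])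
      show "(emeasure (sample_law n (perturbed \<Sigma>\<^sub>0 \<nu> \<beta> u u)) A)\<^sup>2 \<le> emeasure (sample_law n \<Sigma>\<^sub>0) A * ennreal 2"
        if "A \<in> sets (PiM {..<n} (\<lambda>_. borel))" for A
        using order_trans[OF sp.sample_law_change_of_measure[OF ev \<nu>(1) sm _ that] mult_left_mono[OF ennreal_leI[OF C[unfolded \<eta>_def]]]]
          nn[unfolded \<eta>_def] by simp
      show "L2_norm (sample_law n \<Sigma>\<^sub>0) (\<lambda>x. T x - 0) < ennreal (\<Delta> / 4)"
        using T(2)[OF S] \<delta>_pos f0 by simp
      show "L2_norm (sample_law n (perturbed \<Sigma>\<^sub>0 \<nu> \<beta> u u)) (\<lambda>x. T x - \<Delta>) < ennreal (\<Delta> / 4)"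
        using T(2)[OF perturbed_admissible[of u \<beta>]] b1 \<beta> u sp.uu f1 by simp
    qed (use T \<Delta>0 sample_law_prob_space[OF G] sample_law_prob_space[OF sp.centered_gaussian_perturbed]
        in \<open>auto simp: estimators_def\<close>)
  qed
  moreover have "(h / a) powr s * (\<nu> / (sqrt n * h)) / 32 \<le> \<Delta> / 4" using \<Delta>_ge by (simp add: mult_ac)
  ultimately show ?thesis by (meson ennreal_leI order_trans)
qed

text \<open>Every alternative moves \<open>\<Sigma>\<^sub>0 u\<close> by
  \<open>\<nu> * \<beta>\<close> in the direction of its sign vector, so bumps of width proportional
  to \<open>\<nu> * \<beta>\<close> can tell the alternatives apart; the bound is the height of
  these bumps up to a constant.\<close>

lemma packing_lower_bound:
  assumes s: "s > 0" and K: "K \<ge> 1"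
    and bump: "bounded_smooth (ball 0 2) (nat \<lceil>s\<rceil>) K (bump p :: 'h \<Rightarrow> real)" "p > 0"
    and \<mu>: "0 < \<mu>" "\<mu> < \<nu>" and dim: "dim (eigenspace H \<Sigma>\<^sub>0 \<mu>) = m" "m \<ge> 4" and mr: "real m + 1 \<le> r" and rn: "r \<le> n"
  shows "minimax_risk H s a r \<delta> n \<Sigma>\<^sub>0 \<ge>
    ennreal ((\<nu> / a * sqrt (\<mu> * (real m + 1) / (64 * \<nu> * n)) / 5) powr s / (8 * K))"
proof -
  define d where "d = real m + 1"
  \<comment> \<open>Chosen so that the exponent \<open>n * x\<close> of the second moment, with
    \<open>x = 2 * \<beta>\<^sup>2 * \<nu> / \<mu>\<close>, equals \<open>d / 32\<close>; the code
    has at least \<open>(4 / 3) ^ m\<close> words, with \<open>m = d - 1\<close>.\<close>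
  define \<beta> where "\<beta> = sqrt (\<mu> * d / (64 * \<nu> * n))"
  have d: "d > 0" "d \<le> n" using mr rn by (auto simp: d_def)
  have n0: "real n > 0" using n by simp
  have \<beta>sq: "\<beta>\<^sup>2 = \<mu> * d / (64 * \<nu> * n)" using \<mu> \<nu> d n0 by (simp add: \<beta>_def)
  have \<beta>0: "\<beta> > 0" using \<mu> \<nu> d n0 by (simp add: \<beta>_def)
  have \<beta>le: "\<beta> \<le> sqrt (r / n) / 8"
  proof -
    have "\<mu> * d / (64 * \<nu> * n) = (\<mu> / \<nu>) * (d / n) / 64" by simp
    also have "\<dots> \<le> 1 * (r / n) / 64"
      using \<mu> d mr n0 by (intro divide_right_mono mult_mono) (auto simp: d_def)
    finally have "\<beta> \<le> sqrt (r / n / 64)" unfolding \<beta>_def by (intro real_sqrt_le_mono) simp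
    also have "sqrt (r / n / 64) = sqrt (r / n) / sqrt (8\<^sup>2)" by (simp only: real_sqrt_divide) simp
    finally show ?thesis by simp
  qed
  have b1: "2 * \<beta> + \<beta>\<^sup>2 \<le> sqrt (r / n)"
  proof -
    have "sqrt (r / n) \<le> 1" using rn n0 r by simp
    then have "\<beta> \<le> 1" using \<beta>le by linarith
    then have "\<beta>\<^sup>2 \<le> \<beta>" using \<beta>0 by (simp add: power2_eq_square)
    then show ?thesis using \<beta>le \<beta>0 by linarith
  qed
  define x where "x = 2 * \<beta>\<^sup>2 * \<nu> / \<mu>"
  have x: "0 \<le> x" "x \<le> 1 / 2" "n * x = d / 32"
  proof -
    have xd: "x = d / (32 * n)" using \<mu> \<nu> n0 by (simp add: x_def \<beta>sq field_simps)
    show "0 \<le> x" "x \<le> 1 / 2" "n * x = d / 32" using d n0 by (auto simp: xd field_simps)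
  qed
  define V where "V = eigenspace H \<Sigma>\<^sub>0 \<mu>"
  have V: "subspace V" unfolding V_def by (rule subspace_eigenspace[OF H])
  have dimV: "0 < m" "dim V = m" using dim by (simp_all add: V_def)
  obtain I :: "'h set" and e where I': "finite I" "card I = m" "\<forall>i\<in>I. e i \<in> V \<and> norm (e i) = 1"
    "\<forall>i\<in>I. \<forall>j\<in>I. i \<noteq> j \<longrightarrow> e i \<bullet> e j = 0"
    using exists_orthonormal_family[OF V dimV] by (elim exE conjE) (rule that)
  have I: "finite I" "card I = m" "\<And>i. i \<in> I \<Longrightarrow> e i \<in> V" "\<And>i. i \<in> I \<Longrightarrow> norm (e i) = 1"
    "\<And>i j. i \<in> I \<Longrightarrow> j \<in> I \<Longrightarrow> i \<noteq> j \<Longrightarrow> e i \<bullet> e j = 0"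
    using I' by blast+
  have cI: "card I > 0" using I(2) dim(2) by simp
  define vec where "vec = sign_vector I e"
  have vec: "vec w \<in> H" "norm (vec w) = 1" "blinfun_apply \<Sigma>\<^sub>0 (vec w) = \<mu> *\<^sub>R vec w" for w
  proof -
    have "vec w \<in> V" unfolding vec_def by (rule sign_vector_in_subspace[OF V I(3)])
    then show "vec w \<in> H" "blinfun_apply \<Sigma>\<^sub>0 (vec w) = \<mu> *\<^sub>R vec w" by (auto simp: V_def eigenspace_def)
    show "norm (vec w) = 1" unfolding vec_def by (rule norm_sign_vector[OF I(1) cI I(4,5)])
  qed
  have uv: "u \<bullet> vec w = 0" for w
  proof -
    have "\<nu> * (u \<bullet> vec w) = \<mu> * (u \<bullet> vec w)"
      using centered_gaussian_symmetric[OF G, of u "vec w"] by (simp add: ev vec(3) inner_commute)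
    then show ?thesis using \<mu> by simp
  qed
  obtain C where C': "C \<subseteq> Pow I" "\<forall>w\<in>C. \<forall>w'\<in>C. w \<noteq> w' \<longrightarrow> card I < 8 * card (sym_diff w w')"
    "(4 / 3) ^ card I \<le> real (card C)"
    using exists_separated_code[OF I(1)] by (elim exE conjE) (rule that)
  have C: "C \<subseteq> Pow I" "\<And>w w'. w \<in> C \<Longrightarrow> w' \<in> C \<Longrightarrow> w \<noteq> w' \<Longrightarrow> card I < 8 * card (sym_diff w w')"
    "(4 / 3) ^ card I \<le> real (card C)"
    using C' by simp_all
  have fC: "finite C" using C(1) I(1) by (auto intro: finite_subset)
  \<comment> \<open>Distinct code vectors have squared distance above 1/2; scaled by 5 this exceeds
    25/2, more than the 9 needed for bumps at distance 3.\<close>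
  define z where "z = (\<lambda>w. 5 *\<^sub>R vec w)"
  have sep: "norm (z w - z w') \<ge> 3" if w: "w \<in> C" "w' \<in> C" "w \<noteq> w'" for w w'
  proof (rule power2_le_imp_le)
    have "(norm (vec w - vec w'))\<^sup>2 = 4 * card (sym_diff w w') / card I"
      unfolding vec_def by (rule norm_sign_vector_diff[OF I(1) cI I(4,5)]) (use w C(1) in auto)
    also have "\<dots> > 1 / 2" using C(2)[OF w] cI by (simp add: field_simps)
    finally have "25 * (norm (vec w - vec w'))\<^sup>2 \<ge> 9" by linarith
    also have "25 * (norm (vec w - vec w'))\<^sup>2 = (norm (z w - z w'))\<^sup>2"
      by (simp add: z_def scaleR_diff_right[symmetric] power_mult_distrib)
    finally show "3\<^sup>2 \<le> (norm (z w - z w'))\<^sup>2" by simp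
  qed simp
  \<comment> \<open>In units of \<open>h\<close> the displacement \<open>\<nu> * \<beta>\<close> has
    length 5, so each alternative sits at the centre \<open>z w\<close> of its own bump.\<close>
  define h where "h = \<nu> * \<beta> / 5"
  have h: "h > 0" "h \<le> a"
  proof -
    show "h > 0" using \<nu> \<beta>0 by (simp add: h_def)
    have "sqrt (r / n) \<le> 1" using rn n0 r by simp
    then have "\<beta> / 5 \<le> 1" using \<beta>le by linarith
    then have "\<nu> * (\<beta> / 5) \<le> a * 1" using \<nu> \<beta>0 by (intro mult_mono) auto
    then show "h \<le> a" by (simp add: h_def)
  qed
  define \<epsilon> where "\<epsilon> = (\<lambda>S (w :: 'h set). if w \<in> S then 1 else - 1 :: real)"
  define F where "F = (\<lambda>S (A :: 'h \<Rightarrow>\<^sub>L 'h). \<Sum>w\<in>C. \<epsilon> S w * bump p ((blinfun_apply A u + - (\<nu> / h) *\<^sub>R u) - z w))"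
  have F: "bounded_smooth UNIV (nat \<lceil>s\<rceil>) K (F S)" for S
  proof -
    have "bounded_smooth ((\<lambda>A :: 'h \<Rightarrow>\<^sub>L 'h. blinfun_apply A u + - (\<nu> / h) *\<^sub>R u) -` UNIV) (nat \<lceil>s\<rceil>) K
       (\<lambda>A. (\<lambda>y. \<Sum>w\<in>C. \<epsilon> S w * bump p (y - z w)) (blinfun_apply A u + - (\<nu> / h) *\<^sub>R u))"
    proof (rule bounded_smooth_compose_affine)
      show "bounded_linear (\<lambda>A :: 'h \<Rightarrow>\<^sub>L 'h. blinfun_apply A u)" by (rule blinfun.bounded_linear_left)
      show "norm (blinfun_apply A u) \<le> norm A" for A :: "'h \<Rightarrow>\<^sub>L 'h" using norm_blinfun[of A u] u by simp
      show "bounded_smooth UNIV (nat \<lceil>s\<rceil>) K (\<lambda>y. \<Sum>w\<in>C. \<epsilon> S w * bump p (y - z w))"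
        by (rule bounded_smooth_bump_sum[OF fC bump(2) K bump(1) sep]) (auto simp: \<epsilon>_def)
    qed (use K in auto)
    then show ?thesis by (simp add: F_def)
  qed
  define f where "f = (\<lambda>S A. (h / a) powr s / (2 * K) * F S (A /\<^sub>R h))"
  have hf: "holder_norm V s a U (f S) \<le> 1" for V U S
    unfolding f_def by (rule holder_norm_le_1[OF s h K F])
  define \<Delta> where "\<Delta> = (h / a) powr s / (2 * K)"
  have \<Delta>0: "\<Delta> > 0" using h K by (simp add: \<Delta>_def)
  define \<Sigma> where "\<Sigma> = (\<lambda>w. perturbed \<Sigma>\<^sub>0 \<nu> \<beta> u (vec w))"
  have sp: "spike P \<Sigma>\<^sub>0 \<nu> \<beta> u (vec w)" for w
    by unfold_locales (use \<beta>0 G u ev \<nu> vec uv in auto)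
  have f\<Sigma>: "f S (\<Sigma> w) = (if w \<in> S then \<Delta> else - \<Delta>)" if w: "w \<in> C" for S w
  proof -
    have hz: "(\<nu> * \<beta>) / h = 5" using \<nu> \<beta>0 by (simp add: h_def)
    have "blinfun_apply (\<Sigma> w /\<^sub>R h) u + - (\<nu> / h) *\<^sub>R u = ((\<nu> * \<beta>) / h) *\<^sub>R vec w"
      unfolding \<Sigma>_def blinfun.scaleR_left spike.perturbed_apply_top[OF sp] uv
      by (simp add: scaleR_add_right divide_inverse mult_ac)
    then have y: "blinfun_apply (\<Sigma> w /\<^sub>R h) u + - (\<nu> / h) *\<^sub>R u = z w" by (simp only: hz z_def)
    have "F S (\<Sigma> w /\<^sub>R h) = (\<Sum>w'\<in>C. \<epsilon> S w' * bump p (z w - z w'))" unfolding F_def y ..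
    also have "\<dots> = (\<Sum>w'\<in>C. if w' = w then \<epsilon> S w else 0)"
    proof (rule sum.cong[OF refl])
      fix w' assume w': "w' \<in> C"
      show "\<epsilon> S w' * bump p (z w - z w') = (if w' = w then \<epsilon> S w else 0)"
      proof (cases "w' = w")
        case True
        then show ?thesis by (simp add: bump_def)
      next
        case False
        then have "norm (z w - z w') \<ge> 1" using sep[OF w w'] by simp
        then show ?thesis using False bump(2) by (simp add: bump_eq_0)
      qed
    qed
    also have "\<dots> = \<epsilon> S w" using fC w by simp
    finally show ?thesis by (simp add: f_def \<Delta>_def \<epsilon>_def)
  qed
  have "ennreal (\<Delta> / 4) \<le> minimax_risk H s a r \<delta> n \<Sigma>\<^sub>0"
  proof (rule ccontr)
    assume "\<not> ?thesis"
    then have "minimax_risk H s a r \<delta> n \<Sigma>\<^sub>0 < ennreal (\<Delta> / 4)" by simp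
    then have "\<forall>S. \<exists>T\<in>estimators n. \<forall>\<Sigma>\<in>covariance_class H a r. norm (\<Sigma> - \<Sigma>\<^sub>0) < \<delta> \<longrightarrow>
        L2_norm (sample_law n \<Sigma>) (\<lambda>X. T X - f S \<Sigma>) < ennreal (\<Delta> / 4)"
      by (intro allI minimax_risk_lessD[OF _ hf])
    then obtain T where T: "\<And>S. T S \<in> estimators n"
      "\<And>S \<Sigma>. \<Sigma> \<in> covariance_class H a r \<Longrightarrow> norm (\<Sigma> - \<Sigma>\<^sub>0) < \<delta> \<Longrightarrow>
        L2_norm (sample_law n \<Sigma>) (\<lambda>X. T S X - f S \<Sigma>) < ennreal (\<Delta> / 4)"
      by metis
    have x1: "2 * \<beta>\<^sup>2 * \<nu> / \<mu> < 1" using x by (simp add: x_def)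
    have C': "(1 / sqrt (1 - x)) ^ n \<le> exp (d / 32)"
      using inverse_sqrt_power_le_exp[OF x(1,2), of n] x(3) by simp
    have nn: "1 / sqrt (1 - x) \<ge> 0" using x by simp
    have gP: "centered_gaussian (distr P borel (\<lambda>y. y + (\<beta> * (y \<bullet> u)) *\<^sub>R vec w)) (\<Sigma> w)" for w
      unfolding \<Sigma>_def by (rule spike.centered_gaussian_perturbed[OF sp])
    have "real (card C) * (9 / 16) \<le> exp (d / 32)"
    proof (rule decoding_bound[where P = "sample_law n \<Sigma>\<^sub>0" and Q = "\<lambda>w. sample_law n (\<Sigma> w)" and T = T
          and M = "PiM {..<n} (\<lambda>_. borel)" and \<Delta> = \<Delta>])
      show "(emeasure (sample_law n (\<Sigma> w)) A)\<^sup>2 \<le> emeasure (sample_law n \<Sigma>\<^sub>0) A * ennreal (exp (d / 32))"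
        if "w \<in> C" "A \<in> sets (PiM {..<n} (\<lambda>_. borel))" for w A
      proof -
        note sm = likelihood_ratio_second_moment_shear[OF G vec(2) u(2) uv vec(3) \<mu>(1) ev \<nu>(1) x1, folded x_def]
        have "(emeasure (sample_law n (\<Sigma> w)) A)\<^sup>2 \<le> emeasure (sample_law n \<Sigma>\<^sub>0) A * ennreal ((1 / sqrt (1 - x)) ^ n)"
          unfolding \<Sigma>_def by (rule spike.sample_law_change_of_measure[OF sp vec(3) \<mu>(1) sm nn that(2)])
        also have "\<dots> \<le> emeasure (sample_law n \<Sigma>\<^sub>0) A * ennreal (exp (d / 32))"
          by (intro mult_left_mono ennreal_leI C') simp
        finally show ?thesis .
      qed
      show "L2_norm (sample_law n (\<Sigma> w)) (\<lambda>x. T S x - (if w \<in> S then \<Delta> else - \<Delta>)) < ennreal (\<Delta> / 4)"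
        if "w \<in> C" for w S
        unfolding f\<Sigma>[OF that, symmetric]
        by (rule T(2)) (use perturbed_admissible[OF vec(1,2), of w \<beta>] b1 \<beta>0 uv in \<open>simp_all add: \<Sigma>_def\<close>)
    qed (use fC T(1) \<Delta>0 sample_law_prob_space[OF G] sample_law_prob_space[OF gP]
        in \<open>auto simp: estimators_def\<close>)
    moreover have "exp (d / 32) < (4 / 3) ^ card I * (9 / 16)"
      using exp_less_four_thirds_power[OF dim(2)] by (simp add: d_def I(2))
    ultimately show False using C(3) by linarith
  qed
  moreover have "\<Delta> / 4 = (\<nu> / a * \<beta> / 5) powr s / (8 * K)" by (simp add: \<Delta>_def h_def mult.commute)
  ultimately show ?thesis by (simp add: \<beta>_def d_def)
qed

end

lemma rate_eq:
  fixes \<gamma>\<^sub>1 \<gamma>\<^sub>2 t s :: real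
  assumes "0 \<le> \<gamma>\<^sub>1" "0 \<le> \<gamma>\<^sub>2" "0 \<le> t"
  shows "\<gamma>\<^sub>1 powr (s / 2) * \<gamma>\<^sub>2 powr (s / 2) * sqrt t powr s = sqrt (\<gamma>\<^sub>1 * \<gamma>\<^sub>2 * t) powr s"
proof -
  have "sqrt x powr s = x powr (s / 2)" if "0 \<le> x" for x :: real
    using that by (simp add: powr_half_sqrt[symmetric] powr_powr)
  then show ?thesis using assms by (simp add: powr_mult mult_nonneg_nonneg)
qed

theorem theorem2p7:
  "\<exists>c\<^sub>1 c\<^sub>2 :: real. c\<^sub>1 \<ge> 1 \<and> c\<^sub>2 > 0 \<and>
     (\<forall>s::real. s > 0 \<longrightarrow> (\<exists>c::real. c > 0 \<and>
       (\<forall>(H :: 'h::{real_inner, polish_space} set) (a::real) (r::real) (\<gamma>\<^sub>1::real) (\<gamma>\<^sub>2::real)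
          (\<delta>::real) (n::nat) (\<Sigma>\<^sub>0 :: 'h \<Rightarrow>\<^sub>L 'h).
          subspace H \<and> closed H \<and> a > 0 \<and> r \<ge> 1 \<and> n \<ge> 1 \<and>
          0 < \<gamma>\<^sub>2 \<and> \<gamma>\<^sub>2 < \<gamma>\<^sub>1 \<and> \<gamma>\<^sub>1 < 1 \<and>
          \<Sigma>\<^sub>0 \<in> covariance_class H a r \<and>
          spiked_covariance H (nat \<lfloor>r\<rfloor>) (\<gamma>\<^sub>1 * a) (\<gamma>\<^sub>2 * a) \<Sigma>\<^sub>0 \<and>
          c\<^sub>1 * \<gamma>\<^sub>1 * a * sqrt (r / real n) < \<delta> \<and>
          \<delta> \<le> min (c\<^sub>2 * min \<gamma>\<^sub>2 (min (\<gamma>\<^sub>1 - \<gamma>\<^sub>2) (1 - \<gamma>\<^sub>1)) * a) 1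
          \<longrightarrow>
          (let U = ball \<Sigma>\<^sub>0 (2 * \<delta>) \<inter> operators_on H in
           SUP f\<in>{f. holder_norm (operators_on H) s a U f \<le> 1}.
           INF T\<in>estimators n.
           SUP \<Sigma>\<in>{\<Sigma>\<in>covariance_class H a r. norm (\<Sigma> - \<Sigma>\<^sub>0) < \<delta>}.
             L2_norm (sample_law n \<Sigma>) (\<lambda>X. T X - f \<Sigma>))
          \<ge> ennreal (c * max (\<gamma>\<^sub>1 / sqrt (real n))
                            (\<gamma>\<^sub>1 powr (s / 2) * \<gamma>\<^sub>2 powr (s / 2) * sqrt (r / real n) powr s)))))"
proof -
  \<comment> \<open>Both \<open>c\<^sub>1\<close> and \<open>c\<^sub>2\<close> are 1; the factors
    \<open>1 *\<close> keep the shape of the theorem for the final instantiation.\<close>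
  have bound: "\<exists>c>0. \<forall>(H :: 'h set) a r \<gamma>\<^sub>1 \<gamma>\<^sub>2 \<delta> n \<Sigma>\<^sub>0.
      subspace H \<and> closed H \<and> a > 0 \<and> r \<ge> 1 \<and> n \<ge> 1 \<and>
      0 < \<gamma>\<^sub>2 \<and> \<gamma>\<^sub>2 < \<gamma>\<^sub>1 \<and> \<gamma>\<^sub>1 < 1 \<and> \<Sigma>\<^sub>0 \<in> covariance_class H a r \<and>
      spiked_covariance H (nat \<lfloor>r\<rfloor>) (\<gamma>\<^sub>1 * a) (\<gamma>\<^sub>2 * a) \<Sigma>\<^sub>0 \<and>
      1 * \<gamma>\<^sub>1 * a * sqrt (r / real n) < \<delta> \<and>
      \<delta> \<le> min (1 * min \<gamma>\<^sub>2 (min (\<gamma>\<^sub>1 - \<gamma>\<^sub>2) (1 - \<gamma>\<^sub>1)) * a) 1 \<longrightarrow>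
      minimax_risk H s a r \<delta> n \<Sigma>\<^sub>0 \<ge> ennreal (c * max (\<gamma>\<^sub>1 / sqrt (real n))
        (\<gamma>\<^sub>1 powr (s / 2) * \<gamma>\<^sub>2 powr (s / 2) * sqrt (r / real n) powr s))"
    if s: "s > 0" for s
  proof -
    obtain K where K: "K \<ge> 1"
      "bounded_smooth (ball 0 2) (nat \<lceil>s\<rceil>) K (bump (Suc (nat \<lceil>s\<rceil>)) :: 'h \<Rightarrow> real)"
      using bounded_smooth_bump[of "nat \<lceil>s\<rceil>" "Suc (nat \<lceil>s\<rceil>)"] by auto
    \<comment> \<open>The 80 absorbs the factors 1/5 and 1/8 of the packing bound and the loss
      \<open>r \<le> 2 * (real m + 1)\<close>; \<open>32 * K\<close> dominates both the 32 of the
      two-point bound and \<open>8 * K\<close>.\<close>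
    define c where "c = (1 / 80) powr s / (32 * K)"
    have c80: "(1 / 80 :: real) powr s \<le> 1" using powr_le1[of s "1 / 80 :: real"] s by simp
    have c0: "c > 0" using K by (simp add: c_def)
    have cK: "c \<le> (1 / 80) powr s / (8 * K)" unfolding c_def using K by (intro divide_left_mono) auto
    have c1: "c \<le> (1 / 80) powr s / 32" unfolding c_def using K by (intro divide_left_mono) auto
    have c32: "c \<le> 1 / 32" using c1 c80 by linarith
    show ?thesis
    proof (intro exI[of _ c] conjI c0 allI impI; (elim conjE)?)
      fix H :: "'h set" and a r \<gamma>\<^sub>1 \<gamma>\<^sub>2 \<delta> :: real and n :: nat and \<Sigma>\<^sub>0 :: "'h \<Rightarrow>\<^sub>L 'h"
      assume H: "subspace H" and a: "a > 0" and r: "r \<ge> 1" and n: "n \<ge> 1"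
        and g: "0 < \<gamma>\<^sub>2" "\<gamma>\<^sub>2 < \<gamma>\<^sub>1" "\<gamma>\<^sub>1 < 1" and S: "\<Sigma>\<^sub>0 \<in> covariance_class H a r"
        and sp: "spiked_covariance H (nat \<lfloor>r\<rfloor>) (\<gamma>\<^sub>1 * a) (\<gamma>\<^sub>2 * a) \<Sigma>\<^sub>0"
        and d1: "1 * \<gamma>\<^sub>1 * a * sqrt (r / real n) < \<delta>"
        and d2: "\<delta> \<le> min (1 * min \<gamma>\<^sub>2 (min (\<gamma>\<^sub>1 - \<gamma>\<^sub>2) (1 - \<gamma>\<^sub>1)) * a) 1"
      define \<nu> where "\<nu> = \<gamma>\<^sub>1 * a"
      have \<nu>: "0 < \<nu>" "\<nu> \<le> a" using g a by (auto simp: \<nu>_def)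
      have n0: "real n > 0" using n by simp
      have dle: "\<delta> \<le> \<gamma>\<^sub>2 * a" "\<delta> \<le> (1 - \<gamma>\<^sub>1) * a"
      proof -
        have "min \<gamma>\<^sub>2 (min (\<gamma>\<^sub>1 - \<gamma>\<^sub>2) (1 - \<gamma>\<^sub>1)) * a \<le> \<gamma>\<^sub>2 * a"
          "min \<gamma>\<^sub>2 (min (\<gamma>\<^sub>1 - \<gamma>\<^sub>2) (1 - \<gamma>\<^sub>1)) * a \<le> (1 - \<gamma>\<^sub>1) * a"
          using a by (intro mult_right_mono; simp)+
        then show "\<delta> \<le> \<gamma>\<^sub>2 * a" "\<delta> \<le> (1 - \<gamma>\<^sub>1) * a" using d2 by linarith+
      qed
      obtain P where G: "centered_gaussian P \<Sigma>\<^sub>0"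
        using S by (auto simp: covariance_class_def covariance_operator_on_def)
      obtain u where u: "u \<in> H" "norm u = 1" "blinfun_apply \<Sigma>\<^sub>0 u = \<nu> *\<^sub>R u"
        using spiked_covariance_top_eigenvector[OF H sp] by (auto simp: \<nu>_def)
      interpret spiked_minimax H a r \<delta> \<nu> n \<Sigma>\<^sub>0 P u
      proof
        show "norm \<Sigma>\<^sub>0 \<le> \<nu>" using spiked_covariance_norm[OF H sp] by (simp add: \<nu>_def)
        show "\<nu> * sqrt (r / n) < \<delta>" using d1 by (simp add: \<nu>_def)
        then show "\<nu> * sqrt (r / n) \<le> a - \<nu>" using dle(2) by (simp add: \<nu>_def algebra_simps)
      qed (use H S G u \<nu> r n in auto)
      \<comment> \<open>The two conditions on \<open>\<delta>\<close> are compatible only if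
        \<open>\<nu> * sqrt (r / n) < \<gamma>\<^sub>2 * a\<close>, and the right side is below
        \<open>\<nu>\<close>.\<close>
      have rn: "r \<le> n"
      proof -
        have "\<nu> * sqrt (r / n) < \<nu> * 1"
          using small(1) dle(1) mult_strict_right_mono[OF g(2) a] by (simp add: \<nu>_def)
        then have "sqrt (r / n) < 1" using \<nu> by (simp only: mult_less_cancel_left_pos)
        then show ?thesis using n0 by simp
      qed
      have n1: "\<nu> / sqrt n \<le> a"
      proof -
        have "\<nu> / sqrt n \<le> \<nu> / 1" using \<nu> n by (intro divide_left_mono) auto
        then show ?thesis using \<nu> by simp
      qed
      have A: "ennreal (c * (\<gamma>\<^sub>1 / sqrt n)) \<le> minimax_risk H s a r \<delta> n \<Sigma>\<^sub>0"
      proof (rule order_trans[OF ennreal_leI two_point_lower_bound[OF s n1 order_refl]])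
        have "c * (\<gamma>\<^sub>1 / sqrt n) \<le> 1 / 32 * (\<gamma>\<^sub>1 / sqrt n)" using c32 g by (intro mult_right_mono) auto
        also have "\<dots> = (a / a) powr s * (\<nu> / (sqrt n * a)) / 32" using a by (simp add: \<nu>_def)
        finally show "c * (\<gamma>\<^sub>1 / sqrt n) \<le> (a / a) powr s * (\<nu> / (sqrt n * a)) / 32" .
      qed
      define q where "q = sqrt (\<gamma>\<^sub>1 * \<gamma>\<^sub>2 * (r / n))"
      have q0: "q \<ge> 0" using g r by (simp add: q_def)
      have q80: "(q / 80) powr s = (1 / 80) powr s * q powr s"
        using q0 powr_mult[of "1 / 80" q s] by simp
      have B: "ennreal (c * q powr s) \<le> minimax_risk H s a r \<delta> n \<Sigma>\<^sub>0"
      proof (cases "nat \<lfloor>r\<rfloor> \<ge> 5")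
        case False
        then have r5: "r \<le> 9" using r by linarith
        \<comment> \<open>Here \<open>r\<close> is bounded, so \<open>q\<close> is at most a
          constant times \<open>\<gamma>\<^sub>1 / sqrt n\<close>, and two points at this scale
          suffice.\<close>
        define h where "h = \<nu> / sqrt n"
        have h: "h > 0" "h / a = \<gamma>\<^sub>1 / sqrt n" "\<nu> / (sqrt n * h) = 1" using \<nu> n0 a by (auto simp: h_def \<nu>_def)
        have "q / 80 \<le> h / a"
        proof -
          have "\<gamma>\<^sub>1 * \<gamma>\<^sub>2 * (r / n) \<le> \<gamma>\<^sub>1 * \<gamma>\<^sub>1 * (9 / n)"
            using g r r5 n0 by (intro mult_mono divide_right_mono mult_left_mono) auto
          then have "q \<le> sqrt (\<gamma>\<^sub>1\<^sup>2 * 3\<^sup>2 / n)" unfolding q_def by (intro real_sqrt_le_mono) (simp add: power2_eq_square)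
          also have "\<dots> = 3 * (\<gamma>\<^sub>1 / sqrt n)"
            using g by (simp add: real_sqrt_divide real_sqrt_mult)
          finally show ?thesis using q0 h by simp
        qed
        then have "(q / 80) powr s \<le> (h / a) powr s" using q0 s by (intro powr_mono2) auto
        then have "(1 / 80) powr s / 32 * q powr s \<le> (h / a) powr s / 32" by (simp add: q80)
        moreover have "c * q powr s \<le> (1 / 80) powr s / 32 * q powr s" using c1 by (intro mult_right_mono) auto
        ultimately have "c * q powr s \<le> (h / a) powr s * (\<nu> / (sqrt n * h)) / 32" unfolding h(3) by simp
        then show ?thesis
          by (rule order_trans[OF ennreal_leI two_point_lower_bound[OF s]]) (use n1 in \<open>auto simp: h_def\<close>)
      next
        case True
        \<comment> \<open>The multiplicity of the smaller eigenvalue: the spike takes one of the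
          dimensions counted by the integer part of \<open>r\<close>.\<close>
        define m where "m = nat \<lfloor>r\<rfloor> - 1"
        have m: "m \<ge> 4" "real m + 1 \<le> r" "r \<le> 2 * (real m + 1)"
        proof -
          have nf: "real (nat \<lfloor>r\<rfloor>) = of_int \<lfloor>r\<rfloor>" using r by simp
          have rm: "real m + 1 = real (nat \<lfloor>r\<rfloor>)" using True by (simp add: m_def of_nat_diff)
          show "m \<ge> 4" using True by (simp add: m_def)
          have "1 \<le> \<lfloor>r\<rfloor>" using r by simp
          then have "1 \<le> (of_int \<lfloor>r\<rfloor> :: real)" by linarith
          then show "real m + 1 \<le> r" "r \<le> 2 * (real m + 1)"
            unfolding rm nf using real_of_int_floor_add_one_gt[of r] by linarith+
        qed
        have dm: "dim (eigenspace H \<Sigma>\<^sub>0 (\<gamma>\<^sub>2 * a)) = m" using sp by (simp add: spiked_covariance_def m_def)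
        have \<mu>: "0 < \<gamma>\<^sub>2 * a" "\<gamma>\<^sub>2 * a < \<nu>" using g a by (auto simp: \<nu>_def)
        define w where "w = \<nu> / a * sqrt (\<gamma>\<^sub>2 * a * (real m + 1) / (64 * \<nu> * n)) / 5"
        have "q / 80 \<le> w"
        proof (rule power2_le_imp_le)
          have "(q / 80)\<^sup>2 = \<gamma>\<^sub>1 * \<gamma>\<^sub>2 * (r / n) / 6400" using g r by (simp add: q_def power_divide)
          also have "\<dots> \<le> \<gamma>\<^sub>1 * \<gamma>\<^sub>2 * (2 * (real m + 1) / n) / 6400"
            using g m(3) n0 by (intro divide_right_mono mult_left_mono) auto
          also have "\<dots> \<le> \<gamma>\<^sub>1 * \<gamma>\<^sub>2 * (4 * (real m + 1) / n) / 6400"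
            using g n0 by (intro divide_right_mono mult_left_mono) auto
          also have "\<dots> = \<gamma>\<^sub>1\<^sup>2 * (\<gamma>\<^sub>2 * (real m + 1) / (64 * \<gamma>\<^sub>1 * n)) / 25"
            using g n0 by (simp add: power2_eq_square field_simps)
          also have "\<dots> = w\<^sup>2"
            using g a n0 by (simp add: w_def power_mult_distrib power_divide \<nu>_def)
          finally show "(q / 80)\<^sup>2 \<le> w\<^sup>2" .
          show "0 \<le> w" using g a \<nu> by (simp add: w_def)
        qed
        then have "(q / 80) powr s \<le> w powr s" using q0 s by (intro powr_mono2) auto
        then have "(1 / 80) powr s / (8 * K) * q powr s \<le> w powr s / (8 * K)"
          using K divide_right_mono[of "(q / 80) powr s" "w powr s" "8 * K"] by (simp add: q80)
        moreover have "c * q powr s \<le> (1 / 80) powr s / (8 * K) * q powr s" using cK by (intro mult_right_mono) auto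
        ultimately have "c * q powr s \<le> w powr s / (8 * K)" by linarith
        then show ?thesis
          unfolding w_def
          by (rule order_trans[OF ennreal_leI packing_lower_bound[OF s K zero_less_Suc \<mu> dm m(1,2) rn]])
      qed
      have "\<gamma>\<^sub>1 powr (s / 2) * \<gamma>\<^sub>2 powr (s / 2) * sqrt (r / n) powr s = q powr s"
        unfolding q_def by (rule rate_eq) (use g r in auto)
      then show "ennreal (c * max (\<gamma>\<^sub>1 / sqrt (real n))
          (\<gamma>\<^sub>1 powr (s / 2) * \<gamma>\<^sub>2 powr (s / 2) * sqrt (r / real n) powr s)) \<le> minimax_risk H s a r \<delta> n \<Sigma>\<^sub>0"
        using A B by (simp add: max_def)
    qed
  qed
  show ?thesis
    unfolding Let_def minimax_risk_def[symmetric]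
    by (intro exI[of _ 1] conjI allI impI bound) auto
qed

end
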